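(* Let $(M,\theta)$ be a Sasakian manifold whose Tanaka-Webster connection $\nabla$ is complete, and let $\gamma$ be a $\nabla$-geodesic in $M$, with parameter $t$ starting at $0$, parameterized by arc length. Then every Jacobi field $V$ along $\gamma$ can be uniquely decomposed in the form $$V=a\gamma'+bt\gamma'+W,$$ where $a,b\in\mathbb{R}$ and $W$ is a Jacobi field along $\gamma$ such that $$\langle W,\gamma'\rangle_{\gamma(t)}=2\langle\xi,\gamma'\rangle\int_0^t\langle V,J\gamma'\rangle\,dt\quad\text{for all } t.$$ In particular, if either (i) $\gamma$ is horizontal, or (ii) $V_{\gamma(t)}\perp J\gamma'(t)$ for every $t$, then $W$ is perpendicular to $\gamma$ (i.e. $\langle W,\gamma'\rangle\equiv0$).
   Context: A pseudo-Hermitian manifold $(M,H(M),J,\theta)$ (written $(M,\theta)$) consists of a connected orientable smooth manifold $M$ of real dimension $2m+1$, a smooth rank-$2m$ subbundle $H(M)\subset TM$ with a smooth complex structure $J:H(M)\to H(M)$, $J^2=-1$, such that $H^{1,0}M=\{X-iJX: X\in H(M)\}\subset TM\otimes\mathbb{C}$ satisfies $[\Gamma(H^{1,0}M),\Gamma(H^{1,0}M)]\subset\Gamma(H^{1,0}M)$, and a nowhere vanishing real $1$-form $\theta$ with $\ker\theta=H(M)$ such that the Levi form $L_\theta(X,Y)=d\theta(X,JY)$ is positive definite on $H(M)$. Convention: $d\theta(X,Y)=\frac12\{X\theta(Y)-Y\theta(X)-\theta([X,Y])\}$. The Reeb field $\xi$ is the unique vector field with $\theta(\xi)=1$, $d\theta(\xi,\cdot)=0$;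 so $TM=\mathbb{R}\xi\oplus H(M)$ (vertical and horizontal directions); $J$ is extended by $J\xi=0$. The Webster metric is the Riemannian metric $g_\theta=\langle\cdot,\cdot\rangle=\theta\otimes\theta+G_\theta$, where $G_\theta(X,Y)=L_\theta(\pi_HX,\pi_HY)$ and $\pi_H:TM\to H(M)$ is the projection along $\xi$; then $d\theta(X,Y)=\langle JX,Y\rangle$. The Tanaka-Webster connection $\nabla$ is the unique linear connection such that $\nabla$ preserves $H(M)$, $\nabla g_\theta=0$, $\nabla J=0$ (hence $\nabla\xi=0$, $\nabla\theta=0$), and its torsion $T_\nabla(X,Y)=\nabla_XY-\nabla_YX-[X,Y]$ satisfies $T_\nabla(X,Y)=2d\theta(X,Y)\xi$ and $T_\nabla(\xi,JX)+JT_\nabla(\xi,X)=0$ for $X,Y\in H(M)$. The manifold is Sasakian if $\tau(X):=T_\nabla(\xi,X)$ vanishes identically. The curvature is $R(X,Y)Z=\nabla_X\nabla_YZ-\nabla_Y\nabla_XZ-\nabla_{[X,Y]}Z$. A $\nabla$-geodesic is a curve $\gamma$ with $\nabla_{\gamma'}\gamma'=0$; along it $\langle\xi,\gamma'\rangle$ is constant. It is horizontal if $\gamma'\perp\xi$. $(M,\nabla)$ is complete if every $\nabla$-geodesic extends to all $t\in\mathbb{R}$. A Jacobi field along a $\nabla$-geodesic $\gamma$ is a vector field $V$ along $\gamma$ satisfying $\nabla_{\gamma'}\nabla_{\gamma'}V=R(\gamma',V)\gamma'+\nabla_{\gamma'}(T_\nabla(\gamma',V))$. *)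

theory Defs
  imports "HOL-Analysis.Analysis" "HOL-Library.Function_Algebras"
begin

section \<open>Pointwise real vector space structure on functions\<close>

instantiation "fun" :: (type, real_vector) real_vector
begin

definition scaleR_fun :: "real \<Rightarrow> ('a \<Rightarrow> 'b) \<Rightarrow> 'a \<Rightarrow> 'b" where
  "scaleR_fun c f = (\<lambda>x. c *\<^sub>R f x)"

instance
  by standard (auto simp: scaleR_fun_def fun_eq_iff scaleR_add_right scaleR_add_left)

end


section \<open>Smooth maps between Euclidean spaces\<close>

text \<open>The sets \<open>S\<close> used below are open sets, or relatively open subsets of nondegenerate real
  intervals (where derivatives at an end point are one-sided); on these the derivative is unique.\<close>

fun Ck_on :: "nat \<Rightarrow> 'b::euclidean_space set \<Rightarrow> ('b \<Rightarrow> 'c::real_normed_vector) \<Rightarrow> bool" where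
  "Ck_on 0 S f \<longleftrightarrow> continuous_on S f"
| "Ck_on (Suc k) S f \<longleftrightarrow>
     (\<exists>f'. (\<forall>x\<in>S. (f has_derivative f' x) (at x within S)) \<and> (\<forall>v. Ck_on k S (\<lambda>x. f' x v)))"

definition smooth_on :: "'b::euclidean_space set \<Rightarrow> ('b \<Rightarrow> 'c::real_normed_vector) \<Rightarrow> bool" where
  "smooth_on S f \<longleftrightarrow> (\<forall>k. Ck_on k S f)"


section \<open>Smooth manifolds\<close>

text \<open>The underlying set of the manifold is the whole type \<open>'a\<close>; its Hausdorff and second
  countability properties are imposed by type classes. An atlas need not be maximal.\<close>

type_synonym ('a, 'n) chart = "'a set \<times> ('a \<Rightarrow> real ^ 'n)"

definition smooth_atlas :: "('a::topological_space, 'n::finite) chart set \<Rightarrow> bool" where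
  "smooth_atlas A \<longleftrightarrow>
     (\<forall>(U, \<phi>)\<in>A. open U \<and> open (\<phi> ` U) \<and> homeomorphism U (\<phi> ` U) \<phi> (inv_into U \<phi>)) \<and>
     (\<Union>(U, \<phi>)\<in>A. U) = UNIV \<and>
     (\<forall>(U, \<phi>)\<in>A. \<forall>(V, \<psi>)\<in>A. smooth_on (\<phi> ` (U \<inter> V)) (\<psi> \<circ> inv_into U \<phi>))"

definition orientable :: "('a::topological_space, 'n::finite) chart set \<Rightarrow> bool" where
  "orientable A \<longleftrightarrow>
     (\<exists>B. smooth_atlas B \<and> smooth_atlas (A \<union> B) \<and>
        (\<forall>(U, \<phi>)\<in>B. \<forall>(V, \<psi>)\<in>B. \<forall>x\<in>\<phi> ` (U \<inter> V).
           det (matrix (frechet_derivative (\<psi> \<circ> inv_into U \<phi>) (at x))) > 0))"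

definition smooth_fun ::
  "('a::topological_space, 'n::finite) chart set \<Rightarrow> 'a set \<Rightarrow> ('a \<Rightarrow> real) \<Rightarrow> bool" where
  "smooth_fun A W f \<longleftrightarrow> (\<forall>(U, \<phi>)\<in>A. smooth_on (\<phi> ` (U \<inter> W)) (f \<circ> inv_into U \<phi>))"

definition smooth_near ::
  "('a::topological_space, 'n::finite) chart set \<Rightarrow> 'a \<Rightarrow> ('a \<Rightarrow> real) \<Rightarrow> bool" where
  "smooth_near A p f \<longleftrightarrow> (\<exists>W. open W \<and> p \<in> W \<and> smooth_fun A W f)"

definition smooth_curve ::
  "('a::topological_space, 'n::finite) chart set \<Rightarrow> real set \<Rightarrow> (real \<Rightarrow> 'a) \<Rightarrow> bool" where
  "smooth_curve A I \<gamma> \<longleftrightarrow>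
     continuous_on I \<gamma> \<and> (\<forall>(U, \<phi>)\<in>A. smooth_on (I \<inter> \<gamma> -` U) (\<phi> \<circ> \<gamma>))"


section \<open>Tangent vectors and vector fields\<close>

text \<open>A tangent vector at \<open>p\<close> is the directional derivative along a smooth curve through \<open>p\<close>,
  acting on the functions that are smooth near \<open>p\<close>. On all other functions it takes the dummy
  value \<open>0\<close>, so that equality of tangent vectors is equality of HOL functions.\<close>

type_synonym 'a tvec = "('a \<Rightarrow> real) \<Rightarrow> real"
type_synonym 'a vfield = "'a \<Rightarrow> 'a tvec"

definition velocity ::
  "('a::topological_space, 'n::finite) chart set \<Rightarrow> real set \<Rightarrow> (real \<Rightarrow> 'a) \<Rightarrow> real \<Rightarrow> 'a tvec" where
  "velocity A I \<gamma> t =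
     (\<lambda>f. if smooth_near A (\<gamma> t) f then vector_derivative (f \<circ> \<gamma>) (at t within I) else 0)"

definition tangent_space ::
  "('a::topological_space, 'n::finite) chart set \<Rightarrow> 'a \<Rightarrow> 'a tvec set" where
  "tangent_space A p =
     {velocity A {-\<epsilon><..<\<epsilon>} \<sigma> 0 | \<epsilon> \<sigma>. \<epsilon> > 0 \<and> smooth_curve A {-\<epsilon><..<\<epsilon>} \<sigma> \<and> \<sigma> 0 = p}"

definition linear_on :: "'b::real_vector set \<Rightarrow> ('b \<Rightarrow> 'c::real_vector) \<Rightarrow> bool" where
  "linear_on S L \<longleftrightarrow>
     (\<forall>u\<in>S. \<forall>v\<in>S. \<forall>a b. L (a *\<^sub>R u + b *\<^sub>R v) = a *\<^sub>R L u + b *\<^sub>R L v)"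

definition vector_field ::
  "('a::topological_space, 'n::finite) chart set \<Rightarrow> 'a set \<Rightarrow> 'a vfield \<Rightarrow> bool" where
  "vector_field A W X \<longleftrightarrow>
     (\<forall>p\<in>W. X p \<in> tangent_space A p) \<and>
     (\<forall>W' f. open W' \<and> W' \<subseteq> W \<and> smooth_fun A W' f \<longrightarrow> smooth_fun A W' (\<lambda>p. X p f))"

definition lie_bracket ::
  "('a::topological_space, 'n::finite) chart set \<Rightarrow> 'a vfield \<Rightarrow> 'a vfield \<Rightarrow> 'a vfield" where
  "lie_bracket A X Y p =
     (\<lambda>f. if smooth_near A p f then X p (\<lambda>q. Y q f) - Y p (\<lambda>q. X q f) else 0)"

text \<open>Pointwise values of tensorial operators: the common value at \<open>p\<close> of the operator \<open>B\<close> on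
  all smooth local vector fields that extend the given tangent vectors.\<close>

definition tensor2 ::
  "('a::topological_space, 'n::finite) chart set \<Rightarrow> ('a vfield \<Rightarrow> 'a vfield \<Rightarrow> 'a \<Rightarrow> 'b) \<Rightarrow>
     'a \<Rightarrow> 'a tvec \<Rightarrow> 'a tvec \<Rightarrow> 'b" where
  "tensor2 A B p u v =
     (THE r. \<forall>W X Y. open W \<and> p \<in> W \<and> vector_field A W X \<and> vector_field A W Y \<and>
        X p = u \<and> Y p = v \<longrightarrow> B X Y p = r)"

definition tensor3 ::
  "('a::topological_space, 'n::finite) chart set \<Rightarrow>
     ('a vfield \<Rightarrow> 'a vfield \<Rightarrow> 'a vfield \<Rightarrow> 'a \<Rightarrow> 'b) \<Rightarrow>
     'a \<Rightarrow> 'a tvec \<Rightarrow> 'a tvec \<Rightarrow> 'a tvec \<Rightarrow> 'b" where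
  "tensor3 A B p u v w =
     (THE r. \<forall>W X Y Z. open W \<and> p \<in> W \<and> vector_field A W X \<and> vector_field A W Y \<and>
        vector_field A W Z \<and> X p = u \<and> Y p = v \<and> Z p = w \<longrightarrow> B X Y Z p = r)"


section \<open>Differential 1-forms and subbundles\<close>

definition one_form ::
  "('a::topological_space, 'n::finite) chart set \<Rightarrow> ('a \<Rightarrow> 'a tvec \<Rightarrow> real) \<Rightarrow> bool" where
  "one_form A \<theta> \<longleftrightarrow>
     (\<forall>p. linear_on (tangent_space A p) (\<theta> p)) \<and>
     (\<forall>W X. open W \<and> vector_field A W X \<longrightarrow> smooth_fun A W (\<lambda>p. \<theta> p (X p)))"

text \<open>The exterior derivative, with the normalising factor \<open>1/2\<close>.\<close>

definition ext_deriv ::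
  "('a::topological_space, 'n::finite) chart set \<Rightarrow> ('a \<Rightarrow> 'a tvec \<Rightarrow> real) \<Rightarrow>
     'a \<Rightarrow> 'a tvec \<Rightarrow> 'a tvec \<Rightarrow> real" where
  "ext_deriv A \<theta> =
     tensor2 A (\<lambda>X Y p. (X p (\<lambda>q. \<theta> q (Y q)) - Y p (\<lambda>q. \<theta> q (X q))
        - \<theta> p (lie_bracket A X Y p)) / 2)"

definition smooth_subbundle ::
  "('a::topological_space, 'n::finite) chart set \<Rightarrow> nat \<Rightarrow> ('a \<Rightarrow> 'a tvec set) \<Rightarrow> bool" where
  "smooth_subbundle A k H \<longleftrightarrow>
     (\<forall>p. subspace (H p) \<and> H p \<subseteq> tangent_space A p \<and> dim (H p) = k) \<and>
     (\<forall>p. \<exists>W E. open W \<and> p \<in> W \<and> (\<forall>i<k. vector_field A W (E i)) \<and>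
        (\<forall>q\<in>W. H q = span ((\<lambda>i. E i q) ` {..<k})))"

definition smooth_complex_structure ::
  "('a::topological_space, 'n::finite) chart set \<Rightarrow> ('a \<Rightarrow> 'a tvec set) \<Rightarrow>
     ('a \<Rightarrow> 'a tvec \<Rightarrow> 'a tvec) \<Rightarrow> bool" where
  "smooth_complex_structure A H J \<longleftrightarrow>
     (\<forall>p. linear_on (H p) (J p) \<and> (\<forall>v\<in>H p. J p v \<in> H p \<and> J p (J p v) = - v)) \<and>
     (\<forall>W X. open W \<and> vector_field A W X \<and> (\<forall>p\<in>W. X p \<in> H p) \<longrightarrow>
        vector_field A W (\<lambda>p. J p (X p)))"


section \<open>The complexified tangent bundle and integrability\<close>

text \<open>The complex tangent vector \<open>u + i v\<close> is represented by the complex-valued functional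
  \<open>\<lambda>f. u f + i * v f\<close> on real functions; it acts on complex functions by complex linearity.\<close>

type_synonym 'a ctvec = "('a \<Rightarrow> real) \<Rightarrow> complex"
type_synonym 'a cvfield = "'a \<Rightarrow> 'a ctvec"

definition cact :: "'a ctvec \<Rightarrow> ('a \<Rightarrow> complex) \<Rightarrow> complex" where
  "cact Z h = Z (\<lambda>q. Re (h q)) + \<i> * Z (\<lambda>q. Im (h q))"

definition clie_bracket ::
  "('a::topological_space, 'n::finite) chart set \<Rightarrow> 'a cvfield \<Rightarrow> 'a cvfield \<Rightarrow> 'a cvfield" where
  "clie_bracket A Z Z' p =
     (\<lambda>f. if smooth_near A p f then cact (Z p) (\<lambda>q. Z' q f) - cact (Z' p) (\<lambda>q. Z q f) else 0)"

definition H10 ::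
  "('a \<Rightarrow> 'a tvec set) \<Rightarrow> ('a \<Rightarrow> 'a tvec \<Rightarrow> 'a tvec) \<Rightarrow> 'a \<Rightarrow> 'a ctvec set" where
  "H10 H J p = {\<lambda>f. complex_of_real (v f) - \<i> * complex_of_real (J p v f) | v. v \<in> H p}"

definition smooth_csections ::
  "('a::topological_space, 'n::finite) chart set \<Rightarrow> ('a \<Rightarrow> 'a ctvec set) \<Rightarrow> 'a cvfield set" where
  "smooth_csections A E =
     {Z. (\<forall>p. Z p \<in> E p) \<and> vector_field A UNIV (\<lambda>p f. Re (Z p f)) \<and>
        vector_field A UNIV (\<lambda>p f. Im (Z p f))}"

definition integrable_cr ::
  "('a::topological_space, 'n::finite) chart set \<Rightarrow> ('a \<Rightarrow> 'a tvec set) \<Rightarrow>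
     ('a \<Rightarrow> 'a tvec \<Rightarrow> 'a tvec) \<Rightarrow> bool" where
  "integrable_cr A H J \<longleftrightarrow>
     (\<forall>Z\<in>smooth_csections A (H10 H J). \<forall>Z'\<in>smooth_csections A (H10 H J).
        clie_bracket A Z Z' \<in> smooth_csections A (H10 H J))"


section \<open>Pseudo-Hermitian manifolds\<close>

definition levi_form ::
  "('a::topological_space, 'n::finite) chart set \<Rightarrow> ('a \<Rightarrow> 'a tvec \<Rightarrow> 'a tvec) \<Rightarrow>
     ('a \<Rightarrow> 'a tvec \<Rightarrow> real) \<Rightarrow> 'a \<Rightarrow> 'a tvec \<Rightarrow> 'a tvec \<Rightarrow> real" where
  "levi_form A J \<theta> p u v = ext_deriv A \<theta> p u (J p v)"

text \<open>Symmetry of the Levi form is a consequence of integrability and is not required here.\<close>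

definition pseudo_hermitian ::
  "('a::{t2_space,second_countable_topology}, 'n::finite) chart set \<Rightarrow> nat \<Rightarrow>
     ('a \<Rightarrow> 'a tvec set) \<Rightarrow> ('a \<Rightarrow> 'a tvec \<Rightarrow> 'a tvec) \<Rightarrow> ('a \<Rightarrow> 'a tvec \<Rightarrow> real) \<Rightarrow> bool" where
  "pseudo_hermitian A m H J \<theta> \<longleftrightarrow>
     smooth_atlas A \<and> connected (UNIV :: 'a set) \<and> orientable A \<and> CARD('n) = 2 * m + 1 \<and>
     smooth_subbundle A (2 * m) H \<and> smooth_complex_structure A H J \<and> integrable_cr A H J \<and>
     one_form A \<theta> \<and> (\<forall>p. \<exists>v\<in>tangent_space A p. \<theta> p v \<noteq> 0) \<and>
     (\<forall>p. H p = {v \<in> tangent_space A p. \<theta> p v = 0}) \<and>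
     (\<forall>p. \<forall>v\<in>H p. v \<noteq> 0 \<longrightarrow> levi_form A J \<theta> p v v > 0)"

definition reeb_field ::
  "('a::topological_space, 'n::finite) chart set \<Rightarrow> ('a \<Rightarrow> 'a tvec \<Rightarrow> real) \<Rightarrow> 'a vfield \<Rightarrow> bool" where
  "reeb_field A \<theta> \<xi> \<longleftrightarrow>
     vector_field A UNIV \<xi> \<and>
     (\<forall>p. \<theta> p (\<xi> p) = 1 \<and> (\<forall>v\<in>tangent_space A p. ext_deriv A \<theta> p (\<xi> p) v = 0))"

definition horizontal_part ::
  "('a \<Rightarrow> 'a tvec \<Rightarrow> real) \<Rightarrow> 'a vfield \<Rightarrow> 'a \<Rightarrow> 'a tvec \<Rightarrow> 'a tvec" where
  "horizontal_part \<theta> \<xi> p v = v - \<theta> p v *\<^sub>R \<xi> p"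

text \<open>The extension of \<open>J\<close> from \<open>H\<close> to the whole tangent bundle that annihilates \<open>\<xi>\<close>.\<close>

definition extended_J ::
  "('a \<Rightarrow> 'a tvec \<Rightarrow> 'a tvec) \<Rightarrow> ('a \<Rightarrow> 'a tvec \<Rightarrow> real) \<Rightarrow> 'a vfield \<Rightarrow>
     'a \<Rightarrow> 'a tvec \<Rightarrow> 'a tvec" where
  "extended_J J \<theta> \<xi> p v = J p (horizontal_part \<theta> \<xi> p v)"

definition webster_metric ::
  "('a::topological_space, 'n::finite) chart set \<Rightarrow> ('a \<Rightarrow> 'a tvec \<Rightarrow> 'a tvec) \<Rightarrow>
     ('a \<Rightarrow> 'a tvec \<Rightarrow> real) \<Rightarrow> 'a vfield \<Rightarrow> 'a \<Rightarrow> 'a tvec \<Rightarrow> 'a tvec \<Rightarrow> real" where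
  "webster_metric A J \<theta> \<xi> p u v =
     \<theta> p u * \<theta> p v
     + levi_form A J \<theta> p (horizontal_part \<theta> \<xi> p u) (horizontal_part \<theta> \<xi> p v)"


section \<open>Linear connections\<close>

text \<open>\<open>D p v Y\<close> is the covariant derivative at \<open>p\<close> of the local vector field \<open>Y\<close> in the
  direction of the tangent vector \<open>v\<close> at \<open>p\<close>. Since \<open>Y\<close> may be defined only near \<open>p\<close>,
  locality is part of the definition.\<close>

type_synonym 'a connection = "'a \<Rightarrow> 'a tvec \<Rightarrow> 'a vfield \<Rightarrow> 'a tvec"

definition linear_connection ::
  "('a::topological_space, 'n::finite) chart set \<Rightarrow> 'a connection \<Rightarrow> bool" where
  "linear_connection A D \<longleftrightarrow>
     (\<forall>W X Y. open W \<and> vector_field A W X \<and> vector_field A W Y \<longrightarrow>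
        vector_field A W (\<lambda>p. D p (X p) Y)) \<and>
     (\<forall>W p Y. open W \<and> p \<in> W \<and> vector_field A W Y \<longrightarrow>
        linear_on (tangent_space A p) (\<lambda>v. D p v Y)) \<and>
     (\<forall>W p v Y Z. open W \<and> p \<in> W \<and> v \<in> tangent_space A p \<and>
        vector_field A W Y \<and> vector_field A W Z \<longrightarrow>
        D p v (\<lambda>q. Y q + Z q) = D p v Y + D p v Z) \<and>
     (\<forall>W p v f Y. open W \<and> p \<in> W \<and> v \<in> tangent_space A p \<and>
        smooth_fun A W f \<and> vector_field A W Y \<longrightarrow>
        D p v (\<lambda>q. f q *\<^sub>R Y q) = v f *\<^sub>R Y p + f p *\<^sub>R D p v Y) \<and>
     (\<forall>W p v Y Z. open W \<and> p \<in> W \<and> v \<in> tangent_space A p \<and>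
        vector_field A W Y \<and> vector_field A W Z \<and> (\<forall>q\<in>W. Y q = Z q) \<longrightarrow>
        D p v Y = D p v Z)"

definition torsion ::
  "('a::topological_space, 'n::finite) chart set \<Rightarrow> 'a connection \<Rightarrow>
     'a \<Rightarrow> 'a tvec \<Rightarrow> 'a tvec \<Rightarrow> 'a tvec" where
  "torsion A D = tensor2 A (\<lambda>X Y p. D p (X p) Y - D p (Y p) X - lie_bracket A X Y p)"

definition curvature ::
  "('a::topological_space, 'n::finite) chart set \<Rightarrow> 'a connection \<Rightarrow>
     'a \<Rightarrow> 'a tvec \<Rightarrow> 'a tvec \<Rightarrow> 'a tvec \<Rightarrow> 'a tvec" where
  "curvature A D =
     tensor3 A (\<lambda>X Y Z p. D p (X p) (\<lambda>q. D q (Y q) Z) - D p (Y p) (\<lambda>q. D q (X q) Z)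
        - D p (lie_bracket A X Y p) Z)"

definition tanaka_webster ::
  "('a::topological_space, 'n::finite) chart set \<Rightarrow> ('a \<Rightarrow> 'a tvec set) \<Rightarrow>
     ('a \<Rightarrow> 'a tvec \<Rightarrow> 'a tvec) \<Rightarrow> ('a \<Rightarrow> 'a tvec \<Rightarrow> real) \<Rightarrow> 'a vfield \<Rightarrow> 'a connection \<Rightarrow> bool" where
  "tanaka_webster A H J \<theta> \<xi> D \<longleftrightarrow>
     linear_connection A D \<and>
     (\<forall>W p v Y. open W \<and> p \<in> W \<and> v \<in> tangent_space A p \<and>
        vector_field A W Y \<and> (\<forall>q\<in>W. Y q \<in> H q) \<longrightarrow> D p v Y \<in> H p) \<and>
     (\<forall>W p v Y Z. open W \<and> p \<in> W \<and> v \<in> tangent_space A p \<and>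
        vector_field A W Y \<and> vector_field A W Z \<longrightarrow>
        v (\<lambda>q. webster_metric A J \<theta> \<xi> q (Y q) (Z q)) =
          webster_metric A J \<theta> \<xi> p (D p v Y) (Z p) + webster_metric A J \<theta> \<xi> p (Y p) (D p v Z)) \<and>
     (\<forall>W p v Y. open W \<and> p \<in> W \<and> v \<in> tangent_space A p \<and> vector_field A W Y \<longrightarrow>
        D p v (\<lambda>q. extended_J J \<theta> \<xi> q (Y q)) = extended_J J \<theta> \<xi> p (D p v Y)) \<and>
     (\<forall>p. \<forall>u\<in>H p. \<forall>v\<in>H p. torsion A D p u v = (2 * ext_deriv A \<theta> p u v) *\<^sub>R \<xi> p) \<and>
     (\<forall>p. \<forall>u\<in>H p. torsion A D p (\<xi> p) (J p u) + extended_J J \<theta> \<xi> p (torsion A D p (\<xi> p) u) = 0)"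

definition sasakian ::
  "('a::topological_space, 'n::finite) chart set \<Rightarrow> 'a vfield \<Rightarrow> 'a connection \<Rightarrow> bool" where
  "sasakian A \<xi> D \<longleftrightarrow> (\<forall>p. \<forall>v\<in>tangent_space A p. torsion A D p (\<xi> p) v = 0)"


section \<open>Vector fields along curves, geodesics, Jacobi fields\<close>

definition vector_field_along ::
  "('a::topological_space, 'n::finite) chart set \<Rightarrow> real set \<Rightarrow> (real \<Rightarrow> 'a) \<Rightarrow>
     (real \<Rightarrow> 'a tvec) \<Rightarrow> bool" where
  "vector_field_along A I \<gamma> V \<longleftrightarrow>
     (\<forall>t\<in>I. V t \<in> tangent_space A (\<gamma> t)) \<and>
     (\<forall>W f. open W \<and> smooth_fun A W f \<longrightarrow> smooth_on (I \<inter> \<gamma> -` W) (\<lambda>t. V t f))"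

text \<open>The induced covariant derivative of \<open>V\<close> along \<open>\<gamma>\<close> is determined by the Leibniz rule: if
  near \<open>t\<close> one has \<open>V = \<Sum>i<k. c i * (E i \<circ> \<gamma>)\<close> with local vector fields \<open>E i\<close> and real functions
  \<open>c i\<close>, then its value is \<open>\<Sum>i<k. c i' * E i + c i * \<nabla>\<^bsub>\<gamma>'\<^esub> (E i)\<close>, independently of the
  representation. Such representations exist, for example through a coordinate frame.\<close>

definition cov_along ::
  "('a::topological_space, 'n::finite) chart set \<Rightarrow> 'a connection \<Rightarrow> real set \<Rightarrow> (real \<Rightarrow> 'a) \<Rightarrow>
     (real \<Rightarrow> 'a tvec) \<Rightarrow> real \<Rightarrow> 'a tvec" where
  "cov_along A D I \<gamma> V t =
     (THE w. \<forall>W S (k::nat) E c.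
        open W \<and> open S \<and> t \<in> S \<and> \<gamma> ` (I \<inter> S) \<subseteq> W \<and>
        (\<forall>i<k. vector_field A W (E i) \<and> smooth_on (I \<inter> S) (c i)) \<and>
        (\<forall>s\<in>I \<inter> S. V s = (\<Sum>i<k. c i s *\<^sub>R E i (\<gamma> s))) \<longrightarrow>
        w = (\<Sum>i<k. vector_derivative (c i) (at t within I) *\<^sub>R E i (\<gamma> t)
                    + c i t *\<^sub>R D (\<gamma> t) (velocity A I \<gamma> t) (E i)))"

definition geodesic ::
  "('a::topological_space, 'n::finite) chart set \<Rightarrow> 'a connection \<Rightarrow> real set \<Rightarrow>
     (real \<Rightarrow> 'a) \<Rightarrow> bool" where
  "geodesic A D I \<gamma> \<longleftrightarrow>
     is_interval I \<and> interior I \<noteq> {} \<and> smooth_curve A I \<gamma> \<and>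
     (\<forall>t\<in>I. cov_along A D I \<gamma> (velocity A I \<gamma>) t = 0)"

definition complete_connection ::
  "('a::topological_space, 'n::finite) chart set \<Rightarrow> 'a connection \<Rightarrow> bool" where
  "complete_connection A D \<longleftrightarrow>
     (\<forall>I \<gamma>. geodesic A D I \<gamma> \<longrightarrow> (\<exists>\<sigma>. geodesic A D UNIV \<sigma> \<and> (\<forall>t\<in>I. \<sigma> t = \<gamma> t)))"

definition jacobi_field ::
  "('a::topological_space, 'n::finite) chart set \<Rightarrow> 'a connection \<Rightarrow> real set \<Rightarrow> (real \<Rightarrow> 'a) \<Rightarrow>
     (real \<Rightarrow> 'a tvec) \<Rightarrow> bool" where
  "jacobi_field A D I \<gamma> V \<longleftrightarrow>
     vector_field_along A I \<gamma> V \<and>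
     (\<forall>t\<in>I. cov_along A D I \<gamma> (cov_along A D I \<gamma> V) t =
        curvature A D (\<gamma> t) (velocity A I \<gamma> t) (V t) (velocity A I \<gamma> t)
        + cov_along A D I \<gamma> (\<lambda>s. torsion A D (\<gamma> s) (velocity A I \<gamma> s) (V s)) t)"

end

theory Submission
  imports Defs
begin

text \<open>Write \<open>f = \<langle>V, \<gamma>'\<rangle>\<close>. Since \<open>\<nabla>\<close> is metric and \<open>\<gamma>'\<close> is parallel along the geodesic \<open>\<gamma>\<close>, the function
\<open>f\<close> has first derivative \<open>\<langle>\<nabla>V, \<gamma>'\<rangle>\<close> and second derivative \<open>\<langle>\<nabla>\<nabla>V, \<gamma>'\<rangle>\<close>. Insert the Jacobi equation.
The curvature term \<open>\<langle>R(\<gamma>',V)\<gamma>', \<gamma>'\<rangle>\<close> vanishes: apply \<open>[X,Y] = XY - YX\<close> to the function \<open>\<langle>Z,Z\<rangle>\<close>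
(\<open>curvature_metric_zero\<close>). On a Sasakian manifold the torsion is \<open>T(X,Y) = 2 d\<theta>(X,Y) \<xi>\<close> for all \<open>X, Y\<close>,
not only for horizontal ones (\<open>sasakian_torsion\<close>), the field \<open>\<xi>\<close> is parallel (\<open>reeb_parallel\<close>), and
\<open>\<kappa> = \<langle>\<xi>, \<gamma>'\<rangle>\<close> is constant. So the torsion term contributes \<open>2 \<kappa> w'\<close> with \<open>w = d\<theta>(\<gamma>', V)\<close>, and
\<open>f' - 2 \<kappa> w\<close> is a constant \<open>b\<close>. Integration from \<open>0\<close> gives \<open>f(t) = a + b t + 2 \<kappa> \<integral> w\<close>
(\<open>jacobi_velocity_component\<close>), and \<open>w = \<langle>V, J\<gamma>'\<rangle>\<close> (\<open>metric_J\<close>).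

The field \<open>(a + b t) \<gamma>'\<close> is itself a Jacobi field, because \<open>R(\<gamma>',\<gamma>') = 0\<close> and \<open>T(\<gamma>',\<gamma>') = 0\<close>, so
\<open>W = V - (a + b t) \<gamma>'\<close> is the desired Jacobi field. Pairing any decomposition with the unit vector
\<open>\<gamma>'\<close> recovers \<open>a + b t\<close>, which proves uniqueness.

Most of the text builds the calculus behind these few lines. Three points are delicate.
First, \<open>d\<theta>\<close>, the torsion, the curvature and the derivative along a curve are all described as the
common value over all extensions or representations. Each description is meaningful only because
the value does not depend on the choice; both arguments expand everything in a coordinate frame
(\<open>pointwise_determined\<close>, \<open>representation_value\<close>).
Second, the bracket of two vector fields must be tangent, where a tangent vector is the velocity of
a curve. In coordinates the second derivatives cancel by the symmetry of second derivatives, which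
is proved here by the mean value theorem (\<open>frechet_derivative_commute\<close>, \<open>lie_bracket_tangent\<close>).
Third, symmetry of the metric is a consequence of integrability and holds only because of it. The
integrability condition speaks of global sections, so horizontal vectors are extended to global
fields with a smooth bump function (\<open>global_field_extension\<close>, \<open>omega_J_invariant\<close>, \<open>metric_sym\<close>).\<close>

section \<open>Differential calculus of smooth maps\<close>

text \<open>At every point each coordinate direction can be approached inside the set, which makes
Frechet derivatives within the set unique. Open sets and nondegenerate intervals are both of
this kind, so manifolds and curves with end points are treated alike.\<close>

definition derivative_domain :: "'b::euclidean_space set \<Rightarrow> bool" where
  "derivative_domain S \<longleftrightarrow>
     (\<forall>x\<in>S. \<forall>i\<in>Basis. \<forall>e>0. \<exists>d. 0 < \<bar>d\<bar> \<and> \<bar>d\<bar> < e \<and> x + d *\<^sub>R i \<in> S)"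

lemma derivative_domain_unique:
  assumes "derivative_domain S" "x \<in> S"
    "(f has_derivative f') (at x within S)" "(f has_derivative f'') (at x within S)"
  shows "f' = f''"
  using assms by (auto intro!: frechet_derivative_unique_within simp: derivative_domain_def)

lemma derivative_domain_Int_open:
  fixes S :: "'b::euclidean_space set"
  assumes "derivative_domain S" "open N"
  shows "derivative_domain (S \<inter> N)"
  unfolding derivative_domain_def
proof (intro ballI allI impI)
  fix x i :: 'b and e :: real
  assume x: "x \<in> S \<inter> N" and i: "i \<in> Basis" and e: "e > 0"
  obtain r where r: "r > 0" "ball x r \<subseteq> N"
    using assms(2) x openE by blast
  obtain d where d: "0 < \<bar>d\<bar>" "\<bar>d\<bar> < min e r" "x + d *\<^sub>R i \<in> S"
    using assms(1) x i e r unfolding derivative_domain_def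
    by (metis IntE min_less_iff_conj)
  have "x + d *\<^sub>R i \<in> ball x r"
    using d i by (simp add: dist_norm)
  then show "\<exists>d. 0 < \<bar>d\<bar> \<and> \<bar>d\<bar> < e \<and> x + d *\<^sub>R i \<in> S \<inter> N"
    using d r by auto
qed

lemma derivative_domain_UNIV: "derivative_domain (UNIV :: 'b::euclidean_space set)"
  unfolding derivative_domain_def
proof (intro ballI allI impI)
  fix e :: real assume "e > 0"
  then show "\<exists>d. 0 < \<bar>d\<bar> \<and> \<bar>d\<bar> < e \<and> (x::'b) + d *\<^sub>R i \<in> UNIV" for x i
    by (intro exI[of _ "e/2"]) auto
qed

lemma derivative_domain_open: "open (S :: 'b::euclidean_space set) \<Longrightarrow> derivative_domain S"
  using derivative_domain_Int_open[OF derivative_domain_UNIV] by simp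

lemma derivative_domain_interval:
  fixes I :: "real set"
  assumes "is_interval I" "interior I \<noteq> {}"
  shows "derivative_domain I"
  unfolding derivative_domain_def
proof (intro ballI allI impI)
  fix x i e :: real
  assume x: "x \<in> I" and i: "i \<in> Basis" and e: "e > 0"
  obtain c r where r: "r > 0" "ball c r \<subseteq> I"
    using assms(2) by (meson ex_in_conv mem_interior)
  define y where "y = (if x = c then c + r/2 else c)"
  have y: "y \<in> I" "y \<noteq> x"
    using r by (auto simp: y_def dist_norm subset_iff)
  define k where "k = min 1 (e / (2 * \<bar>y - x\<bar>))"
  have k: "0 < k" "k \<le> 1" using y e by (auto simp: k_def)
  have "k * \<bar>y - x\<bar> \<le> e/2"
    using y e by (auto simp: k_def min_def field_simps)
  then have ke: "\<bar>k * (y - x)\<bar> < e" using k e by (simp add: abs_mult)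
  have "(1-k) * x + k * y \<in> I"
    using assms(1) x y k by (auto simp: is_interval_convex_1 convex_alt)
  then have "x + (k * (y - x)) *\<^sub>R i \<in> I"
    using i by (simp add: algebra_simps)
  then show "\<exists>d. 0 < \<bar>d\<bar> \<and> \<bar>d\<bar> < e \<and> x + d *\<^sub>R i \<in> I"
    using ke k y by (intro exI[of _ "k * (y - x)"]) auto
qed

lemma derivative_domain_at_not_bot:
  fixes S :: "real set"
  assumes "derivative_domain S" "t \<in> S"
  shows "at t within S \<noteq> bot"
proof -
  have "t islimpt S"
    unfolding islimpt_approachable
  proof (intro allI impI)
    fix e :: real assume "e > 0"
    then obtain d where "0 < \<bar>d\<bar>" "\<bar>d\<bar> < e" "t + d *\<^sub>R 1 \<in> S"
      using assms(1)[unfolded derivative_domain_def, rule_format, OF assms(2), of 1 e] by auto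
    then show "\<exists>x'\<in>S. x' \<noteq> t \<and> dist x' t < e"
      by (intro bexI[of _ "t + d"]) (auto simp: dist_norm)
  qed
  then show ?thesis by (simp add: trivial_limit_within)
qed

lemma at_within_Int_open_eq: "open N \<Longrightarrow> x \<in> N \<Longrightarrow> at x within (S \<inter> N) = at x within S"
  by (rule at_within_nhd[of _ N]) auto

declare Ck_on.simps [simp del]

lemma Ck_on_SucI:
  "(\<And>x. x \<in> S \<Longrightarrow> (f has_derivative f' x) (at x within S)) \<Longrightarrow>
     (\<And>v. Ck_on k S (\<lambda>x. f' x v)) \<Longrightarrow> Ck_on (Suc k) S f"
  unfolding Ck_on.simps(2) by blast

lemma Ck_on_SucE:
  assumes "Ck_on (Suc k) S f"
  obtains f' where "\<And>x. x \<in> S \<Longrightarrow> (f has_derivative f' x) (at x within S)"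
    "\<And>v. Ck_on k S (\<lambda>x. f' x v)"
proof -
  obtain f' where f': "\<forall>x\<in>S. (f has_derivative f' x) (at x within S)" "\<forall>v. Ck_on k S (\<lambda>x. f' x v)"
    using assms unfolding Ck_on.simps(2) by blast
  show ?thesis by (rule that[OF f'(1)[rule_format] f'(2)[rule_format]])
qed

lemma Ck_on_subset: "Ck_on k S f \<Longrightarrow> T \<subseteq> S \<Longrightarrow> Ck_on k T f"
proof (induction k arbitrary: f)
  case 0 then show ?case using continuous_on_subset unfolding Ck_on.simps by blast
next
  case (Suc k)
  obtain f' where f: "\<And>x. x \<in> S \<Longrightarrow> (f has_derivative f' x) (at x within S)"
    "\<And>v. Ck_on k S (\<lambda>x. f' x v)" using Ck_on_SucE[OF Suc.prems(1)] by blast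
  show ?case
  proof (rule Ck_on_SucI)
    show "(f has_derivative f' x) (at x within T)" if "x \<in> T" for x
      using f(1)[of x] that Suc.prems(2) has_derivative_subset by blast
    show "Ck_on k T (\<lambda>x. f' x v)" for v
      using Suc.IH f(2) Suc.prems(2) .
  qed
qed

lemma Ck_on_Suc_D: "Ck_on (Suc k) S f \<Longrightarrow> Ck_on k S f"
proof (induction k arbitrary: f)
  case 0
  then show ?case by (auto simp: Ck_on.simps continuous_on_eq_continuous_within intro: has_derivative_continuous)
next
  case (Suc k)
  obtain f' where f: "\<And>x. x \<in> S \<Longrightarrow> (f has_derivative f' x) (at x within S)"
    "\<And>v. Ck_on (Suc k) S (\<lambda>x. f' x v)" using Ck_on_SucE[OF Suc.prems] by blast
  show ?case by (rule Ck_on_SucI[OF f(1) Suc.IH[OF f(2)]])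
qed

lemma Ck_on_cong:
  assumes eq: "\<And>x. x \<in> S \<Longrightarrow> f x = g x" and f: "Ck_on k S f"
  shows "Ck_on k S g"
proof (cases k)
  case 0 then show ?thesis using f continuous_on_cong[of S S f g] eq by (simp add: Ck_on.simps)
next
  case (Suc j)
  obtain f' where f': "\<And>x. x \<in> S \<Longrightarrow> (f has_derivative f' x) (at x within S)"
    "\<And>v. Ck_on j S (\<lambda>x. f' x v)" using Ck_on_SucE[OF f[unfolded Suc]] by blast
  show ?thesis
    unfolding Suc
  proof (rule Ck_on_SucI[OF _ f'(2)])
    show "(g has_derivative f' x) (at x within S)" if "x \<in> S" for x
      using has_derivative_transform[OF that _ f'(1)[OF that]] eq by simp
  qed
qed

lemma Ck_on_const: "Ck_on k S (\<lambda>x. c)"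
proof (induction k arbitrary: c)
  case (Suc k)
  then show ?case by (intro Ck_on_SucI[where f' = "\<lambda>_ _. 0"]) auto
qed (simp add: Ck_on.simps)

lemma Ck_on_linear: "bounded_linear L \<Longrightarrow> Ck_on k S L"
  by (cases k) (auto simp: Ck_on.simps intro!: exI[of _ "\<lambda>_. L"] Ck_on_const linear_continuous_on
      bounded_linear_imp_has_derivative)

lemma Ck_on_add: "Ck_on k S f \<Longrightarrow> Ck_on k S g \<Longrightarrow> Ck_on k S (\<lambda>x. f x + g x)"
proof (induction k arbitrary: f g)
  case 0 then show ?case by (auto simp: Ck_on.simps intro: continuous_on_add)
next
  case (Suc k)
  obtain f' where f: "\<And>x. x \<in> S \<Longrightarrow> (f has_derivative f' x) (at x within S)"
    "\<And>v. Ck_on k S (\<lambda>x. f' x v)" using Ck_on_SucE[OF Suc.prems(1)] by blast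
  obtain g' where g: "\<And>x. x \<in> S \<Longrightarrow> (g has_derivative g' x) (at x within S)"
    "\<And>v. Ck_on k S (\<lambda>x. g' x v)" using Ck_on_SucE[OF Suc.prems(2)] by blast
  show ?case
  proof (rule Ck_on_SucI)
    show "((\<lambda>x. f x + g x) has_derivative (\<lambda>v. f' x v + g' x v)) (at x within S)" if "x \<in> S" for x
      using has_derivative_add[OF f(1)[OF that] g(1)[OF that]] .
    show "Ck_on k S (\<lambda>x. f' x v + g' x v)" for v
      by (rule Suc.IH[OF f(2) g(2)])
  qed
qed

lemma Ck_on_sum: "(\<And>i. i \<in> B \<Longrightarrow> Ck_on k S (f i)) \<Longrightarrow> Ck_on k S (\<lambda>x. \<Sum>i\<in>B. f i x)"
  by (induction B rule: infinite_finite_induct) (auto intro: Ck_on_const Ck_on_add)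

lemma (in bounded_bilinear) Ck_on_prod:
  "Ck_on k S f \<Longrightarrow> Ck_on k S g \<Longrightarrow> Ck_on k S (\<lambda>x. prod (f x) (g x))"
proof (induction k arbitrary: f g)
  case 0 then show ?case by (auto simp: Ck_on.simps intro: continuous_on)
next
  case (Suc k)
  obtain f' where f: "\<And>x. x \<in> S \<Longrightarrow> (f has_derivative f' x) (at x within S)"
    "\<And>v. Ck_on k S (\<lambda>x. f' x v)" using Ck_on_SucE[OF Suc.prems(1)] by blast
  obtain g' where g: "\<And>x. x \<in> S \<Longrightarrow> (g has_derivative g' x) (at x within S)"
    "\<And>v. Ck_on k S (\<lambda>x. g' x v)" using Ck_on_SucE[OF Suc.prems(2)] by blast
  have "Ck_on k S f" "Ck_on k S g" using Suc.prems Ck_on_Suc_D by blast+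
  show ?case
  proof (rule Ck_on_SucI)
    show "((\<lambda>x. prod (f x) (g x)) has_derivative (\<lambda>v. prod (f x) (g' x v) + prod (f' x v) (g x)))
        (at x within S)" if "x \<in> S" for x
      using FDERIV[OF f(1)[OF that] g(1)[OF that]] .
    show "Ck_on k S (\<lambda>x. prod (f x) (g' x v) + prod (f' x v) (g x))" for v
      by (intro Ck_on_add Suc.IH[OF \<open>Ck_on k S f\<close> g(2)] Suc.IH[OF f(2) \<open>Ck_on k S g\<close>])
  qed
qed

lemmas Ck_on_scaleR = bounded_bilinear.Ck_on_prod[OF bounded_bilinear_scaleR]

text \<open>By the chain rule the derivative is \<open>g' (f x) (f' x v)\<close>. The induction hypothesis applies to
\<open>g' (f x) b\<close> only for a fixed direction \<open>b\<close>; expanding \<open>f' x v\<close> in the standard basis reduces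
the moving direction to this case.\<close>

lemma Ck_on_compose:
  fixes f :: "'b::euclidean_space \<Rightarrow> 'c::euclidean_space"
  assumes "Ck_on k S f" "Ck_on k T g" "f ` S \<subseteq> T"
  shows "Ck_on k S (\<lambda>x. g (f x))"
  using assms
proof (induction k arbitrary: g)
  case 0 then show ?case
    using continuous_on_compose2[of T g S f] by (simp add: Ck_on.simps)
next
  case (Suc k)
  obtain f' where f: "\<And>x. x \<in> S \<Longrightarrow> (f has_derivative f' x) (at x within S)"
    "\<And>v. Ck_on k S (\<lambda>x. f' x v)" using Ck_on_SucE[OF Suc.prems(1)] by blast
  obtain g' where g: "\<And>x. x \<in> T \<Longrightarrow> (g has_derivative g' x) (at x within T)"
    "\<And>v. Ck_on k T (\<lambda>x. g' x v)" using Ck_on_SucE[OF Suc.prems(2)] by blast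
  let ?h = "\<lambda>x v. \<Sum>b\<in>Basis. (f' x v \<bullet> b) *\<^sub>R g' (f x) b"
  have "((\<lambda>x. g (f x)) has_derivative ?h x) (at x within S)" if x: "x \<in> S" for x
  proof -
    have fx: "f x \<in> T" using x Suc.prems by auto
    then interpret bounded_linear "g' (f x)" using g has_derivative_bounded_linear by blast
    have "(g has_derivative g' (f x)) (at (f x) within f ` S)"
      using g fx Suc.prems has_derivative_subset by blast
    from diff_chain_within[OF f(1)[OF x] this]
    have "((\<lambda>x. g (f x)) has_derivative (\<lambda>v. g' (f x) (f' x v))) (at x within S)"
      by (simp add: o_def)
    moreover have "g' (f x) (f' x v) = ?h x v" for v
    proof -
      have "g' (f x) (f' x v) = g' (f x) (\<Sum>b\<in>Basis. (f' x v \<bullet> b) *\<^sub>R b)"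
        by (simp add: euclidean_representation)
      then show ?thesis by (simp add: sum scaleR)
    qed
    ultimately show ?thesis by simp
  qed
  moreover have "Ck_on k S (\<lambda>x. ?h x v)" for v
  proof (intro Ck_on_sum Ck_on_scaleR)
    fix b :: 'c
    show "Ck_on k S (\<lambda>x. f' x v \<bullet> b)"
      by (rule bounded_bilinear.Ck_on_prod[OF bounded_bilinear_inner f(2) Ck_on_const])
    show "Ck_on k S (\<lambda>x. g' (f x) b)"
      using Suc.IH[OF Ck_on_Suc_D[OF Suc.prems(1)] g(2) Suc.prems(3)] .
  qed
  ultimately show ?case by (rule Ck_on_SucI)
qed

text \<open>Locally chosen derivatives agree on overlaps because derivatives within the set are unique, so the
derivatives at the centres of the neighbourhoods form a derivative with the same local regularity.\<close>

lemma Ck_on_local: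
  assumes "derivative_domain S" "\<And>x. x \<in> S \<Longrightarrow> \<exists>N. open N \<and> x \<in> N \<and> Ck_on k (S \<inter> N) f"
  shows "Ck_on k S f"
  using assms(2)
proof (induction k arbitrary: f)
  case 0
  show ?case
    unfolding Ck_on.simps continuous_on_eq_continuous_within
  proof
    fix x assume x: "x \<in> S"
    obtain N where N: "open N" "x \<in> N" "continuous_on (S \<inter> N) f"
      using 0[OF x] unfolding Ck_on.simps(1) by blast
    then have "continuous (at x within (S \<inter> N)) f"
      using x by (simp add: continuous_on_eq_continuous_within)
    then show "continuous (at x within S) f"
      using N by (simp add: at_within_Int_open_eq)
  qed
next
  case (Suc k)
  have "\<forall>x\<in>S. \<exists>N F. open N \<and> x \<in> N \<and> (\<forall>y\<in>S \<inter> N. (f has_derivative F y) (at y within S)) \<and>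
          (\<forall>v. Ck_on k (S \<inter> N) (\<lambda>y. F y v))"
  proof
    fix x assume x: "x \<in> S"
    obtain N where N: "open N" "x \<in> N" "Ck_on (Suc k) (S \<inter> N) f"
      using Suc.prems[OF x] by blast
    obtain F where F: "\<And>y. y \<in> S \<inter> N \<Longrightarrow> (f has_derivative F y) (at y within (S \<inter> N))"
      "\<And>v. Ck_on k (S \<inter> N) (\<lambda>y. F y v)" using Ck_on_SucE[OF N(3)] by blast
    then show "\<exists>N F. open N \<and> x \<in> N \<and> (\<forall>y\<in>S \<inter> N. (f has_derivative F y) (at y within S)) \<and>
          (\<forall>v. Ck_on k (S \<inter> N) (\<lambda>y. F y v))" using N
      by (intro exI[of _ N] exI[of _ F]) (simp add: at_within_Int_open_eq)
  qed
  then obtain N F where NF: "\<forall>x\<in>S. open (N x) \<and> x \<in> N x \<and>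
      (\<forall>y\<in>S \<inter> N x. (f has_derivative F x y) (at y within S)) \<and>
      (\<forall>v. Ck_on k (S \<inter> N x) (\<lambda>y. F x y v))"
    unfolding bchoice_iff by (elim exE) (rule that)
  then have N: "\<And>x. x \<in> S \<Longrightarrow> open (N x) \<and> x \<in> N x"
    and F: "\<And>x y. x \<in> S \<Longrightarrow> y \<in> S \<inter> N x \<Longrightarrow> (f has_derivative F x y) (at y within S)"
      "\<And>x v. x \<in> S \<Longrightarrow> Ck_on k (S \<inter> N x) (\<lambda>y. F x y v)"
    by blast+
  have "Ck_on k S (\<lambda>x. F x x v)" for v
  proof (rule Suc.IH)
    fix x assume x: "x \<in> S"
    have "F x y v = F y y v" if "y \<in> S \<inter> N x" for y
      using derivative_domain_unique[OF assms(1)] F(1)[of x y] F(1)[of y y] N that x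
      by (metis IntD1 IntI)
    then have "Ck_on k (S \<inter> N x) (\<lambda>y. F y y v)"
      by (rule Ck_on_cong[where f = "\<lambda>y. F x y v"]) (simp_all add: F(2)[OF x])
    then show "\<exists>N. open N \<and> x \<in> N \<and> Ck_on k (S \<inter> N) (\<lambda>x. F x x v)"
      using N x by blast
  qed
  moreover have "(f has_derivative F x x) (at x within S)" if "x \<in> S" for x
    using F(1)[of x x] N[OF that] that by blast
  ultimately show ?case by (intro Ck_on_SucI[where f' = "\<lambda>x. F x x"])
qed

lemma smooth_on_subset: "smooth_on S f \<Longrightarrow> T \<subseteq> S \<Longrightarrow> smooth_on T f"
  unfolding smooth_on_def by (blast intro: Ck_on_subset)

lemma smooth_on_cong: "(\<And>x. x \<in> S \<Longrightarrow> f x = g x) \<Longrightarrow> smooth_on S f \<Longrightarrow> smooth_on S g"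
  unfolding smooth_on_def using Ck_on_cong[of S f g] by blast

lemma smooth_on_const: "smooth_on S (\<lambda>x. c)"
  by (simp add: smooth_on_def Ck_on_const)

lemma smooth_on_linear: "bounded_linear L \<Longrightarrow> smooth_on S L"
  by (simp add: smooth_on_def Ck_on_linear)

lemma smooth_on_add: "smooth_on S f \<Longrightarrow> smooth_on S g \<Longrightarrow> smooth_on S (\<lambda>x. f x + g x)"
  by (simp add: smooth_on_def Ck_on_add)

lemma smooth_on_sum: "(\<And>i. i \<in> B \<Longrightarrow> smooth_on S (f i)) \<Longrightarrow> smooth_on S (\<lambda>x. \<Sum>i\<in>B. f i x)"
  by (simp add: smooth_on_def Ck_on_sum)

lemma smooth_on_scaleR: "smooth_on S f \<Longrightarrow> smooth_on S g \<Longrightarrow> smooth_on S (\<lambda>x. f x *\<^sub>R g x)"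
  by (simp add: smooth_on_def Ck_on_scaleR)

lemma smooth_on_mult:
  fixes f g :: "'b::euclidean_space \<Rightarrow> real"
  shows "smooth_on S f \<Longrightarrow> smooth_on S g \<Longrightarrow> smooth_on S (\<lambda>x. f x * g x)"
  using smooth_on_scaleR[of S f g] by simp

lemma smooth_on_compose:
  fixes f :: "'b::euclidean_space \<Rightarrow> 'c::euclidean_space"
  shows "smooth_on S f \<Longrightarrow> smooth_on T g \<Longrightarrow> f ` S \<subseteq> T \<Longrightarrow> smooth_on S (\<lambda>x. g (f x))"
  unfolding smooth_on_def using Ck_on_compose by blast

lemma smooth_on_local:
  assumes "derivative_domain S" "\<And>x. x \<in> S \<Longrightarrow> \<exists>N. open N \<and> x \<in> N \<and> smooth_on (S \<inter> N) f"
  shows "smooth_on S f"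
  unfolding smooth_on_def
  by (intro allI Ck_on_local[OF assms(1)]) (use assms(2) smooth_on_def in blast)

text \<open>Smoothness provides a derivative for each order separately; by uniqueness they are all the same one.\<close>

lemma smooth_on_derivative:
  assumes S: "derivative_domain S" and f: "smooth_on S f"
  shows "\<exists>f'. (\<forall>x\<in>S. (f has_derivative f' x) (at x within S)) \<and> (\<forall>v. smooth_on S (\<lambda>x. f' x v))"
proof -
  have C: "\<exists>f'. (\<forall>x\<in>S. (f has_derivative f' x) (at x within S)) \<and> (\<forall>v. Ck_on k S (\<lambda>x. f' x v))" for k
    using f Ck_on.simps(2)[of k S f] unfolding smooth_on_def by blast
  then obtain f' where f': "\<forall>x\<in>S. (f has_derivative f' x) (at x within S)" by blast
  have "Ck_on k S (\<lambda>x. f' x v)" for k v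
  proof -
    obtain f'' where f'': "\<forall>x\<in>S. (f has_derivative f'' x) (at x within S)"
      "\<forall>v. Ck_on k S (\<lambda>x. f'' x v)"
      using C by blast
    have "f'' x v = f' x v" if "x \<in> S" for x
      using derivative_domain_unique[OF S that f''(1)[rule_format, OF that] f'[rule_format, OF that]]
      by simp
    then show ?thesis
      by (rule Ck_on_cong[where f = "\<lambda>x. f'' x v"]) (simp_all add: f''(2))
  qed
  with f' show ?thesis unfolding smooth_on_def by blast
qed

lemma smooth_on_open_has_derivative:
  assumes "open S" "smooth_on S f" "x \<in> S"
  shows "(f has_derivative frechet_derivative f (at x)) (at x)"
proof -
  obtain f' where f': "\<forall>x\<in>S. (f has_derivative f' x) (at x within S)"
    "\<forall>v. smooth_on S (\<lambda>x. f' x v)"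
    using smooth_on_derivative[OF derivative_domain_open[OF assms(1)] assms(2)]
    by (elim exE conjE) (rule that)
  then have D: "(f has_derivative f' x) (at x)"
    using assms(1,3) at_within_open[OF assms(3,1)] by metis
  show ?thesis
    using D unfolding frechet_derivative_at[OF D, symmetric] .
qed

lemma smooth_on_frechet_derivative:
  assumes "open S" "smooth_on S f"
  shows "smooth_on S (\<lambda>x. frechet_derivative f (at x) v)"
proof -
  obtain f' where f': "\<forall>x\<in>S. (f has_derivative f' x) (at x within S)"
    "\<forall>v. smooth_on S (\<lambda>x. f' x v)"
    using smooth_on_derivative[OF derivative_domain_open[OF assms(1)] assms(2)]
    by (elim exE conjE) (rule that)
  have "f' x v = frechet_derivative f (at x) v" if "x \<in> S" for x
    using frechet_derivative_at[of f "f' x" x] f'(1) that at_within_open[OF that assms(1)] by metis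
  then show ?thesis
    by (rule smooth_on_cong[where f = "\<lambda>x. f' x v"]) (simp_all add: f'(2))
qed

lemma smooth_on_has_vector_derivative:
  assumes "derivative_domain S" "smooth_on S f" "t \<in> S"
  shows "(f has_vector_derivative vector_derivative f (at t within S)) (at t within S)"
proof -
  obtain f' where f': "\<forall>x\<in>S. (f has_derivative f' x) (at x within S)"
    "\<forall>v. smooth_on S (\<lambda>x. f' x v)"
    using smooth_on_derivative[OF assms(1,2)]
    by (elim exE conjE) (rule that)
  then have "f differentiable at t within S" using assms(3) by (auto simp: differentiable_def)
  then show ?thesis by (simp add: vector_derivative_works)
qed

lemma smooth_on_vector_derivative:
  assumes "derivative_domain S" "smooth_on S f"
  shows "smooth_on S (\<lambda>t. vector_derivative f (at t within S))"
proof -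
  obtain f' where f': "\<forall>x\<in>S. (f has_derivative f' x) (at x within S)"
    "\<forall>v. smooth_on S (\<lambda>x. f' x v)"
    using smooth_on_derivative[OF assms] by (elim exE conjE) (rule that)
  have "f' t 1 = vector_derivative f (at t within S)" if t: "t \<in> S" for t
  proof -
    have D: "(f has_derivative f' t) (at t within S)" using f'(1) t by (rule bspec)
    have "f' t h = h *\<^sub>R f' t 1" for h
      using linear_scale[OF has_derivative_linear[OF D], of h 1] by simp
    then have "(\<lambda>h. h *\<^sub>R f' t 1) = f' t" by (intro ext) (rule sym)
    then have V: "(f has_vector_derivative f' t 1) (at t within S)"
      using D by (simp add: has_vector_derivative_def)
    show ?thesis
      by (rule vector_derivative_within[OF derivative_domain_at_not_bot[OF assms(1) t] V, symmetric])
  qed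
  then show ?thesis
    by (rule smooth_on_cong[where f = "\<lambda>x. f' x 1"]) (simp_all add: f'(2))
qed

lemma smooth_on_line_derivative:
  fixes f :: "'b::euclidean_space \<Rightarrow> real"
  assumes "open S" "smooth_on S f" "x + s *\<^sub>R u \<in> S"
  shows "((\<lambda>s. f (x + s *\<^sub>R u)) has_real_derivative frechet_derivative f (at (x + s *\<^sub>R u)) u) (at s)"
proof -
  have D: "(f has_derivative frechet_derivative f (at (x + s *\<^sub>R u))) (at (x + s *\<^sub>R u))"
    by (rule smooth_on_open_has_derivative[OF assms])
  have L: "((\<lambda>s. x + s *\<^sub>R u) has_derivative (\<lambda>h. h *\<^sub>R u)) (at s)"
    by (auto intro!: derivative_eq_intros)
  have "((\<lambda>s. f (x + s *\<^sub>R u)) has_derivative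
      (\<lambda>h. frechet_derivative f (at (x + s *\<^sub>R u)) (h *\<^sub>R u))) (at s)"
    using has_derivative_compose[OF L D] .
  moreover have "frechet_derivative f (at (x + s *\<^sub>R u)) (h *\<^sub>R u)
      = h * frechet_derivative f (at (x + s *\<^sub>R u)) u" for h
    using linear_scale[OF has_derivative_linear[OF D]] by simp
  ultimately show ?thesis
    by (simp add: has_field_derivative_def mult.commute[of _ "frechet_derivative f _ u"])
qed

text \<open>The second difference is symmetric in \<open>u\<close> and \<open>v\<close>, while the mean value theorem, applied first in
direction \<open>u\<close> and then in direction \<open>v\<close>, turns it into an iterated derivative in this order at a
nearby point.\<close>

lemma second_difference_mean_value:
  fixes f :: "'b::euclidean_space \<Rightarrow> real"
  assumes S: "open S" "smooth_on S f" "ball x r \<subseteq> S" and h: "h > 0" "h * (norm u + norm v) < r"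
  shows "\<exists>p. dist x p < r \<and> f (x + h *\<^sub>R u + h *\<^sub>R v) - f (x + h *\<^sub>R u) - f (x + h *\<^sub>R v) + f x
     = h * h * frechet_derivative (\<lambda>y. frechet_derivative f (at y) u) (at p) v"
proof -
  have inS: "dist x (x + s *\<^sub>R u + t *\<^sub>R v) < r" if "0 \<le> s" "s \<le> h" "0 \<le> t" "t \<le> h" for s t
  proof -
    have "norm (s *\<^sub>R u + t *\<^sub>R v) \<le> s * norm u + t * norm v"
      using norm_triangle_ineq[of "s *\<^sub>R u" "t *\<^sub>R v"] that by simp
    also have "\<dots> \<le> h * norm u + h * norm v"
      using that by (intro add_mono mult_right_mono) auto
    finally have "norm (s *\<^sub>R u + t *\<^sub>R v) < r" using h by (simp add: algebra_simps)
    moreover have "dist x (x + s *\<^sub>R u + t *\<^sub>R v) = norm (s *\<^sub>R u + t *\<^sub>R v)"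
      unfolding dist_norm by (subst norm_minus_commute) (simp add: add.assoc)
    ultimately show ?thesis by simp
  qed
  let ?D = "\<lambda>y. frechet_derivative f (at y) u"
  \<comment> \<open>the increment of \<open>f\<close> in direction \<open>v\<close>, moved along \<open>u\<close>\<close>
  define g where "g = (\<lambda>s. f ((x + h *\<^sub>R v) + s *\<^sub>R u) - f (x + s *\<^sub>R u))"
  have "(g has_real_derivative ?D ((x + h *\<^sub>R v) + s *\<^sub>R u) - ?D (x + s *\<^sub>R u)) (at s)"
    if "0 \<le> s" "s \<le> h" for s
    unfolding g_def
    by (intro DERIV_diff smooth_on_line_derivative[OF S(1,2)])
       (use inS[of s h] inS[of s 0] that h S(3) in \<open>auto simp: algebra_simps\<close>)
  then obtain s where s: "0 < s" "s < h"
    "g h - g 0 = (h - 0) * (?D ((x + h *\<^sub>R v) + s *\<^sub>R u) - ?D (x + s *\<^sub>R u))"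
    using MVT2[of 0 h g "\<lambda>s. ?D ((x + h *\<^sub>R v) + s *\<^sub>R u) - ?D (x + s *\<^sub>R u)"] h by auto
  define k where "k = (\<lambda>t. ?D ((x + s *\<^sub>R u) + t *\<^sub>R v))"
  have "(k has_real_derivative frechet_derivative ?D (at ((x + s *\<^sub>R u) + t *\<^sub>R v)) v) (at t)"
    if "0 \<le> t" "t \<le> h" for t
    unfolding k_def
    by (intro smooth_on_line_derivative[OF S(1) smooth_on_frechet_derivative[OF S(1,2)]])
       (use inS[of s t] that h s S(3) in auto)
  then obtain t where t: "0 < t" "t < h"
    "k h - k 0 = (h - 0) * frechet_derivative ?D (at ((x + s *\<^sub>R u) + t *\<^sub>R v)) v"
    using MVT2[of 0 h k "\<lambda>t. frechet_derivative ?D (at ((x + s *\<^sub>R u) + t *\<^sub>R v)) v"] h by auto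
  have e: "x + h *\<^sub>R v + s *\<^sub>R u = x + s *\<^sub>R u + h *\<^sub>R v"
    "x + h *\<^sub>R v + h *\<^sub>R u = x + h *\<^sub>R u + h *\<^sub>R v" by (simp_all add: algebra_simps)
  have "f (x + h *\<^sub>R u + h *\<^sub>R v) - f (x + h *\<^sub>R u) - f (x + h *\<^sub>R v) + f x = g h - g 0"
    by (simp add: g_def e)
  also have "\<dots> = h * (k h - k 0)" using s(3) by (simp add: k_def e)
  also have "\<dots> = h * h * frechet_derivative ?D (at ((x + s *\<^sub>R u) + t *\<^sub>R v)) v"
    using t(3) by simp
  finally show ?thesis using inS[of s t] s t by (intro exI[of _ "(x + s *\<^sub>R u) + t *\<^sub>R v"]) auto
qed

text \<open>Divided by \<open>h\<^sup>2\<close>, the second difference tends to both iterated derivatives as \<open>h\<close> tends to \<open>0\<close>.\<close>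

lemma frechet_derivative_commute:
  fixes f :: "'b::euclidean_space \<Rightarrow> real"
  assumes S: "open S" "smooth_on S f" "x \<in> S"
  shows "frechet_derivative (\<lambda>y. frechet_derivative f (at y) u) (at x) v
       = frechet_derivative (\<lambda>y. frechet_derivative f (at y) v) (at x) u" (is "?A x = ?B x")
proof -
  have "smooth_on S ?A" "smooth_on S ?B"
    by (intro smooth_on_frechet_derivative S)+
  then have "continuous_on S ?A" "continuous_on S ?B"
    unfolding smooth_on_def using Ck_on.simps(1) by blast+
  then have cont: "isCont ?A x" "isCont ?B x"
    using S continuous_on_eq_continuous_at by blast+
  have "\<bar>?A x - ?B x\<bar> < 2 * e" if e: "e > 0" for e
  proof -
    obtain d1 where d1: "d1 > 0" "\<And>p. dist p x < d1 \<Longrightarrow> dist (?A p) (?A x) < e"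
      using cont(1) e unfolding continuous_at_eps_delta by blast
    obtain d2 where d2: "d2 > 0" "\<And>p. dist p x < d2 \<Longrightarrow> dist (?B p) (?B x) < e"
      using cont(2) e unfolding continuous_at_eps_delta by blast
    obtain d3 where d3: "d3 > 0" "ball x d3 \<subseteq> S" using S openE by blast
    define r where "r = min d1 (min d2 d3)"
    have r: "r > 0" "ball x r \<subseteq> S" using d1 d2 d3 by (auto simp: r_def)
    \<comment> \<open>small enough for all points of both second differences to stay within \<open>r\<close> of \<open>x\<close>\<close>
    define h where "h = r / (norm u + norm v + 1)"
    have h: "h > 0" using r by (simp add: h_def add_nonneg_pos)
    have c: "norm u + norm v + 1 \<noteq> 0" using norm_ge_zero[of u] norm_ge_zero[of v] by linarith
    have "h * (norm u + norm v + 1) = r"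
      unfolding h_def by (simp only: times_divide_eq_left nonzero_mult_div_cancel_right[OF c])
    then have hr: "h * (norm u + norm v) < r" "h * (norm v + norm u) < r"
      using h by (simp_all add: algebra_simps)
    obtain p where p: "dist x p < r"
      "f (x + h *\<^sub>R u + h *\<^sub>R v) - f (x + h *\<^sub>R u) - f (x + h *\<^sub>R v) + f x = h * h * ?A p"
      using second_difference_mean_value[OF S(1,2) r(2) h hr(1)] by blast
    obtain q where q: "dist x q < r"
      "f (x + h *\<^sub>R v + h *\<^sub>R u) - f (x + h *\<^sub>R v) - f (x + h *\<^sub>R u) + f x = h * h * ?B q"
      using second_difference_mean_value[OF S(1,2) r(2) h hr(2)] by blast
    have "h * h * ?A p = h * h * ?B q"
      using p(2) q(2) by (simp add: algebra_simps)
    then have "?A p = ?B q" using h by simp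
    moreover have "dist (?A p) (?A x) < e" "dist (?B q) (?B x) < e"
      using d1(2)[of p] d2(2)[of q] p(1) q(1) by (simp_all add: r_def dist_commute)
    ultimately show ?thesis by (simp add: dist_real_def)
  qed
  then have "\<bar>?A x - ?B x\<bar> \<le> 0"
    by (metis field_sum_of_halves less_eq_real_def linorder_not_le mult_2 zero_less_divide_iff zero_less_numeral)
  then show ?thesis by simp
qed

section \<open>Smooth bump functions\<close>

text \<open>Allowing a polynomial factor makes this family closed under differentiation, so that smoothness at
the origin, where all derivatives vanish, follows by one induction. The polynomial \<open>1\<close> gives the
usual building block \<open>exp (- 1 / s)\<close>.\<close>

definition flat_fun :: "real poly \<Rightarrow> real \<Rightarrow> real" where
  "flat_fun P s = (if s > 0 then poly P (1 / s) * exp (- (1 / s)) else 0)"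

lemma poly_times_exp_tendsto_0: "((\<lambda>y. y ^ k * poly P y * exp (- y)) \<longlongrightarrow> (0::real)) at_top"
proof (induction P arbitrary: k rule: pCons_induct)
  case 0
  then show ?case by simp
next
  case (pCons a P)
  have "((\<lambda>y. a * (y ^ k / exp y) + y ^ Suc k * poly P y * exp (- y)) \<longlongrightarrow> a * 0 + 0) at_top"
    by (intro tendsto_intros tendsto_power_div_exp_0 pCons.IH)
  then show ?case by (simp add: algebra_simps exp_minus divide_inverse)
qed

lemma flat_fun_tendsto_0: "(flat_fun P \<longlongrightarrow> 0) (at 0)"
proof -
  have "((\<lambda>s. poly P (inverse s) * exp (- inverse s)) \<longlongrightarrow> 0) (at_right (0::real))"
    using filterlim_compose[OF poly_times_exp_tendsto_0[of 0 P] filterlim_inverse_at_top_right]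
    by simp
  then have "(flat_fun P \<longlongrightarrow> 0) (at_right 0)"
    by (rule Lim_transform_eventually)
       (auto simp: eventually_at_filter flat_fun_def inverse_eq_divide)
  moreover have "(flat_fun P \<longlongrightarrow> 0) (at_left 0)"
    by (rule Lim_transform_eventually[OF tendsto_const])
       (auto simp: eventually_at_filter flat_fun_def)
  ultimately show ?thesis by (simp add: filterlim_split_at)
qed

lemma flat_fun_has_derivative:
  "(flat_fun P has_real_derivative flat_fun (pCons 0 (pCons 0 (P - pderiv P))) s) (at s)"
proof (cases s "0::real" rule: linorder_cases)
  case less
  have "((\<lambda>s. 0) has_real_derivative 0) (at s)" by simp
  then have "(flat_fun P has_real_derivative 0) (at s)"
    by (rule has_field_derivative_transform_within_open[where S = "{..<0}"])
       (use less in \<open>auto simp: flat_fun_def\<close>)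
  then show ?thesis using less by (simp add: flat_fun_def)
next
  case equal
  have "((\<lambda>h. (flat_fun P (0 + h) - flat_fun P 0) / h) \<longlongrightarrow> 0) (at 0)"
    by (rule Lim_transform_eventually[OF flat_fun_tendsto_0[of "pCons 0 P"]])
       (auto simp: eventually_at_filter flat_fun_def)
  then show ?thesis using equal by (simp add: DERIV_def flat_fun_def)
next
  case greater
  have "((\<lambda>s. poly P (1 / s) * exp (- (1 / s))) has_real_derivative
      flat_fun (pCons 0 (pCons 0 (P - pderiv P))) s) (at s)"
    using greater
    by (auto intro!: derivative_eq_intros DERIV_chain2[OF poly_DERIV]
        simp: flat_fun_def field_simps power2_eq_square)
  then show ?thesis
    by (rule has_field_derivative_transform_within_open[where S = "{0<..}"])
       (use greater in \<open>auto simp: flat_fun_def\<close>)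
qed

lemma smooth_on_flat_fun: "smooth_on UNIV (flat_fun P)"
proof -
  have "Ck_on k UNIV (flat_fun P)" for k
  proof (induction k arbitrary: P)
    case 0
    have "isCont (flat_fun P) s" for s using flat_fun_has_derivative DERIV_isCont by blast
    then show ?case by (simp add: Ck_on.simps continuous_at_imp_continuous_on)
  next
    case (Suc k)
    let ?Q = "pCons 0 (pCons 0 (P - pderiv P))"
    show ?case
    proof (rule Ck_on_SucI)
      show "(flat_fun P has_derivative (\<lambda>v. flat_fun ?Q s *\<^sub>R v)) (at s within UNIV)" for s
        using flat_fun_has_derivative[of P s] by (simp add: has_field_derivative_def)
      show "Ck_on k UNIV (\<lambda>s. flat_fun ?Q s *\<^sub>R v)" for v
        by (rule Ck_on_scaleR[OF Suc.IH Ck_on_const])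
    qed
  qed
  then show ?thesis by (simp add: smooth_on_def)
qed

text \<open>The function \<open>flat_fun 1\<close> of \<open>r\<^sup>2 - |x - p|\<^sup>2\<close> is positive exactly on the open ball.\<close>

lemma smooth_bump_exists:
  fixes p :: "'b::euclidean_space"
  assumes "r > 0"
  shows "\<exists>\<beta>. smooth_on UNIV \<beta> \<and> \<beta> p \<noteq> (0::real) \<and> (\<forall>x. dist p x \<ge> r \<longrightarrow> \<beta> x = 0)"
proof -
  define q where "q = (\<lambda>x. r\<^sup>2 - (x - p) \<bullet> (x - p))"
  have "Ck_on k UNIV q" for k
  proof -
    have d: "Ck_on k UNIV (\<lambda>x. x + - p)"
      by (intro Ck_on_add Ck_on_linear Ck_on_const bounded_linear_ident)
    have "Ck_on k UNIV (\<lambda>x. r\<^sup>2 + (-1) *\<^sub>R ((x + - p) \<bullet> (x + - p)))"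
      by (intro Ck_on_add Ck_on_scaleR Ck_on_const d
          bounded_bilinear.Ck_on_prod[OF bounded_bilinear_inner])
    then show ?thesis by (simp add: q_def)
  qed
  then have "smooth_on UNIV q" by (simp add: smooth_on_def)
  then have "smooth_on UNIV (\<lambda>x. flat_fun 1 (q x))"
    by (rule smooth_on_compose[OF _ smooth_on_flat_fun]) auto
  moreover have "flat_fun 1 (q p) \<noteq> 0" using assms by (simp add: q_def flat_fun_def)
  moreover have "flat_fun 1 (q x) = 0" if "dist p x \<ge> r" for x
  proof -
    have "r\<^sup>2 \<le> (dist p x)\<^sup>2" using that assms by (intro power_mono) auto
    then show ?thesis
      by (simp add: flat_fun_def q_def dist_norm norm_minus_commute power2_norm_eq_inner[symmetric])
  qed
  ultimately show ?thesis by (intro exI[of _ "\<lambda>x. flat_fun 1 (q x)"]) auto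
qed

section \<open>Charts, tangent spaces and vector fields\<close>

locale smooth_manifold =
  fixes A :: "('a::topological_space, 'n::finite) chart set"
  assumes atlas: "smooth_atlas A"
begin

abbreviation coord :: "('a \<Rightarrow> real ^ 'n) \<Rightarrow> 'n \<Rightarrow> 'a \<Rightarrow> real" where
  "coord \<phi> i \<equiv> (\<lambda>q. \<phi> q $ i)"

lemma chart_open: "(U, \<phi>) \<in> A \<Longrightarrow> open U"
  and chart_homeomorphism: "(U, \<phi>) \<in> A \<Longrightarrow> homeomorphism U (\<phi> ` U) \<phi> (inv_into U \<phi>)"
  and chart_image_open: "(U, \<phi>) \<in> A \<Longrightarrow> open (\<phi> ` U)"
  and transition_smooth:
    "(U, \<phi>) \<in> A \<Longrightarrow> (V, \<psi>) \<in> A \<Longrightarrow> smooth_on (\<phi> ` (U \<inter> V)) (\<psi> \<circ> inv_into U \<phi>)"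
  using atlas unfolding smooth_atlas_def by blast+

lemma chart_exists: "\<exists>U \<phi>. (U, \<phi>) \<in> A \<and> p \<in> U"
  using atlas unfolding smooth_atlas_def by blast

lemma chart_inv: "(U, \<phi>) \<in> A \<Longrightarrow> p \<in> U \<Longrightarrow> inv_into U \<phi> (\<phi> p) = p"
  using chart_homeomorphism homeomorphism_apply1 by blast

lemma chart_inj: "(U, \<phi>) \<in> A \<Longrightarrow> inj_on \<phi> U"
  using chart_inv inj_on_inverseI[of U "inv_into U \<phi>" \<phi>] by blast

lemma chart_open_image:
  assumes "(U, \<phi>) \<in> A" "open W"
  shows "open (\<phi> ` (U \<inter> W))"
proof -
  have "continuous_on (\<phi> ` U) (inv_into U \<phi>)"
    using chart_homeomorphism[OF assms(1)] by (simp add: homeomorphism_def)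
  then have "open (\<phi> ` U \<inter> inv_into U \<phi> -` W)"
    by (rule continuous_open_preimage[OF _ chart_image_open[OF assms(1)] assms(2)])
  moreover have "\<phi> ` U \<inter> inv_into U \<phi> -` W = \<phi> ` (U \<inter> W)"
    using chart_inv[OF assms(1)] by (auto simp: image_iff)
  ultimately show ?thesis by simp
qed

lemma smooth_fun_smooth_on: "smooth_fun A W f \<Longrightarrow> (U, \<phi>) \<in> A \<Longrightarrow> smooth_on (\<phi> ` (U \<inter> W)) (f \<circ> inv_into U \<phi>)"
  unfolding smooth_fun_def by blast

lemma smooth_fun_subset: "smooth_fun A W f \<Longrightarrow> W' \<subseteq> W \<Longrightarrow> smooth_fun A W' f"
  unfolding smooth_fun_def by (blast intro: smooth_on_subset)

lemma smooth_fun_cong: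
  assumes "\<And>q. q \<in> W \<Longrightarrow> f q = g q" "smooth_fun A W f"
  shows "smooth_fun A W g"
  unfolding smooth_fun_def
proof clarify
  fix U \<phi> assume c: "(U, \<phi>) \<in> A"
  show "smooth_on (\<phi> ` (U \<inter> W)) (g \<circ> inv_into U \<phi>)"
    by (rule smooth_on_cong[OF _ smooth_fun_smooth_on[OF assms(2) c]])
       (use assms(1) chart_inv[OF c] in auto)
qed

lemma smooth_fun_const: "smooth_fun A W (\<lambda>q. c)"
  unfolding smooth_fun_def by (auto simp: o_def smooth_on_const)

lemma smooth_fun_add: "smooth_fun A W f \<Longrightarrow> smooth_fun A W g \<Longrightarrow> smooth_fun A W (\<lambda>q. f q + g q)"
  unfolding smooth_fun_def o_def by (auto intro: smooth_on_add)

lemma smooth_fun_mult: "smooth_fun A W f \<Longrightarrow> smooth_fun A W g \<Longrightarrow> smooth_fun A W (\<lambda>q. f q * g q)"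
  unfolding smooth_fun_def o_def by (auto intro: smooth_on_mult)

lemma smooth_fun_minus: "smooth_fun A W f \<Longrightarrow> smooth_fun A W (\<lambda>q. - f q)"
  using smooth_fun_mult[OF smooth_fun_const[of W "-1"]] by simp

lemma smooth_fun_diff: "smooth_fun A W f \<Longrightarrow> smooth_fun A W g \<Longrightarrow> smooth_fun A W (\<lambda>q. f q - g q)"
  using smooth_fun_add[OF _ smooth_fun_minus, of W f g] by simp

lemma smooth_fun_local:
  assumes "open W" "\<And>p. p \<in> W \<Longrightarrow> \<exists>N. open N \<and> p \<in> N \<and> smooth_fun A (W \<inter> N) f"
  shows "smooth_fun A W f"
  unfolding smooth_fun_def
proof clarify
  fix U \<phi> assume c: "(U, \<phi>) \<in> A"
  show "smooth_on (\<phi> ` (U \<inter> W)) (f \<circ> inv_into U \<phi>)"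
  proof (rule smooth_on_local[OF derivative_domain_open[OF chart_open_image[OF c assms(1)]]])
    fix x assume "x \<in> \<phi> ` (U \<inter> W)"
    then obtain q where q: "q \<in> U" "q \<in> W" "x = \<phi> q" by blast
    obtain N where N: "open N" "q \<in> N" "smooth_fun A (W \<inter> N) f" using assms(2)[OF q(2)] by blast
    have "\<phi> ` (U \<inter> W) \<inter> \<phi> ` (U \<inter> N) \<subseteq> \<phi> ` (U \<inter> (W \<inter> N))"
      using chart_inj[OF c] by (auto simp: inj_on_def)
    then have "smooth_on (\<phi> ` (U \<inter> W) \<inter> \<phi> ` (U \<inter> N)) (f \<circ> inv_into U \<phi>)"
      by (rule smooth_on_subset[OF smooth_fun_smooth_on[OF N(3) c]])
    then show "\<exists>M. open M \<and> x \<in> M \<and> smooth_on (\<phi> ` (U \<inter> W) \<inter> M) (f \<circ> inv_into U \<phi>)"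
      using chart_open_image[OF c N(1)] q N(2) by blast
  qed
qed

text \<open>One chart suffices, since the other coordinate expressions differ by a smooth transition map.\<close>

lemma smooth_fun_chartI:
  assumes c: "(U, \<phi>) \<in> A" and W: "W \<subseteq> U" and f: "smooth_on (\<phi> ` W) (f \<circ> inv_into U \<phi>)"
  shows "smooth_fun A W f"
  unfolding smooth_fun_def
proof clarify
  fix V \<psi> assume d: "(V, \<psi>) \<in> A"
  have "smooth_on (\<psi> ` (V \<inter> W)) (\<phi> \<circ> inv_into V \<psi>)"
    by (rule smooth_on_subset[OF transition_smooth[OF d c]]) (use W in blast)
  then have "smooth_on (\<psi> ` (V \<inter> W)) (\<lambda>x. (f \<circ> inv_into U \<phi>) ((\<phi> \<circ> inv_into V \<psi>) x))"
    by (rule smooth_on_compose[OF _ f]) (use chart_inv[OF d] in auto)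
  then show "smooth_on (\<psi> ` (V \<inter> W)) (f \<circ> inv_into V \<psi>)"
    by (rule smooth_on_cong[rotated]) (use W chart_inv[OF d] chart_inv[OF c] in auto)
qed

lemma smooth_fun_chart_compose:
  assumes c: "(U, \<phi>) \<in> A" and "smooth_on (\<phi> ` U) g"
  shows "smooth_fun A U (\<lambda>q. g (\<phi> q))"
  by (rule smooth_fun_chartI[OF c], simp, rule smooth_on_cong[OF _ assms(2)])
     (use chart_inv[OF c] in auto)

lemma smooth_fun_coordinate: "(U, \<phi>) \<in> A \<Longrightarrow> smooth_fun A U (coord \<phi> i)"
  by (rule smooth_fun_chart_compose) (auto intro: smooth_on_linear bounded_linear_vec_nth)

lemma smooth_nearI: "open W \<Longrightarrow> p \<in> W \<Longrightarrow> smooth_fun A W f \<Longrightarrow> smooth_near A p f"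
  unfolding smooth_near_def by blast

lemma smooth_near_coordinate: "(U, \<phi>) \<in> A \<Longrightarrow> p \<in> U \<Longrightarrow> smooth_near A p (coord \<phi> i)"
  by (rule smooth_nearI[OF chart_open _ smooth_fun_coordinate])

lemma smooth_near_cong:
  assumes "open W" "p \<in> W" "\<And>q. q \<in> W \<Longrightarrow> f q = g q"
  shows "smooth_near A p f \<longleftrightarrow> smooth_near A p g"
proof -
  have "smooth_near A p g" if f: "smooth_near A p f" and eq: "\<And>q. q \<in> W \<Longrightarrow> f q = g q" for f g
  proof -
    obtain W' where W': "open W'" "p \<in> W'" "smooth_fun A W' f" using f unfolding smooth_near_def by blast
    have "smooth_fun A (W' \<inter> W) g"
      by (rule smooth_fun_cong[OF _ smooth_fun_subset[OF W'(3)]]) (auto simp: eq)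
    then show ?thesis using W' assms by (intro smooth_nearI[of "W' \<inter> W"]) auto
  qed
  from this[of f g] this[of g f] assms(3) show ?thesis by auto
qed

lemma smooth_near_has_derivative:
  assumes "(U, \<phi>) \<in> A" "p \<in> U" "smooth_near A p f"
  shows "(f \<circ> inv_into U \<phi> has_derivative frechet_derivative (f \<circ> inv_into U \<phi>) (at (\<phi> p))) (at (\<phi> p))"
proof -
  obtain W where W: "open W" "p \<in> W" "smooth_fun A W f" using assms(3) unfolding smooth_near_def by blast
  show ?thesis
    by (rule smooth_on_open_has_derivative[OF chart_open_image[OF assms(1) W(1)]
        smooth_fun_smooth_on[OF W(3) assms(1)]]) (use assms W in blast)
qed

text \<open>The field with constant coefficients \<open>c\<close> in the chart \<open>\<phi>\<close>. The value \<open>0\<close> on functions that are not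
smooth near the point is the one that velocities of curves take there, so that the equality with
tangent vectors is one of functionals.\<close>

definition coord_vec :: "'a set \<Rightarrow> ('a \<Rightarrow> real ^ 'n) \<Rightarrow> real ^ 'n \<Rightarrow> 'a vfield" where
  "coord_vec U \<phi> c p = (\<lambda>f. if smooth_near A p f
     then frechet_derivative (f \<circ> inv_into U \<phi>) (at (\<phi> p)) c else 0)"

abbreviation frame :: "'a set \<Rightarrow> ('a \<Rightarrow> real ^ 'n) \<Rightarrow> 'n \<Rightarrow> 'a vfield" where
  "frame U \<phi> i \<equiv> coord_vec U \<phi> (axis i 1)"

lemma coord_vec_linear:
  assumes "(U, \<phi>) \<in> A" "p \<in> U"
  shows "linear (\<lambda>c. coord_vec U \<phi> c p)"
proof
  fix c d :: "real ^ 'n" and a :: real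
  have L: "linear (frechet_derivative (f \<circ> inv_into U \<phi>) (at (\<phi> p)))" if "smooth_near A p f" for f
    by (rule has_derivative_linear[OF smooth_near_has_derivative[OF assms that]])
  show "coord_vec U \<phi> (c + d) p = coord_vec U \<phi> c p + coord_vec U \<phi> d p"
    using linear_add[OF L] by (auto simp: coord_vec_def fun_eq_iff)
  show "coord_vec U \<phi> (a *\<^sub>R c) p = a *\<^sub>R coord_vec U \<phi> c p"
    using linear_scale[OF L] by (auto simp: coord_vec_def fun_eq_iff scaleR_fun_def)
qed

lemma coord_vec_coordinate:
  assumes "(U, \<phi>) \<in> A" "p \<in> U"
  shows "coord_vec U \<phi> c p (coord \<phi> i) = c $ i"
proof -
  have "((\<lambda>x. x $ i) has_derivative (\<lambda>x. x $ i)) (at (\<phi> p))"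
    by (simp add: bounded_linear_imp_has_derivative bounded_linear_vec_nth)
  then have "((coord \<phi> i) \<circ> inv_into U \<phi> has_derivative (\<lambda>x. x $ i)) (at (\<phi> p))"
    by (rule has_derivative_transform_within_open[OF _ chart_image_open[OF assms(1)]])
       (use assms chart_inv[OF assms(1)] in auto)
  from fun_cong[OF frechet_derivative_at[OF this], of c] show ?thesis
    unfolding coord_vec_def using smooth_near_coordinate[OF assms, of i] by simp
qed

lemma curve_locally_in_open:
  assumes "continuous_on I \<gamma>" "t \<in> I" "open W" "\<gamma> t \<in> W"
  obtains S where "open S" "t \<in> S" "I \<inter> S = I \<inter> \<gamma> -` W" "\<gamma> ` (I \<inter> S) \<subseteq> W"
proof -
  obtain S where "open S" "S \<inter> I = \<gamma> -` W \<inter> I"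
    using assms(1,3) unfolding continuous_on_open_invariant by blast
  then show ?thesis using that[of S] assms by blast
qed

text \<open>The chain rule through the chart. The curve stays in the chart only near \<open>t\<close>, on \<open>I \<inter> S\<close>, which does
not affect derivatives within \<open>I\<close>.\<close>

lemma velocity_coord:
  assumes I: "derivative_domain I" "t \<in> I" and \<gamma>: "smooth_curve A I \<gamma>"
    and c: "(U, \<phi>) \<in> A" "\<gamma> t \<in> U"
  shows "((\<phi> \<circ> \<gamma>) has_vector_derivative vector_derivative (\<phi> \<circ> \<gamma>) (at t within I)) (at t within I)"
    and "smooth_near A (\<gamma> t) f \<Longrightarrow>
      ((f \<circ> \<gamma>) has_vector_derivative velocity A I \<gamma> t f) (at t within I)"
    and "velocity A I \<gamma> t = coord_vec U \<phi> (vector_derivative (\<phi> \<circ> \<gamma>) (at t within I)) (\<gamma> t)"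
proof -
  have cont: "continuous_on I \<gamma>" using \<gamma> by (simp add: smooth_curve_def)
  obtain S where S: "open S" "t \<in> S" "I \<inter> S = I \<inter> \<gamma> -` U" "\<gamma> ` (I \<inter> S) \<subseteq> U"
    using curve_locally_in_open[OF cont I(2) chart_open[OF c(1)] c(2)] .
  have at: "at t within (I \<inter> S) = at t within I" by (rule at_within_Int_open_eq[OF S(1,2)])
  have "smooth_on (I \<inter> S) (\<phi> \<circ> \<gamma>)" using \<gamma> c(1) S(3) by (auto simp: smooth_curve_def)
  from smooth_on_has_vector_derivative[OF derivative_domain_Int_open[OF I(1) S(1)] this, of t]
  show D: "((\<phi> \<circ> \<gamma>) has_vector_derivative vector_derivative (\<phi> \<circ> \<gamma>) (at t within I)) (at t within I)"
    using S(2) I(2) unfolding at by blast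
  have E: "((f \<circ> \<gamma>) has_vector_derivative
      coord_vec U \<phi> (vector_derivative (\<phi> \<circ> \<gamma>) (at t within I)) (\<gamma> t) f) (at t within I)"
    if f: "smooth_near A (\<gamma> t) f" for f
  proof -
    have "(f \<circ> inv_into U \<phi> has_derivative frechet_derivative (f \<circ> inv_into U \<phi>) (at (\<phi> (\<gamma> t))))
        (at ((\<phi> \<circ> \<gamma>) t) within (\<phi> \<circ> \<gamma>) ` I)"
      using has_derivative_at_withinI[OF smooth_near_has_derivative[OF c f]] unfolding comp_apply .
    from vector_derivative_diff_chain_within[OF D this]
    have "((f \<circ> inv_into U \<phi>) \<circ> (\<phi> \<circ> \<gamma>) has_vector_derivative
        coord_vec U \<phi> (vector_derivative (\<phi> \<circ> \<gamma>) (at t within I)) (\<gamma> t) f) (at t within (I \<inter> S))"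
      unfolding at by (simp only: coord_vec_def f if_True)
    then have "((f \<circ> \<gamma>) has_vector_derivative
        coord_vec U \<phi> (vector_derivative (\<phi> \<circ> \<gamma>) (at t within I)) (\<gamma> t) f) (at t within (I \<inter> S))"
      by (rule has_vector_derivative_transform[rotated 2])
         (use S I(2) chart_inv[OF c(1)] in auto)
    then show ?thesis by (simp add: at)
  qed
  show V: "velocity A I \<gamma> t = coord_vec U \<phi> (vector_derivative (\<phi> \<circ> \<gamma>) (at t within I)) (\<gamma> t)"
  proof
    fix f
    show "velocity A I \<gamma> t f = coord_vec U \<phi> (vector_derivative (\<phi> \<circ> \<gamma>) (at t within I)) (\<gamma> t) f"
    proof (cases "smooth_near A (\<gamma> t) f")
      case True
      show ?thesis
        using vector_derivative_within[OF derivative_domain_at_not_bot[OF I] E[OF True]] True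
        by (simp add: velocity_def)
    qed (simp add: velocity_def coord_vec_def)
  qed
  show "smooth_near A (\<gamma> t) f \<Longrightarrow>
      ((f \<circ> \<gamma>) has_vector_derivative velocity A I \<gamma> t f) (at t within I)"
    unfolding V by (rule E)
qed

text \<open>The vector is the velocity of the straight line through \<open>\<phi> p\<close> in the chart, restricted to a time
interval in which the line stays in the image of the chart.\<close>

lemma coord_vec_tangent:
  assumes c: "(U, \<phi>) \<in> A" "p \<in> U"
  shows "coord_vec U \<phi> v p \<in> tangent_space A p"
proof -
  obtain r where r: "r > 0" "ball (\<phi> p) r \<subseteq> \<phi> ` U"
    using chart_image_open[OF c(1)] c(2) openE by blast
  \<comment> \<open>adding \<open>1\<close> avoids a division by \<open>0\<close> when \<open>v = 0\<close>\<close>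
  define e where "e = r / (norm v + 1)"
  have nv: "norm v + 1 > 0" using norm_ge_zero[of v] by linarith
  have e: "e > 0" using r nv by (simp add: e_def)
  let ?I = "{-e<..<e}"
  define l where "l = (\<lambda>t::real. \<phi> p + t *\<^sub>R v)"
  define \<sigma> where "\<sigma> = (\<lambda>t. inv_into U \<phi> (l t))"
  have l: "l t \<in> \<phi> ` U" if "t \<in> ?I" for t
  proof -
    have "\<bar>t\<bar> * norm v \<le> \<bar>t\<bar> * (norm v + 1)" by (intro mult_left_mono) auto
    also have "\<dots> < e * (norm v + 1)" using that nv by (intro mult_strict_right_mono) auto
    also have "\<dots> = r" using nv by (simp add: e_def)
    finally have "dist (\<phi> p) (l t) < r" by (simp add: l_def dist_norm)
    then show ?thesis using r by auto
  qed
  have \<sigma>: "\<sigma> t \<in> U" "\<phi> (\<sigma> t) = l t" if "t \<in> ?I" for t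
    using l[OF that] by (auto simp: \<sigma>_def inv_into_into f_inv_into_f)
  have l_smooth: "smooth_on T l" for T
    unfolding l_def by (intro smooth_on_add smooth_on_const smooth_on_linear bounded_linear_scaleR_left)
  have cont: "continuous_on ?I \<sigma>"
    unfolding \<sigma>_def
    by (rule continuous_on_compose2[of "\<phi> ` U" "inv_into U \<phi>"])
       (use chart_homeomorphism[OF c(1)] l in \<open>auto simp: homeomorphism_def l_def intro!: continuous_intros\<close>)
  have "smooth_on (?I \<inter> \<sigma> -` V) (\<psi> \<circ> \<sigma>)" if d: "(V, \<psi>) \<in> A" for V \<psi>
  proof -
    have "smooth_on (?I \<inter> \<sigma> -` V) (\<lambda>t. (\<psi> \<circ> inv_into U \<phi>) (l t))"
    proof (rule smooth_on_compose[OF l_smooth transition_smooth[OF c(1) d]])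
      show "l ` (?I \<inter> \<sigma> -` V) \<subseteq> \<phi> ` (U \<inter> V)"
      proof
        fix y assume "y \<in> l ` (?I \<inter> \<sigma> -` V)"
        then obtain t where t: "t \<in> ?I" "\<sigma> t \<in> V" "y = l t" by blast
        then have "y = \<phi> (\<sigma> t)" "\<sigma> t \<in> U \<inter> V" using \<sigma>[OF t(1)] by auto
        then show "y \<in> \<phi> ` (U \<inter> V)" by blast
      qed
    qed
    then show ?thesis by (simp add: o_def \<sigma>_def)
  qed
  then have curve: "smooth_curve A ?I \<sigma>" using cont by (auto simp: smooth_curve_def)
  have s0: "\<sigma> 0 = p" using chart_inv[OF c] by (simp add: \<sigma>_def l_def)
  have at: "at 0 within ?I = at 0" using e by (intro at_within_open) auto
  have "(l has_vector_derivative v) (at 0)"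
    unfolding l_def by (auto intro!: derivative_eq_intros)
  then have "(\<phi> \<circ> \<sigma> has_vector_derivative v) (at 0)"
    by (rule has_vector_derivative_transform_within_open[where S = ?I]) (use \<sigma> e in auto)
  then have "vector_derivative (\<phi> \<circ> \<sigma>) (at 0 within ?I) = v"
    by (simp add: at vector_derivative_at)
  then have "coord_vec U \<phi> v p = velocity A ?I \<sigma> 0"
    using velocity_coord(3)[OF derivative_domain_open _ curve c(1), of 0] e c(2) s0 by auto
  then show ?thesis unfolding tangent_space_def using e curve s0 by blast
qed

text \<open>This identification with the coordinate space yields the vector space structure, the coordinate
basis and the derivation properties of tangent vectors.\<close>

lemma tangent_space_eq:
  assumes c: "(U, \<phi>) \<in> A" "p \<in> U"
  shows "tangent_space A p = range (\<lambda>v. coord_vec U \<phi> v p)"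
proof
  show "tangent_space A p \<subseteq> range (\<lambda>v. coord_vec U \<phi> v p)"
  proof
    fix w assume "w \<in> tangent_space A p"
    then obtain e \<sigma> where e: "e > 0" and \<sigma>: "smooth_curve A {-e<..<e} \<sigma>" "\<sigma> 0 = p"
      and w: "w = velocity A {-e<..<e} \<sigma> 0"
      unfolding tangent_space_def by blast
    show "w \<in> range (\<lambda>v. coord_vec U \<phi> v p)"
      unfolding w using velocity_coord(3)[OF derivative_domain_open _ \<sigma>(1) c(1)] e \<sigma>(2) c(2) by auto
  qed
qed (use coord_vec_tangent[OF c] in blast)

lemma velocity_tangent:
  assumes "derivative_domain I" "t \<in> I" "smooth_curve A I \<gamma>"
  shows "velocity A I \<gamma> t \<in> tangent_space A (\<gamma> t)"
proof -
  obtain U \<phi> where c: "(U, \<phi>) \<in> A" "\<gamma> t \<in> U" using chart_exists by blast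
  show ?thesis unfolding tangent_space_eq[OF c] velocity_coord(3)[OF assms c] by blast
qed

lemma velocity_has_derivative:
  assumes "derivative_domain I" "t \<in> I" "smooth_curve A I \<gamma>" "smooth_near A (\<gamma> t) f"
  shows "((\<lambda>s. f (\<gamma> s)) has_vector_derivative velocity A I \<gamma> t f) (at t within I)"
proof -
  obtain U \<phi> where c: "(U, \<phi>) \<in> A" "\<gamma> t \<in> U" using chart_exists by blast
  show ?thesis using velocity_coord(2)[OF assms(1-3) c assms(4)] by (simp add: o_def)
qed

lemma subspace_tangent_space: "subspace (tangent_space A p)"
proof -
  obtain U \<phi> where c: "(U, \<phi>) \<in> A" "p \<in> U" using chart_exists by blast
  show ?thesis unfolding tangent_space_eq[OF c]
    by (rule linear_subspace_image[OF coord_vec_linear[OF c] subspace_UNIV])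
qed

lemma tangent_expand:
  assumes c: "(U, \<phi>) \<in> A" "p \<in> U" and v: "v \<in> tangent_space A p"
  shows "v = (\<Sum>i\<in>UNIV. v (coord \<phi> i) *\<^sub>R frame U \<phi> i p)"
proof -
  obtain w where w: "v = coord_vec U \<phi> w p" using v unfolding tangent_space_eq[OF c] by blast
  have "v = coord_vec U \<phi> (\<Sum>i\<in>UNIV. w $ i *\<^sub>R axis i 1) p"
    unfolding w using basis_expansion[of w] by (simp add: scalar_mult_eq_scaleR)
  also have "\<dots> = (\<Sum>i\<in>UNIV. w $ i *\<^sub>R frame U \<phi> i p)"
    unfolding linear_sum[OF coord_vec_linear[OF c]] linear_scale[OF coord_vec_linear[OF c]] ..
  finally show ?thesis unfolding w coord_vec_coordinate[OF c] .
qed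

lemma tangent_cong:
  assumes "v \<in> tangent_space A p" "open W" "p \<in> W" "\<And>q. q \<in> W \<Longrightarrow> f q = g q"
  shows "v f = v g"
proof -
  obtain U \<phi> where c: "(U, \<phi>) \<in> A" "p \<in> U" using chart_exists by blast
  obtain w where w: "v = coord_vec U \<phi> w p" using assms(1) unfolding tangent_space_eq[OF c] by blast
  show ?thesis
  proof (cases "smooth_near A p f")
    case True
    then have g: "smooth_near A p g" using smooth_near_cong[of W p f g, OF assms(2,3,4)] by blast
    have "(g \<circ> inv_into U \<phi> has_derivative frechet_derivative (f \<circ> inv_into U \<phi>) (at (\<phi> p))) (at (\<phi> p))"
      by (rule has_derivative_transform_within_open[OF smooth_near_has_derivative[OF c True]
            chart_open_image[OF c(1) assms(2)]])
         (use c assms chart_inv[OF c(1)] in auto)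
    from frechet_derivative_at[OF this] show ?thesis using True g by (simp add: w coord_vec_def)
  next
    case False
    then have "\<not> smooth_near A p g" using smooth_near_cong[of W p f g, OF assms(2,3,4)] by blast
    with False show ?thesis by (simp add: w coord_vec_def)
  qed
qed

lemma smooth_near_const: "smooth_near A p (\<lambda>q. a)"
  by (rule smooth_nearI[OF open_UNIV UNIV_I smooth_fun_const])

lemma smooth_near_common:
  assumes "smooth_near A p f" "smooth_near A p g"
  obtains W where "open W" "p \<in> W" "smooth_fun A W f" "smooth_fun A W g"
proof -
  obtain W W' where "open W" "p \<in> W" "smooth_fun A W f" "open W'" "p \<in> W'" "smooth_fun A W' g"
    using assms unfolding smooth_near_def by blast
  then show ?thesis using that[of "W \<inter> W'"] by (auto intro: smooth_fun_subset)
qed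

lemma smooth_near_add: "smooth_near A p f \<Longrightarrow> smooth_near A p g \<Longrightarrow> smooth_near A p (\<lambda>q. f q + g q)"
  by (erule smooth_near_common, assumption) (rule smooth_nearI[OF _ _ smooth_fun_add])

lemma smooth_near_mult: "smooth_near A p f \<Longrightarrow> smooth_near A p g \<Longrightarrow> smooth_near A p (\<lambda>q. f q * g q)"
  by (erule smooth_near_common, assumption) (rule smooth_nearI[OF _ _ smooth_fun_mult])

lemma smooth_near_sum:
  "(\<And>i. i \<in> B \<Longrightarrow> smooth_near A p (f i)) \<Longrightarrow> smooth_near A p (\<lambda>q. \<Sum>i\<in>B. f i q)"
proof (induction B rule: infinite_finite_induct)
  case (insert x F)
  then show ?case using smooth_near_add[of p "f x" "\<lambda>q. \<Sum>i\<in>F. f i q"] by simp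
qed (simp_all add: smooth_near_const)

lemma tangent_const: "v \<in> tangent_space A p \<Longrightarrow> v (\<lambda>q. a) = 0"
proof -
  assume v: "v \<in> tangent_space A p"
  obtain U \<phi> where c: "(U, \<phi>) \<in> A" "p \<in> U" using chart_exists by blast
  obtain w where w: "v = coord_vec U \<phi> w p" using v unfolding tangent_space_eq[OF c] by blast
  show ?thesis by (simp add: w coord_vec_def o_def)
qed

lemma tangent_add:
  assumes "v \<in> tangent_space A p" and f: "smooth_near A p f" and g: "smooth_near A p g"
  shows "v (\<lambda>q. f q + g q) = v f + v g"
proof -
  obtain U \<phi> where c: "(U, \<phi>) \<in> A" "p \<in> U" using chart_exists by blast
  obtain w where w: "v = coord_vec U \<phi> w p" using assms(1) unfolding tangent_space_eq[OF c] by blast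
  note D = has_derivative_add[OF smooth_near_has_derivative[OF c f] smooth_near_has_derivative[OF c g]]
  show ?thesis
    using fun_cong[OF frechet_derivative_at[OF D], of w] smooth_near_add[OF f g] f g
    by (simp add: w coord_vec_def o_def)
qed

lemma tangent_mult:
  assumes "v \<in> tangent_space A p" and f: "smooth_near A p f" and g: "smooth_near A p g"
  shows "v (\<lambda>q. f q * g q) = v f * g p + f p * v g"
proof -
  obtain U \<phi> where c: "(U, \<phi>) \<in> A" "p \<in> U" using chart_exists by blast
  obtain w where w: "v = coord_vec U \<phi> w p" using assms(1) unfolding tangent_space_eq[OF c] by blast
  note D = has_derivative_mult[OF smooth_near_has_derivative[OF c f] smooth_near_has_derivative[OF c g]]
  show ?thesis
    using fun_cong[OF frechet_derivative_at[OF D], of w] smooth_near_mult[OF f g] f g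
    by (simp add: w coord_vec_def o_def chart_inv[OF c])
qed

lemma tangent_sum:
  assumes "v \<in> tangent_space A p"
  shows "(\<And>i. i \<in> B \<Longrightarrow> smooth_near A p (f i)) \<Longrightarrow> v (\<lambda>q. \<Sum>i\<in>B. f i q) = (\<Sum>i\<in>B. v (f i))"
proof (induction B rule: infinite_finite_induct)
  case (insert x F)
  then show ?case using tangent_add[OF assms, of "f x" "\<lambda>q. \<Sum>i\<in>F. f i q"] smooth_near_sum[of F p f] by simp
qed (simp_all add: tangent_const[OF assms])

lemma tangent_minus:
  assumes "v \<in> tangent_space A p" "smooth_near A p f"
  shows "v (\<lambda>q. - f q) = - v f"
  using tangent_mult[OF assms(1) smooth_near_const[of p "-1"] assms(2)] tangent_const[OF assms(1)] by simp

end

lemma sum_fun_apply: "(\<Sum>i\<in>B. F i) x = (\<Sum>i\<in>B. F i x)"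
  by (induction B rule: infinite_finite_induct) simp_all

context smooth_manifold
begin

lemma vector_field_tangent: "vector_field A W X \<Longrightarrow> p \<in> W \<Longrightarrow> X p \<in> tangent_space A p"
  and vector_field_smooth: "vector_field A W X \<Longrightarrow> open W' \<Longrightarrow> W' \<subseteq> W \<Longrightarrow> smooth_fun A W' f \<Longrightarrow>
     smooth_fun A W' (\<lambda>p. X p f)"
  unfolding vector_field_def by blast+

lemma vector_fieldI:
  assumes "\<And>p. p \<in> W \<Longrightarrow> X p \<in> tangent_space A p"
    "\<And>W' f. open W' \<Longrightarrow> W' \<subseteq> W \<Longrightarrow> smooth_fun A W' f \<Longrightarrow> smooth_fun A W' (\<lambda>p. X p f)"
  shows "vector_field A W X"
  using assms unfolding vector_field_def by simp

lemma vector_field_subset: "vector_field A W X \<Longrightarrow> W' \<subseteq> W \<Longrightarrow> vector_field A W' X"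
  by (intro vector_fieldI) (auto intro: vector_field_tangent vector_field_smooth)

lemma vector_field_cong:
  assumes "vector_field A W X" "\<And>q. q \<in> W \<Longrightarrow> X q = Y q"
  shows "vector_field A W Y"
proof (rule vector_fieldI)
  show "Y p \<in> tangent_space A p" if "p \<in> W" for p
    using vector_field_tangent[OF assms(1) that] assms(2)[OF that] by simp
  show "smooth_fun A W' (\<lambda>p. Y p f)" if "open W'" "W' \<subseteq> W" "smooth_fun A W' f" for W' f
    by (rule smooth_fun_cong[OF _ vector_field_smooth[OF assms(1) that]]) (use assms(2) that in auto)
qed

lemma vector_field_add:
  assumes "vector_field A W X" "vector_field A W Y"
  shows "vector_field A W (\<lambda>q. X q + Y q)"
proof (rule vector_fieldI)
  show "X p + Y p \<in> tangent_space A p" if "p \<in> W" for p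
    using vector_field_tangent[OF _ that] assms subspace_add[OF subspace_tangent_space] by blast
  show "smooth_fun A W' (\<lambda>p. (X p + Y p) f)" if "open W'" "W' \<subseteq> W" "smooth_fun A W' f" for W' f
    using smooth_fun_add[OF vector_field_smooth[OF assms(1) that] vector_field_smooth[OF assms(2) that]]
    by simp
qed

lemma vector_field_scale:
  assumes "smooth_fun A W h" "vector_field A W X"
  shows "vector_field A W (\<lambda>q. h q *\<^sub>R X q)"
proof (rule vector_fieldI)
  show "h p *\<^sub>R X p \<in> tangent_space A p" if "p \<in> W" for p
    using vector_field_tangent[OF assms(2) that] subspace_scale[OF subspace_tangent_space] by blast
  show "smooth_fun A W' (\<lambda>p. (h p *\<^sub>R X p) f)" if "open W'" "W' \<subseteq> W" "smooth_fun A W' f" for W' f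
    using smooth_fun_mult[OF smooth_fun_subset[OF assms(1) that(2)] vector_field_smooth[OF assms(2) that]]
    by (simp add: scaleR_fun_def)
qed

lemma vector_field_zero: "vector_field A W (\<lambda>q. 0)"
  by (rule vector_fieldI) (auto simp: subspace_0[OF subspace_tangent_space] smooth_fun_const)

lemma vector_field_diff:
  assumes "vector_field A W X" "vector_field A W Y"
  shows "vector_field A W (\<lambda>q. X q - Y q)"
  using vector_field_add[OF assms(1) vector_field_scale[OF smooth_fun_const assms(2), of "-1"]] by simp

lemma vector_field_local:
  assumes "\<And>p. p \<in> W \<Longrightarrow> \<exists>N. open N \<and> p \<in> N \<and> vector_field A (W \<inter> N) X"
  shows "vector_field A W X"
proof (rule vector_fieldI)
  show "X p \<in> tangent_space A p" if "p \<in> W" for p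
    using assms[OF that] vector_field_tangent that by blast
  fix W' f assume W': "open W'" "W' \<subseteq> W" "smooth_fun A W' f"
  show "smooth_fun A W' (\<lambda>p. X p f)"
  proof (rule smooth_fun_local[OF W'(1)])
    fix p assume "p \<in> W'"
    then obtain N where N: "open N" "p \<in> N" "vector_field A (W \<inter> N) X" using assms W' by blast
    have "smooth_fun A (W' \<inter> N) (\<lambda>p. X p f)"
      by (rule vector_field_smooth[OF N(3) _ _ smooth_fun_subset[OF W'(3)]]) (use N W' in auto)
    then show "\<exists>N. open N \<and> p \<in> N \<and> smooth_fun A (W' \<inter> N) (\<lambda>p. X p f)" using N by blast
  qed
qed

lemma coord_vec_apply_smooth:
  assumes c: "(U, \<phi>) \<in> A" and f: "open W" "smooth_fun A W f"
  shows "smooth_on (\<phi> ` (U \<inter> W)) (\<lambda>x. frechet_derivative (f \<circ> inv_into U \<phi>) (at x) v)"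
    and "\<And>x. x \<in> \<phi> ` (U \<inter> W) \<Longrightarrow> frechet_derivative (f \<circ> inv_into U \<phi>) (at x) v
      = ((\<lambda>p. coord_vec U \<phi> v p f) \<circ> inv_into U \<phi>) x"
proof -
  show "smooth_on (\<phi> ` (U \<inter> W)) (\<lambda>x. frechet_derivative (f \<circ> inv_into U \<phi>) (at x) v)"
    by (rule smooth_on_frechet_derivative[OF chart_open_image[OF c f(1)] smooth_fun_smooth_on[OF f(2) c]])
  show "frechet_derivative (f \<circ> inv_into U \<phi>) (at x) v
      = ((\<lambda>p. coord_vec U \<phi> v p f) \<circ> inv_into U \<phi>) x" if "x \<in> \<phi> ` (U \<inter> W)" for x
    using that smooth_nearI[OF f(1) _ f(2)] by (auto simp: coord_vec_def chart_inv[OF c])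
qed

lemma coord_vec_field:
  assumes c: "(U, \<phi>) \<in> A"
  shows "vector_field A U (coord_vec U \<phi> v)"
proof (rule vector_fieldI)
  show "coord_vec U \<phi> v p \<in> tangent_space A p" if "p \<in> U" for p by (rule coord_vec_tangent[OF c that])
  fix W f assume W: "open W" "W \<subseteq> U" "smooth_fun A W f"
  have UW: "U \<inter> W = W" using W by blast
  show "smooth_fun A W (\<lambda>p. coord_vec U \<phi> v p f)"
    by (rule smooth_fun_chartI[OF c W(2)])
       (rule smooth_on_cong[OF coord_vec_apply_smooth(2,1)[OF c W(1,3), unfolded UW]])
qed

text \<open>In coordinates both sides are second derivatives of the same function.\<close>

lemma coord_vec_commute:
  assumes c: "(U, \<phi>) \<in> A" "p \<in> U" and f: "smooth_near A p f"
  shows "coord_vec U \<phi> v p (\<lambda>q. coord_vec U \<phi> w q f) = coord_vec U \<phi> w p (\<lambda>q. coord_vec U \<phi> v q f)"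
proof -
  obtain W where W: "open W" "p \<in> W" "smooth_fun A W f" using f unfolding smooth_near_def by blast
  let ?F = "f \<circ> inv_into U \<phi>"
  have x: "\<phi> p \<in> \<phi> ` (U \<inter> W)" using c W by blast
  note op = chart_open_image[OF c(1) W(1)]
  have *: "coord_vec U \<phi> v p (\<lambda>q. coord_vec U \<phi> w q f)
      = frechet_derivative (\<lambda>x. frechet_derivative ?F (at x) w) (at (\<phi> p)) v" for v w
  proof -
    have sm: "smooth_near A p (\<lambda>q. coord_vec U \<phi> w q f)"
      by (rule smooth_nearI[of "U \<inter> W"], use c chart_open W in blast, use c W in blast)
         (rule vector_field_smooth[OF coord_vec_field[OF c(1)] _ _ smooth_fun_subset[OF W(3)]],
           use c chart_open W in auto)
    have "((\<lambda>q. coord_vec U \<phi> w q f) \<circ> inv_into U \<phi> has_derivative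
        frechet_derivative (\<lambda>x. frechet_derivative ?F (at x) w) (at (\<phi> p))) (at (\<phi> p))"
      by (rule has_derivative_transform_within_open[OF
            smooth_on_open_has_derivative[OF op coord_vec_apply_smooth(1)[OF c(1) W(1,3)] x] op x])
         (rule coord_vec_apply_smooth(2)[OF c(1) W(1,3)])
    from fun_cong[OF frechet_derivative_at[OF this], of v] show ?thesis
      using sm unfolding coord_vec_def[of U \<phi> v] by simp
  qed
  show ?thesis
    unfolding * by (rule frechet_derivative_commute[OF op smooth_fun_smooth_on[OF W(3) c(1)] x])
qed

text \<open>Local fields, as a connection and a bracket at \<open>p\<close> see only the germ of a field.\<close>

definition field_near :: "'a vfield \<Rightarrow> 'a \<Rightarrow> bool" where
  "field_near X p \<longleftrightarrow> (\<exists>W. open W \<and> p \<in> W \<and> vector_field A W X)"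

lemma field_nearI: "open W \<Longrightarrow> p \<in> W \<Longrightarrow> vector_field A W X \<Longrightarrow> field_near X p"
  unfolding field_near_def by blast

lemma field_near_tangent: "field_near X p \<Longrightarrow> X p \<in> tangent_space A p"
  unfolding field_near_def using vector_field_tangent by blast

lemma field_near_common:
  assumes "field_near X p" "field_near Y p"
  obtains W where "open W" "p \<in> W" "vector_field A W X" "vector_field A W Y"
proof -
  obtain W W' where "open W" "p \<in> W" "vector_field A W X" "open W'" "p \<in> W'" "vector_field A W' Y"
    using assms unfolding field_near_def by blast
  then show ?thesis using that[of "W \<inter> W'"] by (auto intro: vector_field_subset)
qed

lemma field_near_add: "field_near X p \<Longrightarrow> field_near Y p \<Longrightarrow> field_near (\<lambda>q. X q + Y q) p"
  by (erule field_near_common, assumption) (rule field_nearI[OF _ _ vector_field_add])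

lemma field_near_scale:
  assumes "smooth_near A p f" "field_near X p"
  shows "field_near (\<lambda>q. f q *\<^sub>R X q) p"
proof -
  obtain W W' where "open W" "p \<in> W" "vector_field A W X" "open W'" "p \<in> W'" "smooth_fun A W' f"
    using assms unfolding field_near_def smooth_near_def by blast
  then show ?thesis
    by (intro field_nearI[of "W \<inter> W'"] vector_field_scale)
       (auto intro: vector_field_subset smooth_fun_subset)
qed

lemma field_near_sum:
  "(\<And>i. i \<in> B \<Longrightarrow> field_near (X i) p) \<Longrightarrow> field_near (\<lambda>q. \<Sum>i\<in>B. X i q) p"
proof (induction B rule: infinite_finite_induct)
  case (insert x F)
  then show ?case
    unfolding sum.insert[OF insert.hyps]
    using field_near_add[of "X x" p "\<lambda>q. \<Sum>i\<in>F. X i q"] by blast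
qed (auto intro!: field_nearI[OF open_UNIV UNIV_I vector_field_zero])

lemma field_near_coord: "(U, \<phi>) \<in> A \<Longrightarrow> p \<in> U \<Longrightarrow> field_near (coord_vec U \<phi> v) p"
  by (rule field_nearI[OF chart_open _ coord_vec_field])

lemma field_near_apply:
  assumes "field_near X p" "smooth_near A p f"
  shows "smooth_near A p (\<lambda>q. X q f)"
proof -
  obtain W W' where "open W" "p \<in> W" "vector_field A W X" "open W'" "p \<in> W'" "smooth_fun A W' f"
    using assms unfolding field_near_def smooth_near_def by blast
  then show ?thesis
    by (intro smooth_nearI[of "W \<inter> W'"] vector_field_smooth[of W X]) (auto intro: smooth_fun_subset)
qed

lemma field_near_expand:
  assumes c: "(U, \<phi>) \<in> A" "p \<in> U" and X: "field_near X p"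
  obtains W where "open W" "p \<in> W" "W \<subseteq> U" "vector_field A W X"
    "\<And>q. q \<in> W \<Longrightarrow> X q = (\<Sum>i\<in>UNIV. X q (coord \<phi> i) *\<^sub>R frame U \<phi> i q)"
proof -
  obtain W where W: "open W" "p \<in> W" "vector_field A W X" using X unfolding field_near_def by blast
  show ?thesis
  proof (rule that[of "U \<inter> W"])
    show "X q = (\<Sum>i\<in>UNIV. X q (coord \<phi> i) *\<^sub>R frame U \<phi> i q)" if "q \<in> U \<inter> W" for q
      by (rule tangent_expand[OF c(1)]) (use that vector_field_tangent[OF W(3)] in auto)
  qed (use W c chart_open[OF c(1)] vector_field_subset[OF W(3)] in auto)
qed

lemma field_extension_exists:
  assumes "v \<in> tangent_space A p"
  obtains X where "field_near X p" "X p = v"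
proof -
  obtain U \<phi> where c: "(U, \<phi>) \<in> A" "p \<in> U" using chart_exists by blast
  obtain w where "v = coord_vec U \<phi> w p" using assms unfolding tangent_space_eq[OF c] by blast
  then show ?thesis using that field_near_coord[OF c] by blast
qed

section \<open>Lie brackets\<close>

text \<open>The second sum, the part of second order in \<open>f\<close>, is symmetric in \<open>v\<close> and \<open>Y p\<close> and therefore drops out
of a bracket.\<close>

lemma tangent_apply_field:
  assumes c: "(U, \<phi>) \<in> A" "p \<in> U" and Y: "field_near Y p" and f: "smooth_near A p f"
    and v: "v \<in> tangent_space A p"
  shows "v (\<lambda>q. Y q f) =
     (\<Sum>j\<in>UNIV. v (\<lambda>q. Y q (coord \<phi> j)) * frame U \<phi> j p f)
     + (\<Sum>j\<in>UNIV. \<Sum>i\<in>UNIV. Y p (coord \<phi> j) * v (coord \<phi> i) *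
         frame U \<phi> i p (\<lambda>q. frame U \<phi> j q f))"
proof -
  let ?e = "frame U \<phi>" and ?x = "coord \<phi>"
  obtain W where W: "open W" "p \<in> W" "W \<subseteq> U" "vector_field A W Y"
    "\<And>q. q \<in> W \<Longrightarrow> Y q = (\<Sum>i\<in>UNIV. Y q (?x i) *\<^sub>R ?e i q)"
    using field_near_expand[OF c Y] by blast
  have sY: "smooth_near A p (\<lambda>q. Y q (?x j))" for j
    by (rule field_near_apply[OF Y smooth_near_coordinate[OF c]])
  have se: "smooth_near A p (\<lambda>q. ?e j q f)" for j
    by (rule field_near_apply[OF field_near_coord[OF c] f])
  have "Y q f = (\<Sum>j\<in>UNIV. Y q (?x j) * ?e j q f)" if "q \<in> W" for q
    using fun_cong[OF W(5)[OF that], of f] by (simp add: sum_fun_apply scaleR_fun_def)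
  then have "v (\<lambda>q. Y q f) = v (\<lambda>q. \<Sum>j\<in>UNIV. Y q (?x j) * ?e j q f)"
    by (rule tangent_cong[OF v W(1,2)])
  also have "\<dots> = (\<Sum>j\<in>UNIV. v (\<lambda>q. Y q (?x j) * ?e j q f))"
    by (rule tangent_sum[OF v smooth_near_mult[OF sY se]])
  also have "\<dots> = (\<Sum>j\<in>UNIV. v (\<lambda>q. Y q (?x j)) * ?e j p f + Y p (?x j) * v (\<lambda>q. ?e j q f))"
    by (simp add: tangent_mult[OF v sY se])
  also have "\<dots> = (\<Sum>j\<in>UNIV. v (\<lambda>q. Y q (?x j)) * ?e j p f + (\<Sum>i\<in>UNIV. Y p (?x j) * v (?x i) * ?e i p (\<lambda>q. ?e j q f)))"
  proof (rule sum.cong[OF refl])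
    fix j
    have "v (\<lambda>q. ?e j q f) = (\<Sum>i\<in>UNIV. v (?x i) * ?e i p (\<lambda>q. ?e j q f))"
      using fun_cong[OF tangent_expand[OF c v], of "\<lambda>q. ?e j q f"]
      by (simp add: sum_fun_apply scaleR_fun_def)
    then show "v (\<lambda>q. Y q (?x j)) * ?e j p f + Y p (?x j) * v (\<lambda>q. ?e j q f)
      = v (\<lambda>q. Y q (?x j)) * ?e j p f + (\<Sum>i\<in>UNIV. Y p (?x j) * v (?x i) * ?e i p (\<lambda>q. ?e j q f))"
      by (simp add: sum_distrib_left mult.assoc)
  qed
  finally show ?thesis by (simp add: sum.distrib)
qed

text \<open>The bracket is the coordinate vector \<open>w\<close> with coefficients \<open>X (Y\<^sup>j) - Y (X\<^sup>j)\<close>, because the terms of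
second order in \<open>f\<close> are symmetric.\<close>

lemma lie_bracket_tangent:
  assumes X: "field_near X p" and Y: "field_near Y p"
  shows "lie_bracket A X Y p \<in> tangent_space A p"
proof -
  obtain U \<phi> where c: "(U, \<phi>) \<in> A" "p \<in> U" using chart_exists by blast
  let ?e = "frame U \<phi>" and ?x = "coord \<phi>"
  define w where "w = (\<Sum>j\<in>UNIV. (X p (\<lambda>q. Y q (?x j)) - Y p (\<lambda>q. X q (?x j))) *\<^sub>R ?e j p)"
  have "lie_bracket A X Y p f = w f" for f
  proof (cases "smooth_near A p f")
    case True
    let ?H = "\<lambda>i j. ?e i p (\<lambda>q. ?e j q f)"
    have H: "?H i j = ?H j i" for i j by (rule coord_vec_commute[OF c True])
    have "(\<Sum>j\<in>UNIV. \<Sum>i\<in>UNIV. Y p (?x j) * X p (?x i) * ?H i j)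
        = (\<Sum>i\<in>UNIV. \<Sum>j\<in>UNIV. Y p (?x j) * X p (?x i) * ?H i j)" by (rule sum.swap)
    also have "\<dots> = (\<Sum>i\<in>UNIV. \<Sum>j\<in>UNIV. X p (?x i) * Y p (?x j) * ?H j i)"
      by (intro sum.cong refl) (simp add: H mult.commute)
    finally have "X p (\<lambda>q. Y q f) - Y p (\<lambda>q. X q f) =
        (\<Sum>j\<in>UNIV. X p (\<lambda>q. Y q (?x j)) * ?e j p f) - (\<Sum>j\<in>UNIV. Y p (\<lambda>q. X q (?x j)) * ?e j p f)"
      unfolding tangent_apply_field[OF c Y True field_near_tangent[OF X]]
        tangent_apply_field[OF c X True field_near_tangent[OF Y]] by simp
    then show ?thesis
      using True by (simp add: lie_bracket_def w_def sum_fun_apply scaleR_fun_def sum_subtractf left_diff_distrib)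
  next
    case False
    then show ?thesis by (simp add: lie_bracket_def w_def sum_fun_apply scaleR_fun_def coord_vec_def)
  qed
  then have "lie_bracket A X Y p = w" by blast
  moreover have "w \<in> tangent_space A p"
    unfolding w_def
    by (intro subspace_sum[OF subspace_tangent_space] subspace_scale[OF subspace_tangent_space]
        coord_vec_tangent[OF c])
  ultimately show ?thesis by simp
qed

lemma lie_bracket_field:
  assumes W: "open W" and X: "vector_field A W X" and Y: "vector_field A W Y"
  shows "vector_field A W (lie_bracket A X Y)"
proof (rule vector_fieldI)
  show "lie_bracket A X Y p \<in> tangent_space A p" if "p \<in> W" for p
    by (rule lie_bracket_tangent[OF field_nearI[OF W that X] field_nearI[OF W that Y]])
  fix W' f assume W': "open W'" "W' \<subseteq> W" "smooth_fun A W' f"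
  have "smooth_fun A W' (\<lambda>p. X p (\<lambda>q. Y q f) - Y p (\<lambda>q. X q f))"
    by (intro smooth_fun_diff vector_field_smooth[OF X W'(1,2)] vector_field_smooth[OF Y W'(1,2)] W'(3))
  then show "smooth_fun A W' (\<lambda>p. lie_bracket A X Y p f)"
    by (rule smooth_fun_cong[rotated]) (simp add: lie_bracket_def smooth_nearI[OF W'(1) _ W'(3)])
qed

section \<open>Tensoriality\<close>

text \<open>A local operator that is linear over functions depends only on the value of the field at the point:
expand the field in a coordinate frame and pull out the coefficients. This is the reason why the
pointwise values of \<open>d\<theta>\<close>, of the torsion and of the curvature are well defined.\<close>

lemma pointwise_determined:
  fixes L :: "'a vfield \<Rightarrow> 'b::real_vector"
  assumes add: "\<And>X Y. field_near X p \<Longrightarrow> field_near Y p \<Longrightarrow> L (\<lambda>q. X q + Y q) = L X + L Y"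
    and scale: "\<And>f X. smooth_near A p f \<Longrightarrow> field_near X p \<Longrightarrow> L (\<lambda>q. f q *\<^sub>R X q) = f p *\<^sub>R L X"
    and cong: "\<And>X Y W. open W \<Longrightarrow> p \<in> W \<Longrightarrow> vector_field A W X \<Longrightarrow> vector_field A W Y \<Longrightarrow>
       (\<And>q. q \<in> W \<Longrightarrow> X q = Y q) \<Longrightarrow> L X = L Y"
    and X: "field_near X p" and Y: "field_near Y p" and XY: "X p = Y p"
  shows "L X = L Y"
proof -
  obtain U \<phi> where c: "(U, \<phi>) \<in> A" "p \<in> U" using chart_exists by blast
  let ?e = "frame U \<phi>" and ?x = "coord \<phi>"
  have L0: "L (\<lambda>q. 0) = 0"
    using scale[OF smooth_near_const[of p 0] X] by simp
  have "L X = (\<Sum>i\<in>UNIV. X p (?x i) *\<^sub>R L (?e i))" if X: "field_near X p" for X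
  proof -
    have s: "smooth_near A p (\<lambda>q. X q (?x i))" for i
      by (rule field_near_apply[OF X smooth_near_coordinate[OF c]])
    have Ls: "L (\<lambda>q. \<Sum>i\<in>B. X q (?x i) *\<^sub>R ?e i q) = (\<Sum>i\<in>B. X p (?x i) *\<^sub>R L (?e i))" for B
    proof (induction B rule: infinite_finite_induct)
      case (insert x F)
      have "L (\<lambda>q. \<Sum>i\<in>insert x F. X q (?x i) *\<^sub>R ?e i q)
          = L (\<lambda>q. X q (?x x) *\<^sub>R ?e x q + (\<Sum>i\<in>F. X q (?x i) *\<^sub>R ?e i q))"
        unfolding sum.insert[OF insert.hyps] ..
      also have "\<dots> = L (\<lambda>q. X q (?x x) *\<^sub>R ?e x q) + L (\<lambda>q. \<Sum>i\<in>F. X q (?x i) *\<^sub>R ?e i q)"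
        by (intro add field_near_sum field_near_scale[OF s field_near_coord[OF c]])
      also have "\<dots> = X p (?x x) *\<^sub>R L (?e x) + (\<Sum>i\<in>F. X p (?x i) *\<^sub>R L (?e i))"
        by (simp only: insert.IH scale[OF s field_near_coord[OF c]])
      finally show ?case unfolding sum.insert[OF insert.hyps] .
    qed (simp_all only: sum.empty sum.infinite not_False_eq_True L0)
    obtain W where W: "open W" "p \<in> W" "W \<subseteq> U" "vector_field A W X"
      "\<And>q. q \<in> W \<Longrightarrow> X q = (\<Sum>i\<in>UNIV. X q (?x i) *\<^sub>R ?e i q)"
      using field_near_expand[OF c X] by blast
    have "L X = L (\<lambda>q. \<Sum>i\<in>UNIV. X q (?x i) *\<^sub>R ?e i q)"
      by (rule cong[OF W(1,2,4) vector_field_cong[OF W(4) W(5)] W(5)])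
    then show ?thesis unfolding Ls .
  qed
  from this[OF X] this[OF Y] XY show ?thesis by simp
qed

lemma tensor2_eq:
  assumes wd: "\<And>X X' Y Y'. field_near X p \<Longrightarrow> field_near X' p \<Longrightarrow> field_near Y p \<Longrightarrow> field_near Y' p \<Longrightarrow>
      X p = X' p \<Longrightarrow> Y p = Y' p \<Longrightarrow> B X Y p = B X' Y' p"
    and X: "field_near X p" and Y: "field_near Y p" and u: "X p = u" and v: "Y p = v"
  shows "tensor2 A B p u v = B X Y p"
  unfolding tensor2_def
proof (rule the_equality)
  show "\<forall>W X' Y'. open W \<and> p \<in> W \<and> vector_field A W X' \<and> vector_field A W Y' \<and>
      X' p = u \<and> Y' p = v \<longrightarrow> B X' Y' p = B X Y p"
  proof (intro allI impI, elim conjE)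
    fix W X' Y' assume W: "open W" "p \<in> W" and f: "vector_field A W X'" "vector_field A W Y'"
      and e: "X' p = u" "Y' p = v"
    show "B X' Y' p = B X Y p"
      by (rule wd[OF field_nearI[OF W f(1)] X field_nearI[OF W f(2)] Y]) (simp_all add: e u v)
  qed
  fix r assume r: "\<forall>W X Y. open W \<and> p \<in> W \<and> vector_field A W X \<and> vector_field A W Y \<and>
      X p = u \<and> Y p = v \<longrightarrow> B X Y p = r"
  obtain W where "open W" "p \<in> W" "vector_field A W X" "vector_field A W Y"
    using field_near_common[OF X Y] .
  then show "r = B X Y p" using r[rule_format, of W X Y] u v by simp
qed

lemma tensor3_eq:
  assumes wd: "\<And>X X' Y Y' Z Z'. field_near X p \<Longrightarrow> field_near X' p \<Longrightarrow> field_near Y p \<Longrightarrow> field_near Y' p \<Longrightarrow>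
      field_near Z p \<Longrightarrow> field_near Z' p \<Longrightarrow>
      X p = X' p \<Longrightarrow> Y p = Y' p \<Longrightarrow> Z p = Z' p \<Longrightarrow> B X Y Z p = B X' Y' Z' p"
    and X: "field_near X p" and Y: "field_near Y p" and Z: "field_near Z p"
    and u: "X p = u" and v: "Y p = v" and w: "Z p = w"
  shows "tensor3 A B p u v w = B X Y Z p"
  unfolding tensor3_def
proof (rule the_equality)
  show "\<forall>W X' Y' Z'. open W \<and> p \<in> W \<and> vector_field A W X' \<and> vector_field A W Y' \<and> vector_field A W Z' \<and>
      X' p = u \<and> Y' p = v \<and> Z' p = w \<longrightarrow> B X' Y' Z' p = B X Y Z p"
  proof (intro allI impI, elim conjE)
    fix W X' Y' Z' assume W: "open W" "p \<in> W"
      and f: "vector_field A W X'" "vector_field A W Y'" "vector_field A W Z'"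
      and e: "X' p = u" "Y' p = v" "Z' p = w"
    show "B X' Y' Z' p = B X Y Z p"
      by (rule wd[OF field_nearI[OF W f(1)] X field_nearI[OF W f(2)] Y field_nearI[OF W f(3)] Z])
         (simp_all add: e u v w)
  qed
  fix r assume r: "\<forall>W X Y Z. open W \<and> p \<in> W \<and> vector_field A W X \<and> vector_field A W Y \<and>
      vector_field A W Z \<and> X p = u \<and> Y p = v \<and> Z p = w \<longrightarrow> B X Y Z p = r"
  obtain W where W: "open W" "p \<in> W" "vector_field A W X" "vector_field A W Y"
    using field_near_common[OF X Y] .
  obtain W' where W': "open W'" "p \<in> W'" "vector_field A W' Z"
    using Z unfolding field_near_def by blast
  have "open (W \<inter> W')" "p \<in> W \<inter> W'" "vector_field A (W \<inter> W') X" "vector_field A (W \<inter> W') Y"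
    "vector_field A (W \<inter> W') Z" using W W' by (auto intro: vector_field_subset)
  then show "r = B X Y Z p" using r[rule_format, of "W \<inter> W'" X Y Z] u v w by simp
qed

end

section \<open>Vector fields along curves\<close>

lemma linear_on_sum:
  assumes L: "linear_on S L" "subspace S" and e: "\<And>i. i \<in> B \<Longrightarrow> e i \<in> S"
  shows "L (\<Sum>i\<in>B. a i *\<^sub>R e i) = (\<Sum>i\<in>B. a i *\<^sub>R L (e i))"
  using e
proof (induction B rule: infinite_finite_induct)
  case (insert x F)
  have "(\<Sum>i\<in>F. a i *\<^sub>R e i) \<in> S"
    by (intro subspace_sum[OF L(2)] subspace_scale[OF L(2)]) (use insert.prems in auto)
  then have "L (a x *\<^sub>R e x + 1 *\<^sub>R (\<Sum>i\<in>F. a i *\<^sub>R e i))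
      = a x *\<^sub>R L (e x) + 1 *\<^sub>R L (\<Sum>i\<in>F. a i *\<^sub>R e i)"
    using L(1) insert.prems unfolding linear_on_def by blast
  then show ?case using insert by simp
next
  case empty
  have "L (0 *\<^sub>R 0 + 0 *\<^sub>R 0) = 0 *\<^sub>R L 0 + 0 *\<^sub>R L 0"
    using L subspace_0[OF L(2)] unfolding linear_on_def by blast
  then show ?case by simp
next
  case (infinite B)
  have "L (0 *\<^sub>R 0 + 0 *\<^sub>R 0) = 0 *\<^sub>R L 0 + 0 *\<^sub>R L 0"
    using L subspace_0[OF L(2)] unfolding linear_on_def by blast
  then show ?case using infinite by simp
qed

context smooth_manifold
begin

lemma smooth_curve_subset: "smooth_curve A I \<gamma> \<Longrightarrow> J \<subseteq> I \<Longrightarrow> smooth_curve A J \<gamma>"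
proof -
  assume \<gamma>: "smooth_curve A I \<gamma>" and J: "J \<subseteq> I"
  have "smooth_on (J \<inter> \<gamma> -` U) (\<phi> \<circ> \<gamma>)" if "(U, \<phi>) \<in> A" for U \<phi>
    by (rule smooth_on_subset[of "I \<inter> \<gamma> -` U"]) (use \<gamma> J that in \<open>auto simp: smooth_curve_def\<close>)
  moreover have "continuous_on J \<gamma>"
    by (rule continuous_on_subset[OF _ J]) (use \<gamma> in \<open>simp add: smooth_curve_def\<close>)
  ultimately show "smooth_curve A J \<gamma>" unfolding smooth_curve_def by auto
qed

lemma curve_preimage_domain:
  assumes "derivative_domain I" "continuous_on I \<gamma>" "open W"
  shows "derivative_domain (I \<inter> \<gamma> -` W)"
proof -
  obtain S where "open S" "S \<inter> I = \<gamma> -` W \<inter> I"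
    using assms(2,3) unfolding continuous_on_open_invariant by blast
  then have "I \<inter> \<gamma> -` W = I \<inter> S" by blast
  then show ?thesis using derivative_domain_Int_open[OF assms(1) \<open>open S\<close>] by simp
qed

lemma smooth_fun_along:
  assumes I: "derivative_domain I" and \<gamma>: "smooth_curve A I \<gamma>" and W: "open W" "smooth_fun A W f"
  shows "smooth_on (I \<inter> \<gamma> -` W) (\<lambda>s. f (\<gamma> s))"
proof (rule smooth_on_local)
  have cont: "continuous_on I \<gamma>" using \<gamma> by (simp add: smooth_curve_def)
  show "derivative_domain (I \<inter> \<gamma> -` W)" by (rule curve_preimage_domain[OF I cont W(1)])
  fix t assume t: "t \<in> I \<inter> \<gamma> -` W"
  obtain U \<phi> where c: "(U, \<phi>) \<in> A" "\<gamma> t \<in> U" using chart_exists by blast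
  obtain S where S: "open S" "t \<in> S" "I \<inter> S = I \<inter> \<gamma> -` U" "\<gamma> ` (I \<inter> S) \<subseteq> U"
    by (rule curve_locally_in_open[OF cont _ chart_open[OF c(1)] c(2)]) (use t in auto)
  have "smooth_on (I \<inter> \<gamma> -` U) (\<phi> \<circ> \<gamma>)" using \<gamma> c(1) by (auto simp: smooth_curve_def)
  then have "smooth_on (I \<inter> \<gamma> -` W \<inter> S) (\<phi> \<circ> \<gamma>)"
    by (rule smooth_on_subset) (use S in auto)
  then have "smooth_on (I \<inter> \<gamma> -` W \<inter> S) (\<lambda>s. (f \<circ> inv_into U \<phi>) ((\<phi> \<circ> \<gamma>) s))"
    by (rule smooth_on_compose[OF _ smooth_fun_smooth_on[OF W(2) c(1)]]) (use S in auto)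
  then have "smooth_on (I \<inter> \<gamma> -` W \<inter> S) (\<lambda>s. f (\<gamma> s))"
    by (rule smooth_on_cong[rotated]) (use S(4) chart_inv[OF c(1)] in auto)
  then show "\<exists>N. open N \<and> t \<in> N \<and> smooth_on (I \<inter> \<gamma> -` W \<inter> N) (\<lambda>s. f (\<gamma> s))"
    using S by blast
qed

lemma alongI:
  assumes "\<And>t. t \<in> I \<Longrightarrow> V t \<in> tangent_space A (\<gamma> t)"
    "\<And>W f. open W \<Longrightarrow> smooth_fun A W f \<Longrightarrow> smooth_on (I \<inter> \<gamma> -` W) (\<lambda>t. V t f)"
  shows "vector_field_along A I \<gamma> V"
  using assms unfolding vector_field_along_def by simp

lemma along_tangent: "vector_field_along A I \<gamma> V \<Longrightarrow> t \<in> I \<Longrightarrow> V t \<in> tangent_space A (\<gamma> t)"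
  and along_smooth: "vector_field_along A I \<gamma> V \<Longrightarrow> open W \<Longrightarrow> smooth_fun A W f \<Longrightarrow>
    smooth_on (I \<inter> \<gamma> -` W) (\<lambda>t. V t f)"
  unfolding vector_field_along_def by blast+

lemma along_cong:
  assumes V: "vector_field_along A I \<gamma> V" and eq: "\<And>t. t \<in> I \<Longrightarrow> V t = Z t"
  shows "vector_field_along A I \<gamma> Z"
proof (rule alongI)
  show "Z t \<in> tangent_space A (\<gamma> t)" if "t \<in> I" for t using along_tangent[OF V that] eq[OF that] by simp
  show "smooth_on (I \<inter> \<gamma> -` W) (\<lambda>t. Z t f)" if "open W" "smooth_fun A W f" for W f
    by (rule smooth_on_cong[OF _ along_smooth[OF V that]]) (use eq in auto)
qed

lemma along_add:
  assumes V: "vector_field_along A I \<gamma> V" and Z: "vector_field_along A I \<gamma> Z"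
  shows "vector_field_along A I \<gamma> (\<lambda>t. V t + Z t)"
proof (rule alongI)
  show "V t + Z t \<in> tangent_space A (\<gamma> t)" if "t \<in> I" for t
    by (intro subspace_add[OF subspace_tangent_space] along_tangent[OF V that] along_tangent[OF Z that])
  show "smooth_on (I \<inter> \<gamma> -` W) (\<lambda>t. (V t + Z t) f)" if "open W" "smooth_fun A W f" for W f
    using smooth_on_add[OF along_smooth[OF V that] along_smooth[OF Z that]] by simp
qed

lemma along_scale:
  assumes c: "smooth_on I c" and V: "vector_field_along A I \<gamma> V"
  shows "vector_field_along A I \<gamma> (\<lambda>t. c t *\<^sub>R V t)"
proof (rule alongI)
  show "c t *\<^sub>R V t \<in> tangent_space A (\<gamma> t)" if "t \<in> I" for t
    by (intro subspace_scale[OF subspace_tangent_space] along_tangent[OF V that])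
  show "smooth_on (I \<inter> \<gamma> -` W) (\<lambda>t. (c t *\<^sub>R V t) f)" if "open W" "smooth_fun A W f" for W f
  proof -
    have "smooth_on (I \<inter> \<gamma> -` W) c" by (rule smooth_on_subset[OF c]) blast
    then show ?thesis using smooth_on_mult[OF _ along_smooth[OF V that]] by (simp add: scaleR_fun_def)
  qed
qed

lemma along_zero: "vector_field_along A I \<gamma> (\<lambda>t. 0)"
  by (rule alongI) (simp_all add: subspace_0[OF subspace_tangent_space] smooth_on_const)

lemma along_sum:
  "(\<And>i. i \<in> B \<Longrightarrow> vector_field_along A I \<gamma> (V i)) \<Longrightarrow> vector_field_along A I \<gamma> (\<lambda>t. \<Sum>i\<in>B. V i t)"
proof (induction B rule: infinite_finite_induct)
  case (insert x F)
  then show ?case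
    unfolding sum.insert[OF insert.hyps]
    using along_add[of I \<gamma> "V x" "\<lambda>t. \<Sum>i\<in>F. V i t"] by blast
qed (simp_all add: along_zero)

lemma along_pullback:
  assumes I: "derivative_domain I" and \<gamma>: "smooth_curve A I \<gamma>"
    and X: "open W" "vector_field A W X" and W: "\<gamma> ` I \<subseteq> W"
  shows "vector_field_along A I \<gamma> (\<lambda>t. X (\<gamma> t))"
proof (rule alongI)
  show "X (\<gamma> t) \<in> tangent_space A (\<gamma> t)" if "t \<in> I" for t
    using vector_field_tangent[OF X(2)] W that by blast
  fix W' f assume f: "open W'" "smooth_fun A W' f"
  have o: "open (W \<inter> W')" using X f by blast
  have "smooth_on (I \<inter> \<gamma> -` (W \<inter> W')) (\<lambda>t. X (\<gamma> t) f)"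
    by (rule smooth_fun_along[OF I \<gamma> o vector_field_smooth[OF X(2) o _ smooth_fun_subset[OF f(2)]]]) auto
  then show "smooth_on (I \<inter> \<gamma> -` W') (\<lambda>t. X (\<gamma> t) f)"
    by (rule smooth_on_subset) (use W in auto)
qed

lemma along_velocity:
  assumes I: "derivative_domain I" and \<gamma>: "smooth_curve A I \<gamma>"
  shows "vector_field_along A I \<gamma> (velocity A I \<gamma>)"
proof (rule alongI)
  show "velocity A I \<gamma> t \<in> tangent_space A (\<gamma> t)" if "t \<in> I" for t
    by (rule velocity_tangent[OF I that \<gamma>])
  fix W f assume f: "open W" "smooth_fun A W f"
  have cont: "continuous_on I \<gamma>" using \<gamma> by (simp add: smooth_curve_def)
  let ?J = "I \<inter> \<gamma> -` W"
  obtain S where S: "open S" "S \<inter> I = \<gamma> -` W \<inter> I"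
    using cont f(1) unfolding continuous_on_open_invariant by blast
  have J: "?J = I \<inter> S" using S by blast
  have "smooth_on ?J (\<lambda>t. vector_derivative (\<lambda>s. f (\<gamma> s)) (at t within ?J))"
    by (rule smooth_on_vector_derivative[OF curve_preimage_domain[OF I cont f(1)] smooth_fun_along[OF I \<gamma> f]])
  then show "smooth_on ?J (\<lambda>t. velocity A I \<gamma> t f)"
  proof (rule smooth_on_cong[rotated])
    fix t assume t: "t \<in> ?J"
    then have at: "at t within ?J = at t within I" unfolding J by (intro at_within_Int_open_eq S) auto
    have "smooth_near A (\<gamma> t) f" by (rule smooth_nearI[OF f(1) _ f(2)]) (use t in auto)
    then show "vector_derivative (\<lambda>s. f (\<gamma> s)) (at t within ?J) = velocity A I \<gamma> t f"
      unfolding at by (simp add: velocity_def o_def)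
  qed
qed

text \<open>Needed because frames exist only in charts, while a curve may leave any chart.\<close>

lemma along_local:
  assumes I: "derivative_domain I" and \<gamma>: "continuous_on I \<gamma>"
    and loc: "\<And>t. t \<in> I \<Longrightarrow> \<exists>S. open S \<and> t \<in> S \<and> vector_field_along A (I \<inter> S) \<gamma> V"
  shows "vector_field_along A I \<gamma> V"
proof (rule alongI)
  show "V t \<in> tangent_space A (\<gamma> t)" if t: "t \<in> I" for t
  proof -
    obtain S where S: "t \<in> S" "vector_field_along A (I \<inter> S) \<gamma> V" using loc[OF t] by blast
    show ?thesis by (rule along_tangent[OF S(2)]) (use t S in blast)
  qed
  fix W f assume f: "open W" "smooth_fun A W f"
  show "smooth_on (I \<inter> \<gamma> -` W) (\<lambda>t. V t f)"
  proof (rule smooth_on_local[OF curve_preimage_domain[OF I \<gamma> f(1)]])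
    fix t assume "t \<in> I \<inter> \<gamma> -` W"
    then obtain S where S: "open S" "t \<in> S" "vector_field_along A (I \<inter> S) \<gamma> V" using loc by blast
    have "smooth_on (I \<inter> \<gamma> -` W \<inter> S) (\<lambda>t. V t f)"
      by (rule smooth_on_subset[OF along_smooth[OF S(3) f]]) blast
    then show "\<exists>N. open N \<and> t \<in> N \<and> smooth_on (I \<inter> \<gamma> -` W \<inter> N) (\<lambda>t. V t f)" using S by blast
  qed
qed

text \<open>The neighbourhood \<open>S\<close> serves all fields along the curve simultaneously.\<close>

lemma along_frame:
  assumes \<gamma>: "continuous_on I \<gamma>" and t: "t \<in> I" and c: "(U, \<phi>) \<in> A" "\<gamma> t \<in> U"
  obtains S where "open S" "t \<in> S" "\<gamma> ` (I \<inter> S) \<subseteq> U"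
    "\<And>Z j. vector_field_along A I \<gamma> Z \<Longrightarrow> smooth_on (I \<inter> S) (\<lambda>s. Z s (coord \<phi> j))"
    "\<And>Z s. vector_field_along A I \<gamma> Z \<Longrightarrow> s \<in> I \<inter> S \<Longrightarrow>
       Z s = (\<Sum>j\<in>UNIV. Z s (coord \<phi> j) *\<^sub>R frame U \<phi> j (\<gamma> s))"
proof -
  obtain S where S: "open S" "t \<in> S" "I \<inter> S = I \<inter> \<gamma> -` U" "\<gamma> ` (I \<inter> S) \<subseteq> U"
    by (rule curve_locally_in_open[OF \<gamma> t chart_open[OF c(1)] c(2)])
  show ?thesis
  proof (rule that[OF S(1,2,4)])
    show "smooth_on (I \<inter> S) (\<lambda>s. Z s (coord \<phi> j))" if "vector_field_along A I \<gamma> Z" for Z j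
      unfolding S(3) by (rule along_smooth[OF that chart_open[OF c(1)] smooth_fun_coordinate[OF c(1)]])
    show "Z s = (\<Sum>j\<in>UNIV. Z s (coord \<phi> j) *\<^sub>R frame U \<phi> j (\<gamma> s))"
      if "vector_field_along A I \<gamma> Z" "s \<in> I \<inter> S" for Z s
      by (rule tangent_expand[OF c(1) _ along_tangent[OF that(1)]]) (use that S in auto)
  qed
qed

end

section \<open>Linear connections\<close>

locale manifold_connection = smooth_manifold A
  for A :: "('a::topological_space, 'n::finite) chart set" +
  fixes D :: "'a connection"
  assumes connection: "linear_connection A D"
begin

lemmas connection_rules = connection[unfolded linear_connection_def]

lemma connection_field:
  "open W \<Longrightarrow> vector_field A W X \<Longrightarrow> vector_field A W Y \<Longrightarrow> vector_field A W (\<lambda>p. D p (X p) Y)"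
  by (rule connection_rules[THEN conjunct1, rule_format]) simp

lemma connection_linear: "field_near Y p \<Longrightarrow> linear_on (tangent_space A p) (\<lambda>v. D p v Y)"
proof -
  assume "field_near Y p"
  then obtain W where "open W" "p \<in> W" "vector_field A W Y" unfolding field_near_def by blast
  then show ?thesis by (intro connection_rules[THEN conjunct2, THEN conjunct1, rule_format, of W]) simp
qed

lemma connection_add:
  assumes "v \<in> tangent_space A p" "field_near Y p" "field_near Z p"
  shows "D p v (\<lambda>q. Y q + Z q) = D p v Y + D p v Z"
proof -
  obtain W where "open W" "p \<in> W" "vector_field A W Y" "vector_field A W Z"
    using field_near_common[OF assms(2,3)] .
  then show ?thesis using assms(1) by (intro connection_rules[THEN conjunct2, THEN conjunct2, THEN conjunct1, rule_format, of W]) simp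
qed

lemma connection_scale:
  assumes "v \<in> tangent_space A p" "smooth_near A p f" "field_near Y p"
  shows "D p v (\<lambda>q. f q *\<^sub>R Y q) = v f *\<^sub>R Y p + f p *\<^sub>R D p v Y"
proof -
  obtain W W' where W: "open W" "p \<in> W" "vector_field A W Y" "open W'" "p \<in> W'" "smooth_fun A W' f"
    using assms unfolding field_near_def smooth_near_def by blast
  have "open (W \<inter> W')" "p \<in> W \<inter> W'" "vector_field A (W \<inter> W') Y" "smooth_fun A (W \<inter> W') f"
    using W by (auto intro: vector_field_subset smooth_fun_subset)
  then show ?thesis using assms(1) by (intro connection_rules[THEN conjunct2, THEN conjunct2, THEN conjunct2, THEN conjunct1, rule_format, of "W \<inter> W'"]) simp
qed

lemma connection_cong:
  assumes "v \<in> tangent_space A p" "open W" "p \<in> W" "vector_field A W Y" "vector_field A W Z"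
    "\<And>q. q \<in> W \<Longrightarrow> Y q = Z q"
  shows "D p v Y = D p v Z"
  by (rule connection_rules[THEN conjunct2, THEN conjunct2, THEN conjunct2, THEN conjunct2, rule_format, of W]) (use assms in auto)

lemma field_near_connection:
  assumes "field_near X p" "field_near Y p"
  shows "field_near (\<lambda>q. D q (X q) Y) p"
  by (rule field_near_common[OF assms]) (rule field_nearI[OF _ _ connection_field])

lemma connection_tangent:
  assumes "v \<in> tangent_space A p" "field_near Y p"
  shows "D p v Y \<in> tangent_space A p"
proof -
  obtain X where X: "field_near X p" "X p = v" using field_extension_exists[OF assms(1)] .
  show ?thesis using field_near_tangent[OF field_near_connection[OF X(1) assms(2)]] X(2) by simp
qed

lemma connection_zero:
  assumes v: "v \<in> tangent_space A p"
  shows "D p v (\<lambda>q. 0) = 0"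
proof -
  have "field_near (\<lambda>q. 0) p" by (rule field_nearI[OF open_UNIV UNIV_I vector_field_zero])
  from connection_scale[OF v smooth_near_const[of p 0] this] show ?thesis
    using tangent_const[OF v] by simp
qed

lemma connection_sum:
  assumes v: "v \<in> tangent_space A p"
  shows "(\<And>i. i \<in> B \<Longrightarrow> smooth_near A p (f i) \<and> field_near (E i) p) \<Longrightarrow>
    D p v (\<lambda>q. \<Sum>i\<in>B. f i q *\<^sub>R E i q) = (\<Sum>i\<in>B. v (f i) *\<^sub>R E i p + f i p *\<^sub>R D p v (E i))"
proof (induction B rule: infinite_finite_induct)
  case (insert x F)
  have "D p v (\<lambda>q. \<Sum>i\<in>insert x F. f i q *\<^sub>R E i q)
      = D p v (\<lambda>q. f x q *\<^sub>R E x q + (\<Sum>i\<in>F. f i q *\<^sub>R E i q))"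
    unfolding sum.insert[OF insert.hyps] ..
  also have "\<dots> = D p v (\<lambda>q. f x q *\<^sub>R E x q) + D p v (\<lambda>q. \<Sum>i\<in>F. f i q *\<^sub>R E i q)"
    by (rule connection_add[OF v field_near_scale field_near_sum[OF field_near_scale]])
       (use insert.prems in auto)
  also have "\<dots> = (v (f x) *\<^sub>R E x p + f x p *\<^sub>R D p v (E x))
      + (\<Sum>i\<in>F. v (f i) *\<^sub>R E i p + f i p *\<^sub>R D p v (E i))"
    using insert.IH insert.prems connection_scale[OF v, of "f x" "E x"] by (simp only: insertI1 insertI2)
  finally show ?case unfolding sum.insert[OF insert.hyps] .
qed (simp_all only: sum.empty sum.infinite not_False_eq_True connection_zero[OF v])

end

section \<open>Covariant derivatives along curves\<close>

lemma scaleR_frame_expand: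
  fixes e d :: "'j \<Rightarrow> 'v::real_vector"
  shows "r *\<^sub>R (\<Sum>j\<in>K. a j *\<^sub>R e j) + c *\<^sub>R (\<Sum>j\<in>K. b j *\<^sub>R e j + a j *\<^sub>R d j)
     = (\<Sum>j\<in>K. (r * a j + c * b j) *\<^sub>R e j + (c * a j) *\<^sub>R d j)"
  unfolding scaleR_sum_right sum.distrib[symmetric]
  by (rule sum.cong[OF refl]) (simp add: algebra_simps)

lemma scaleR_frame_swap:
  fixes e d :: "'j \<Rightarrow> 'v::real_vector"
  shows "(\<Sum>j\<in>K. (\<Sum>i\<in>B. a i j) *\<^sub>R e j + (\<Sum>i\<in>B. b i j) *\<^sub>R d j)
     = (\<Sum>i\<in>B. \<Sum>j\<in>K. a i j *\<^sub>R e j + b i j *\<^sub>R d j)"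
  unfolding scaleR_sum_left sum.distrib[symmetric] by (rule sum.swap)

locale connection_curve = manifold_connection A D
  for A :: "('a::topological_space, 'n::finite) chart set" and D +
  fixes I :: "real set" and \<gamma> :: "real \<Rightarrow> 'a"
  assumes domain: "derivative_domain I" and curve: "smooth_curve A I \<gamma>"
begin

abbreviation vel :: "real \<Rightarrow> 'a tvec" where "vel \<equiv> velocity A I \<gamma>"
abbreviation along :: "(real \<Rightarrow> 'a tvec) \<Rightarrow> bool" where "along \<equiv> vector_field_along A I \<gamma>"
abbreviation dt :: "(real \<Rightarrow> real) \<Rightarrow> real \<Rightarrow> real" where
  "dt f t \<equiv> vector_derivative f (at t within I)"
abbreviation cov :: "(real \<Rightarrow> 'a tvec) \<Rightarrow> real \<Rightarrow> 'a tvec" where "cov \<equiv> cov_along A D I \<gamma>"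

lemma curve_continuous: "continuous_on I \<gamma>"
  using curve by (simp add: smooth_curve_def)

lemma vel_tangent: "t \<in> I \<Longrightarrow> vel t \<in> tangent_space A (\<gamma> t)"
  by (rule velocity_tangent[OF domain _ curve])

lemma smooth_on_nbhd_has_vector_derivative:
  assumes "open S" "t \<in> I \<inter> S" "smooth_on (I \<inter> S) f"
  shows "(f has_vector_derivative dt f t) (at t within I)"
  using smooth_on_has_vector_derivative[OF derivative_domain_Int_open[OF domain assms(1)] assms(3,2)]
    at_within_Int_open_eq[of S t I] assms by simp

lemma has_vector_derivative_nbhd_cong:
  assumes "open S" "t \<in> I \<inter> S" "\<And>s. s \<in> I \<inter> S \<Longrightarrow> f s = g s"
    and "(g has_vector_derivative d) (at t within I)"
  shows "(f has_vector_derivative d) (at t within I)"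
proof -
  have at: "at t within (I \<inter> S) = at t within I" by (rule at_within_Int_open_eq) (use assms in auto)
  have "(f has_vector_derivative d) (at t within (I \<inter> S))"
    by (rule has_vector_derivative_transform[OF assms(2) assms(3)]) (use assms(4) in \<open>simp_all add: at\<close>)
  then show ?thesis by (simp add: at)
qed

lemma vector_derivative_eq:
  "t \<in> I \<Longrightarrow> (f has_vector_derivative d) (at t within I) \<Longrightarrow> dt f t = d"
  by (rule vector_derivative_within[OF derivative_domain_at_not_bot[OF domain]])

text \<open>The Leibniz expression attached to a representation \<open>V = \<Sum>c\<^sub>i E\<^sub>i\<close> is rewritten, by expanding each \<open>E\<^sub>i\<close> in the
coordinate frame, as an expression in the components of \<open>V\<close> alone. Hence any two
representations give the same value.\<close>

lemma representation_value:
  assumes t: "t \<in> I" and W: "open W" "\<gamma> ` (I \<inter> S) \<subseteq> W" and S: "open S" "t \<in> S"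
    and E: "\<And>i. i \<in> B \<Longrightarrow> vector_field A W (E i)"
    and c: "\<And>i. i \<in> B \<Longrightarrow> smooth_on (I \<inter> S) (c i)"
    and rep: "\<And>s. s \<in> I \<inter> S \<Longrightarrow> V s = (\<Sum>i\<in>B. c i s *\<^sub>R E i (\<gamma> s))"
    and ch: "(U, \<phi>) \<in> A" "\<gamma> t \<in> U"
  shows "(\<Sum>i\<in>B. dt (c i) t *\<^sub>R E i (\<gamma> t) + c i t *\<^sub>R D (\<gamma> t) (vel t) (E i))
    = (\<Sum>j\<in>UNIV. dt (\<lambda>s. V s (coord \<phi> j)) t *\<^sub>R frame U \<phi> j (\<gamma> t)
        + V t (coord \<phi> j) *\<^sub>R D (\<gamma> t) (vel t) (frame U \<phi> j))"
proof -
  let ?e = "frame U \<phi>" and ?x = "coord \<phi>"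
  let ?p = "\<gamma> t" and ?v = "vel t"
  let ?vd = "\<lambda>f. dt f t"
  have tS: "t \<in> I \<inter> S" using t S by blast
  have p: "?p \<in> W" using W(2) tS by blast
  have v: "?v \<in> tangent_space A ?p" by (rule vel_tangent[OF t])
  have near: "field_near (E i) ?p" if "i \<in> B" for i by (rule field_nearI[OF W(1) p E[OF that]])
  have sx: "smooth_near A ?p (\<lambda>q. E i q (?x j))" if "i \<in> B" for i j
    by (rule field_near_apply[OF near[OF that] smooth_near_coordinate[OF ch]])
  have DE: "D ?p ?v (E i) = (\<Sum>j\<in>UNIV. ?v (\<lambda>q. E i q (?x j)) *\<^sub>R ?e j ?p + E i ?p (?x j) *\<^sub>R D ?p ?v (?e j))"
    if i: "i \<in> B" for i
  proof -
    obtain W' where W': "open W'" "?p \<in> W'" "W' \<subseteq> U" "vector_field A W' (E i)"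
      "\<And>q. q \<in> W' \<Longrightarrow> E i q = (\<Sum>j\<in>UNIV. E i q (?x j) *\<^sub>R ?e j q)"
      using field_near_expand[OF ch near[OF i]] by blast
    have "D ?p ?v (E i) = D ?p ?v (\<lambda>q. \<Sum>j\<in>UNIV. E i q (?x j) *\<^sub>R ?e j q)"
      by (rule connection_cong[OF v W'(1,2,4) vector_field_cong[OF W'(4,5)] W'(5)])
    also have "\<dots> = (\<Sum>j\<in>UNIV. ?v (\<lambda>q. E i q (?x j)) *\<^sub>R ?e j ?p + E i ?p (?x j) *\<^sub>R D ?p ?v (?e j))"
      by (rule connection_sum[OF v]) (simp add: sx[OF i] field_near_coord[OF ch])
    finally show ?thesis .
  qed
  have Ep: "E i ?p = (\<Sum>j\<in>UNIV. E i ?p (?x j) *\<^sub>R ?e j ?p)" if "i \<in> B" for i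
    by (rule tangent_expand[OF ch field_near_tangent[OF near[OF that]]])
  have Vx: "V s (?x j) = (\<Sum>i\<in>B. c i s * E i (\<gamma> s) (?x j))" if "s \<in> I \<inter> S" for s j
    using fun_cong[OF rep[OF that], of "?x j"] by (simp add: sum_fun_apply scaleR_fun_def)
  have dV: "?vd (\<lambda>s. V s (?x j)) = (\<Sum>i\<in>B. ?vd (c i) * E i ?p (?x j) + c i t * ?v (\<lambda>q. E i q (?x j)))" for j
  proof (rule vector_derivative_eq[OF t], rule has_vector_derivative_nbhd_cong[OF S(1) tS Vx])
    show "((\<lambda>s. \<Sum>i\<in>B. c i s * E i (\<gamma> s) (?x j)) has_vector_derivative
        (\<Sum>i\<in>B. ?vd (c i) * E i ?p (?x j) + c i t * ?v (\<lambda>q. E i q (?x j)))) (at t within I)"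
    proof (rule has_vector_derivative_sum)
      fix i assume i: "i \<in> B"
      show "((\<lambda>s. c i s * E i (\<gamma> s) (?x j)) has_vector_derivative
          ?vd (c i) * E i ?p (?x j) + c i t * ?v (\<lambda>q. E i q (?x j))) (at t within I)"
        using has_vector_derivative_mult[OF smooth_on_nbhd_has_vector_derivative[OF S(1) tS c[OF i]]
            velocity_has_derivative[OF domain t curve sx[OF i, of j]]]
        by (simp add: add.commute)
    qed
  qed
  have "(\<Sum>i\<in>B. ?vd (c i) *\<^sub>R E i ?p + c i t *\<^sub>R D ?p ?v (E i))
      = (\<Sum>i\<in>B. \<Sum>j\<in>UNIV. (?vd (c i) * E i ?p (?x j) + c i t * ?v (\<lambda>q. E i q (?x j))) *\<^sub>R ?e j ?p
          + (c i t * E i ?p (?x j)) *\<^sub>R D ?p ?v (?e j))"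
  proof (rule sum.cong[OF refl])
    fix i assume i: "i \<in> B"
    have "?vd (c i) *\<^sub>R E i ?p + c i t *\<^sub>R D ?p ?v (E i)
      = ?vd (c i) *\<^sub>R (\<Sum>j\<in>UNIV. E i ?p (?x j) *\<^sub>R ?e j ?p) + c i t *\<^sub>R
        (\<Sum>j\<in>UNIV. ?v (\<lambda>q. E i q (?x j)) *\<^sub>R ?e j ?p + E i ?p (?x j) *\<^sub>R D ?p ?v (?e j))"
      by (rule arg_cong2[of _ _ _ _ "\<lambda>x y. ?vd (c i) *\<^sub>R x + c i t *\<^sub>R y"], rule Ep[OF i], rule DE[OF i])
    then show "?vd (c i) *\<^sub>R E i ?p + c i t *\<^sub>R D ?p ?v (E i) =
        (\<Sum>j\<in>UNIV. (?vd (c i) * E i ?p (?x j) + c i t * ?v (\<lambda>q. E i q (?x j))) *\<^sub>R ?e j ?p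
          + (c i t * E i ?p (?x j)) *\<^sub>R D ?p ?v (?e j))"
      unfolding scaleR_frame_expand .
  qed
  also have "\<dots> = (\<Sum>j\<in>UNIV. ?vd (\<lambda>s. V s (?x j)) *\<^sub>R ?e j ?p + V t (?x j) *\<^sub>R D ?p ?v (?e j))"
    unfolding dV Vx[OF tS] by (rule scaleR_frame_swap[symmetric])
  finally show ?thesis .
qed

text \<open>Any finite index set is allowed; an enumeration turns it into the indices \<open>i < k\<close> of the
definition, and this is also the representation that shows uniqueness of the described vector.\<close>

lemma cov_eq:
  assumes t: "t \<in> I" and W: "open W" "\<gamma> ` (I \<inter> S) \<subseteq> W" and S: "open S" "t \<in> S"
    and B: "finite B"
    and E: "\<And>i. i \<in> B \<Longrightarrow> vector_field A W (E i)"
    and c: "\<And>i. i \<in> B \<Longrightarrow> smooth_on (I \<inter> S) (c i)"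
    and rep: "\<And>s. s \<in> I \<inter> S \<Longrightarrow> V s = (\<Sum>i\<in>B. c i s *\<^sub>R E i (\<gamma> s))"
  shows "cov V t = (\<Sum>i\<in>B. dt (c i) t *\<^sub>R E i (\<gamma> t)
      + c i t *\<^sub>R D (\<gamma> t) (vel t) (E i))" (is "_ = sum ?val B")
proof -
  obtain U \<phi> where ch: "(U, \<phi>) \<in> A" "\<gamma> t \<in> U" using chart_exists by blast
  obtain h where h: "bij_betw h {..<card B} B"
    using ex_bij_betw_nat_finite[OF B] by (auto simp: lessThan_atLeast0)
  show ?thesis
    unfolding cov_along_def
  proof (rule the_equality)
    show "\<forall>W S (k::nat) E c. open W \<and> open S \<and> t \<in> S \<and> \<gamma> ` (I \<inter> S) \<subseteq> W \<and>
        (\<forall>i<k. vector_field A W (E i) \<and> smooth_on (I \<inter> S) (c i)) \<and>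
        (\<forall>s\<in>I \<inter> S. V s = (\<Sum>i<k. c i s *\<^sub>R E i (\<gamma> s))) \<longrightarrow>
        sum ?val B = (\<Sum>i<k. dt (c i) t *\<^sub>R E i (\<gamma> t)
                    + c i t *\<^sub>R D (\<gamma> t) (vel t) (E i))"
    proof (intro allI impI, elim conjE)
      fix W' S' and k :: nat and E' c'
      assume r: "open W'" "open S'" "t \<in> S'" "\<gamma> ` (I \<inter> S') \<subseteq> W'"
        "\<forall>i<k. vector_field A W' (E' i) \<and> smooth_on (I \<inter> S') (c' i)"
        "\<forall>s\<in>I \<inter> S'. V s = (\<Sum>i<k. c' i s *\<^sub>R E' i (\<gamma> s))"
      show "sum ?val B = (\<Sum>i<k. dt (c' i) t *\<^sub>R E' i (\<gamma> t)
                    + c' i t *\<^sub>R D (\<gamma> t) (vel t) (E' i))"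
        by (rule trans[OF representation_value[OF t W S E c rep ch]
              representation_value[OF t r(1,4,2,3) _ _ _ ch, symmetric]])
           (use r(5,6) in blast)+
    qed
    fix w
    assume w: "\<forall>W S (k::nat) E c. open W \<and> open S \<and> t \<in> S \<and> \<gamma> ` (I \<inter> S) \<subseteq> W \<and>
        (\<forall>i<k. vector_field A W (E i) \<and> smooth_on (I \<inter> S) (c i)) \<and>
        (\<forall>s\<in>I \<inter> S. V s = (\<Sum>i<k. c i s *\<^sub>R E i (\<gamma> s))) \<longrightarrow>
        w = (\<Sum>i<k. dt (c i) t *\<^sub>R E i (\<gamma> t)
                    + c i t *\<^sub>R D (\<gamma> t) (vel t) (E i))"
    have hB: "h i \<in> B" if "i < card B" for i using h that by (auto simp: bij_betw_def)
    have "open W \<and> open S \<and> t \<in> S \<and> \<gamma> ` (I \<inter> S) \<subseteq> W \<and>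
        (\<forall>i<card B. vector_field A W (E (h i)) \<and> smooth_on (I \<inter> S) (c (h i))) \<and>
        (\<forall>s\<in>I \<inter> S. V s = (\<Sum>i<card B. c (h i) s *\<^sub>R E (h i) (\<gamma> s)))"
    proof (intro conjI allI impI ballI)
      show "V s = (\<Sum>i<card B. c (h i) s *\<^sub>R E (h i) (\<gamma> s))" if "s \<in> I \<inter> S" for s
        unfolding rep[OF that] by (rule sum.reindex_bij_betw[OF h, symmetric])
    qed (use W S E c hB in auto)
    from mp[OF w[THEN spec[of _ W], THEN spec[of _ S], THEN spec[of _ "card B"],
          THEN spec[of _ "\<lambda>i. E (h i)"], THEN spec[of _ "\<lambda>i. c (h i)"]] this]
    have "w = (\<Sum>i<card B. ?val (h i))" .
    then show "w = sum ?val B" unfolding sum.reindex_bij_betw[OF h, of ?val] .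
  qed
qed

lemma cov_frame:
  assumes V: "along V" and t: "t \<in> I" and ch: "(U, \<phi>) \<in> A" "\<gamma> t \<in> U"
  shows "cov V t = (\<Sum>j\<in>UNIV. dt (\<lambda>s. V s (coord \<phi> j)) t
        *\<^sub>R frame U \<phi> j (\<gamma> t)
        + V t (coord \<phi> j) *\<^sub>R D (\<gamma> t) (vel t) (frame U \<phi> j))"
proof -
  obtain S where S: "open S" "t \<in> S" "\<gamma> ` (I \<inter> S) \<subseteq> U"
    "\<And>Z j. along Z \<Longrightarrow> smooth_on (I \<inter> S) (\<lambda>s. Z s (coord \<phi> j))"
    "\<And>Z s. along Z \<Longrightarrow> s \<in> I \<inter> S \<Longrightarrow> Z s = (\<Sum>j\<in>UNIV. Z s (coord \<phi> j) *\<^sub>R frame U \<phi> j (\<gamma> s))"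
    using along_frame[OF curve_continuous t ch] by blast
  show ?thesis
    by (rule cov_eq[OF t chart_open[OF ch(1)] S(3,1,2) finite coord_vec_field[OF ch(1)]
          S(4)[OF V] S(5)[OF V]])
qed

lemma cov_cong:
  assumes "\<And>s. s \<in> I \<Longrightarrow> V s = Z s"
  shows "cov V t = cov Z t"
proof -
  have "(\<forall>s\<in>I \<inter> S. V s = R s) = (\<forall>s\<in>I \<inter> S. Z s = R s)" for S R using assms by auto
  then show ?thesis unfolding cov_along_def by (simp only:)
qed

lemma component_derivative:
  assumes V: "along V" and t: "t \<in> I" and ch: "(U, \<phi>) \<in> A" "\<gamma> t \<in> U"
  shows "((\<lambda>s. V s (coord \<phi> j)) has_vector_derivative
     dt (\<lambda>s. V s (coord \<phi> j)) t) (at t within I)"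
proof -
  obtain S where S: "open S" "t \<in> S" "\<gamma> ` (I \<inter> S) \<subseteq> U"
    "\<And>Z j. along Z \<Longrightarrow> smooth_on (I \<inter> S) (\<lambda>s. Z s (coord \<phi> j))"
    "\<And>Z s. along Z \<Longrightarrow> s \<in> I \<inter> S \<Longrightarrow> Z s = (\<Sum>j\<in>UNIV. Z s (coord \<phi> j) *\<^sub>R frame U \<phi> j (\<gamma> s))"
    using along_frame[OF curve_continuous t ch] by blast
  show ?thesis by (rule smooth_on_nbhd_has_vector_derivative[OF S(1) _ S(4)[OF V]]) (use S(2) t in blast)
qed

lemma cov_add:
  assumes V: "along V" and Z: "along Z" and t: "t \<in> I"
  shows "cov (\<lambda>s. V s + Z s) t = cov V t + cov Z t"
proof -
  obtain U \<phi> where ch: "(U, \<phi>) \<in> A" "\<gamma> t \<in> U" using chart_exists by blast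
  have a: "(V s + Z s) f = V s f + Z s f" for s f by simp
  have d: "dt (\<lambda>s. V s (coord \<phi> j) + Z s (coord \<phi> j)) t
    = dt (\<lambda>s. V s (coord \<phi> j)) t
    + dt (\<lambda>s. Z s (coord \<phi> j)) t" for j
    using has_vector_derivative_add[OF component_derivative[OF V t ch, of j] component_derivative[OF Z t ch, of j]]
    by (intro vector_derivative_eq[OF t]) simp
  show ?thesis
    unfolding cov_frame[OF V t ch] cov_frame[OF Z t ch] cov_frame[OF along_add[OF V Z] t ch] a d
      sum.distrib[symmetric]
    by (rule sum.cong[OF refl]) (simp only: scaleR_add_left add.assoc add.left_commute)
qed

lemma cov_scale:
  assumes c: "smooth_on I c" and V: "along V" and t: "t \<in> I"
  shows "cov (\<lambda>s. c s *\<^sub>R V s) t = dt c t *\<^sub>R V t + c t *\<^sub>R cov V t"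
proof -
  obtain U \<phi> where ch: "(U, \<phi>) \<in> A" "\<gamma> t \<in> U" using chart_exists by blast
  let ?vd = "\<lambda>f. dt f t" and ?x = "coord \<phi>"
  have a: "(c s *\<^sub>R V s) f = c s * V s f" for s f by (simp add: scaleR_fun_def)
  have d: "?vd (\<lambda>s. c s * V s (?x j)) = ?vd c * V t (?x j) + c t * ?vd (\<lambda>s. V s (?x j))" for j
    using has_vector_derivative_mult[OF smooth_on_has_vector_derivative[OF domain c t]
        component_derivative[OF V t ch, of j]]
    by (intro vector_derivative_eq[OF t]) (simp add: add.commute)
  have Vt: "V t = (\<Sum>j\<in>UNIV. V t (?x j) *\<^sub>R frame U \<phi> j (\<gamma> t))"
    by (rule tangent_expand[OF ch along_tangent[OF V t]])
  have "?vd c *\<^sub>R V t + c t *\<^sub>R cov V t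
      = ?vd c *\<^sub>R (\<Sum>j\<in>UNIV. V t (?x j) *\<^sub>R frame U \<phi> j (\<gamma> t)) + c t *\<^sub>R cov V t"
    by (rule arg_cong[of _ _ "\<lambda>x. ?vd c *\<^sub>R x + c t *\<^sub>R cov V t"], rule Vt)
  also have "\<dots> = cov (\<lambda>s. c s *\<^sub>R V s) t"
    unfolding cov_frame[OF V t ch] cov_frame[OF along_scale[OF c V] t ch] a d scaleR_frame_expand ..
  finally show ?thesis ..
qed

lemma cov_pullback:
  assumes X: "vector_field A UNIV X" and t: "t \<in> I"
  shows "cov (\<lambda>s. X (\<gamma> s)) t = D (\<gamma> t) (vel t) X"
proof -
  have "cov (\<lambda>s. X (\<gamma> s)) t = (\<Sum>i\<in>{()}. dt (\<lambda>s. 1) t *\<^sub>R X (\<gamma> t)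
      + 1 *\<^sub>R D (\<gamma> t) (vel t) X)"
    by (rule cov_eq[OF t open_UNIV _ open_UNIV]) (use X in \<open>auto simp: smooth_on_const\<close>)
  moreover have "dt (\<lambda>s. 1::real) t = 0"
    by (rule vector_derivative_eq[OF t has_vector_derivative_const])
  ultimately show ?thesis by simp
qed

text \<open>Makes the second covariant derivative available. Near \<open>t\<close> the formula of \<open>cov_frame\<close> is a combination
of pulled-back fields with smooth coefficients once \<open>D\<^bsub>\<gamma>'\<^esub> e\<^sub>j\<close> is expanded as \<open>\<Sum>(\<gamma>')\<^sup>l D\<^bsub>e\<^sub>l\<^esub> e\<^sub>j\<close>.\<close>

lemma cov_along_curve:
  assumes V: "along V"
  shows "along (cov V)"
proof (rule along_local[OF domain curve_continuous])
  fix t assume t: "t \<in> I"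
  obtain U \<phi> where ch: "(U, \<phi>) \<in> A" "\<gamma> t \<in> U" using chart_exists by blast
  let ?e = "frame U \<phi>" and ?x = "coord \<phi>"
  obtain S where S: "open S" "t \<in> S" "\<gamma> ` (I \<inter> S) \<subseteq> U"
    "\<And>Z j. along Z \<Longrightarrow> smooth_on (I \<inter> S) (\<lambda>s. Z s (coord \<phi> j))"
    "\<And>Z s. along Z \<Longrightarrow> s \<in> I \<inter> S \<Longrightarrow> Z s = (\<Sum>j\<in>UNIV. Z s (coord \<phi> j) *\<^sub>R frame U \<phi> j (\<gamma> s))"
    using along_frame[OF curve_continuous t ch] by blast
  note vS = S(4)[OF along_velocity[OF domain curve]] S(5)[OF along_velocity[OF domain curve]]
  have dS: "derivative_domain (I \<inter> S)" by (rule derivative_domain_Int_open[OF domain S(1)])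
  note pull = along_pullback[OF dS smooth_curve_subset[OF curve Int_lower1] chart_open[OF ch(1)] _ S(3)]
  have "vector_field_along A (I \<inter> S) \<gamma> (\<lambda>s. \<Sum>j\<in>UNIV. vector_derivative (\<lambda>s. V s (?x j)) (at s within (I \<inter> S))
        *\<^sub>R ?e j (\<gamma> s) + V s (?x j) *\<^sub>R (\<Sum>l\<in>UNIV. vel s (?x l) *\<^sub>R D (\<gamma> s) (?e l (\<gamma> s)) (?e j)))"
    by (intro along_sum along_add along_scale smooth_on_vector_derivative[OF dS] S(4)[OF V] vS(1)
        pull coord_vec_field[OF ch(1)] pull[OF connection_field] chart_open[OF ch(1)])
  then have "vector_field_along A (I \<inter> S) \<gamma> (cov V)"
  proof (rule along_cong)
    fix s assume s: "s \<in> I \<inter> S"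
    then have sI: "s \<in> I" and sU: "\<gamma> s \<in> U" using S(3) by auto
    have at: "at s within (I \<inter> S) = at s within I"
      by (rule at_within_Int_open_eq[OF S(1)]) (use s in blast)
    have Dv: "D (\<gamma> s) (vel s) (?e j) = (\<Sum>l\<in>UNIV. vel s (?x l) *\<^sub>R D (\<gamma> s) (?e l (\<gamma> s)) (?e j))" for j
    proof -
      have "D (\<gamma> s) (vel s) (?e j) = D (\<gamma> s) (\<Sum>l\<in>UNIV. vel s (?x l) *\<^sub>R ?e l (\<gamma> s)) (?e j)"
        by (rule arg_cong[of _ _ "\<lambda>v. D (\<gamma> s) v (?e j)"], rule vS(2)[OF s])
      also have "\<dots> = (\<Sum>l\<in>UNIV. vel s (?x l) *\<^sub>R D (\<gamma> s) (?e l (\<gamma> s)) (?e j))"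
        by (rule linear_on_sum[OF connection_linear[OF field_near_coord[OF ch(1) sU]] subspace_tangent_space
              coord_vec_tangent[OF ch(1) sU]])
      finally show ?thesis .
    qed
    show "(\<Sum>j\<in>UNIV. vector_derivative (\<lambda>s. V s (?x j)) (at s within (I \<inter> S))
        *\<^sub>R ?e j (\<gamma> s) + V s (?x j) *\<^sub>R (\<Sum>l\<in>UNIV. vel s (?x l) *\<^sub>R D (\<gamma> s) (?e l (\<gamma> s)) (?e j))) = cov V s"
      unfolding at cov_frame[OF V sI ch(1) sU] Dv ..
  qed
  then show "\<exists>S. open S \<and> t \<in> S \<and> vector_field_along A (I \<inter> S) \<gamma> (cov V)" using S by blast
qed

section \<open>Parallel bilinear forms\<close>

lemma bilinear_frame_expand:
  assumes l: "\<And>v. v \<in> T \<Longrightarrow> linear_on T (\<lambda>u. b u v)" and r: "\<And>u. u \<in> T \<Longrightarrow> linear_on T (b u)"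
    and T: "subspace T" and e: "\<And>j. j \<in> K \<Longrightarrow> e j \<in> T" "\<And>k. k \<in> L \<Longrightarrow> f k \<in> T"
  shows "b (\<Sum>j\<in>K. x j *\<^sub>R e j) (\<Sum>k\<in>L. y k *\<^sub>R f k) = (\<Sum>j\<in>K. \<Sum>k\<in>L. x j * y k * (b (e j) (f k) :: real))"
proof -
  have yT: "(\<Sum>k\<in>L. y k *\<^sub>R f k) \<in> T"
    by (intro subspace_sum[OF T] subspace_scale[OF T] e(2))
  have "b (\<Sum>j\<in>K. x j *\<^sub>R e j) (\<Sum>k\<in>L. y k *\<^sub>R f k) = (\<Sum>j\<in>K. x j *\<^sub>R b (e j) (\<Sum>k\<in>L. y k *\<^sub>R f k))"
    by (rule linear_on_sum[OF l[OF yT] T e(1)])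
  also have "\<dots> = (\<Sum>j\<in>K. x j *\<^sub>R (\<Sum>k\<in>L. y k *\<^sub>R b (e j) (f k)))"
    by (intro sum.cong refl arg_cong[of _ _ "\<lambda>z. _ *\<^sub>R z"] linear_on_sum[OF r[OF e(1)] T e(2)])
  finally show ?thesis by (simp add: sum_distrib_left mult.assoc)
qed

lemma bilinear_form_along_expand:
  fixes b :: "'a \<Rightarrow> 'a tvec \<Rightarrow> 'a tvec \<Rightarrow> real"
  assumes l: "\<And>p v. v \<in> tangent_space A p \<Longrightarrow> linear_on (tangent_space A p) (\<lambda>u. b p u v)"
    and r: "\<And>p u. u \<in> tangent_space A p \<Longrightarrow> linear_on (tangent_space A p) (b p u)"
    and V: "along V" and Z: "along Z" and s: "s \<in> I" and ch: "(U, \<phi>) \<in> A" "\<gamma> s \<in> U"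
  shows "b (\<gamma> s) (V s) (Z s) = (\<Sum>j\<in>UNIV. \<Sum>k\<in>UNIV. V s (coord \<phi> j) * Z s (coord \<phi> k) *
        b (\<gamma> s) (frame U \<phi> j (\<gamma> s)) (frame U \<phi> k (\<gamma> s)))"
proof -
  have "b (\<gamma> s) (V s) (Z s) = b (\<gamma> s) (\<Sum>j\<in>UNIV. V s (coord \<phi> j) *\<^sub>R frame U \<phi> j (\<gamma> s))
      (\<Sum>j\<in>UNIV. Z s (coord \<phi> j) *\<^sub>R frame U \<phi> j (\<gamma> s))"
    by (rule arg_cong2[of _ _ _ _ "b (\<gamma> s)"])
       (rule tangent_expand[OF ch along_tangent[OF V s]], rule tangent_expand[OF ch along_tangent[OF Z s]])
  also have "\<dots> = (\<Sum>j\<in>UNIV. \<Sum>k\<in>UNIV. V s (coord \<phi> j) * Z s (coord \<phi> k) *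
        b (\<gamma> s) (frame U \<phi> j (\<gamma> s)) (frame U \<phi> k (\<gamma> s)))"
    by (rule bilinear_frame_expand[OF l r subspace_tangent_space coord_vec_tangent[OF ch] coord_vec_tangent[OF ch]])
  finally show ?thesis .
qed

lemma bilinear_form_along_smooth:
  fixes b :: "'a \<Rightarrow> 'a tvec \<Rightarrow> 'a tvec \<Rightarrow> real"
  assumes l: "\<And>p v. v \<in> tangent_space A p \<Longrightarrow> linear_on (tangent_space A p) (\<lambda>u. b p u v)"
    and r: "\<And>p u. u \<in> tangent_space A p \<Longrightarrow> linear_on (tangent_space A p) (b p u)"
    and sm: "\<And>W X Y. open W \<Longrightarrow> vector_field A W X \<Longrightarrow> vector_field A W Y \<Longrightarrow>
       smooth_fun A W (\<lambda>q. b q (X q) (Y q))"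
    and V: "along V" and Z: "along Z"
  shows "smooth_on I (\<lambda>s. b (\<gamma> s) (V s) (Z s))"
proof (rule smooth_on_local[OF domain])
  fix t assume t: "t \<in> I"
  obtain U \<phi> where ch: "(U, \<phi>) \<in> A" "\<gamma> t \<in> U" using chart_exists by blast
  obtain S where S: "open S" "t \<in> S" "\<gamma> ` (I \<inter> S) \<subseteq> U"
    "\<And>Z j. along Z \<Longrightarrow> smooth_on (I \<inter> S) (\<lambda>s. Z s (coord \<phi> j))"
    "\<And>Z s. along Z \<Longrightarrow> s \<in> I \<inter> S \<Longrightarrow> Z s = (\<Sum>j\<in>UNIV. Z s (coord \<phi> j) *\<^sub>R frame U \<phi> j (\<gamma> s))"
    using along_frame[OF curve_continuous t ch] by blast
  have "smooth_on (I \<inter> S) (\<lambda>s. b (\<gamma> s) (frame U \<phi> j (\<gamma> s)) (frame U \<phi> k (\<gamma> s)))" for j k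
    by (rule smooth_on_subset[OF smooth_fun_along[OF domain curve chart_open[OF ch(1)]
          sm[OF chart_open[OF ch(1)] coord_vec_field[OF ch(1)] coord_vec_field[OF ch(1)]]]]) (use S(3) in auto)
  then have "smooth_on (I \<inter> S) (\<lambda>s. \<Sum>j\<in>UNIV. \<Sum>k\<in>UNIV. V s (coord \<phi> j) * Z s (coord \<phi> k) *
      b (\<gamma> s) (frame U \<phi> j (\<gamma> s)) (frame U \<phi> k (\<gamma> s)))"
    by (intro smooth_on_sum smooth_on_mult S(4)[OF V] S(4)[OF Z])
  then have "smooth_on (I \<inter> S) (\<lambda>s. b (\<gamma> s) (V s) (Z s))"
    by (rule smooth_on_cong[rotated], intro bilinear_form_along_expand[OF l r V Z _ ch(1), symmetric])
       (use S(3) in auto)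
  then show "\<exists>N. open N \<and> t \<in> N \<and> smooth_on (I \<inter> N) (\<lambda>s. b (\<gamma> s) (V s) (Z s))" using S by blast
qed

text \<open>The product rule for a parallel form. Both sides are compared after expanding \<open>V\<close> and \<open>Z\<close> in a
coordinate frame, where \<open>par\<close> gives the derivative of the coefficients \<open>b(e\<^sub>j, e\<^sub>k)\<close>.\<close>

lemma parallel_form_derivative:
  fixes b :: "'a \<Rightarrow> 'a tvec \<Rightarrow> 'a tvec \<Rightarrow> real"
  assumes l: "\<And>p v. v \<in> tangent_space A p \<Longrightarrow> linear_on (tangent_space A p) (\<lambda>u. b p u v)"
    and r: "\<And>p u. u \<in> tangent_space A p \<Longrightarrow> linear_on (tangent_space A p) (b p u)"
    and sm: "\<And>W X Y. open W \<Longrightarrow> vector_field A W X \<Longrightarrow> vector_field A W Y \<Longrightarrow>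
       smooth_fun A W (\<lambda>q. b q (X q) (Y q))"
    and par: "\<And>p v X Y. v \<in> tangent_space A p \<Longrightarrow> field_near X p \<Longrightarrow> field_near Y p \<Longrightarrow>
       v (\<lambda>q. b q (X q) (Y q)) = b p (D p v X) (Y p) + b p (X p) (D p v Y)"
    and V: "along V" and Z: "along Z" and t: "t \<in> I"
  shows "((\<lambda>s. b (\<gamma> s) (V s) (Z s)) has_vector_derivative
      b (\<gamma> t) (cov V t) (Z t) + b (\<gamma> t) (V t) (cov Z t)) (at t within I)"
proof -
  obtain U \<phi> where ch: "(U, \<phi>) \<in> A" "\<gamma> t \<in> U" using chart_exists by blast
  obtain S where S: "open S" "t \<in> S" "\<gamma> ` (I \<inter> S) \<subseteq> U"
    "\<And>Z j. along Z \<Longrightarrow> smooth_on (I \<inter> S) (\<lambda>s. Z s (coord \<phi> j))"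
    "\<And>Z s. along Z \<Longrightarrow> s \<in> I \<inter> S \<Longrightarrow> Z s = (\<Sum>j\<in>UNIV. Z s (coord \<phi> j) *\<^sub>R frame U \<phi> j (\<gamma> s))"
    using along_frame[OF curve_continuous t ch] by blast
  let ?e = "frame U \<phi>" and ?x = "coord \<phi>"
  let ?p = "\<gamma> t" and ?v = "vel t"
  let ?vd = "\<lambda>f. dt f t"
  have tS: "t \<in> I \<inter> S" using t S by blast
  have v: "?v \<in> tangent_space A ?p" by (rule vel_tangent[OF t])
  let ?dV = "\<lambda>j. ?vd (\<lambda>s. V s (?x j))" and ?dZ = "\<lambda>j. ?vd (\<lambda>s. Z s (?x j))"
  let ?De = "\<lambda>j. D ?p ?v (?e j)"
  let ?g = "\<lambda>j k. b ?p (?e j ?p) (?e k ?p)"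
  have dg: "((\<lambda>s. b (\<gamma> s) (?e j (\<gamma> s)) (?e k (\<gamma> s))) has_vector_derivative
     b ?p (?De j) (?e k ?p) + b ?p (?e j ?p) (?De k)) (at t within I)" for j k
  proof -
    have "smooth_near A ?p (\<lambda>q. b q (?e j q) (?e k q))"
      by (rule smooth_nearI[OF chart_open[OF ch(1)] ch(2)
            sm[OF chart_open[OF ch(1)] coord_vec_field[OF ch(1)] coord_vec_field[OF ch(1)]]])
    from velocity_has_derivative[OF domain t curve this] show ?thesis
      unfolding par[OF v field_near_coord[OF ch] field_near_coord[OF ch]] .
  qed
  have "((\<lambda>s. \<Sum>j\<in>UNIV. \<Sum>k\<in>UNIV. V s (?x j) * Z s (?x k) * b (\<gamma> s) (?e j (\<gamma> s)) (?e k (\<gamma> s)))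
     has_vector_derivative (\<Sum>j\<in>UNIV. \<Sum>k\<in>UNIV.
        V t (?x j) * Z t (?x k) * (b ?p (?De j) (?e k ?p) + b ?p (?e j ?p) (?De k))
        + (V t (?x j) * ?dZ k + ?dV j * Z t (?x k)) * ?g j k)) (at t within I)"
    by (intro has_vector_derivative_sum has_vector_derivative_mult dg
        smooth_on_nbhd_has_vector_derivative[OF S(1) tS] S(4)[OF V] S(4)[OF Z])
  then have D1: "((\<lambda>s. b (\<gamma> s) (V s) (Z s)) has_vector_derivative (\<Sum>j\<in>UNIV. \<Sum>k\<in>UNIV.
        V t (?x j) * Z t (?x k) * (b ?p (?De j) (?e k ?p) + b ?p (?e j ?p) (?De k))
        + (V t (?x j) * ?dZ k + ?dV j * Z t (?x k)) * ?g j k)) (at t within I)"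
    by (rule has_vector_derivative_nbhd_cong[OF S(1) tS, rotated],
        intro bilinear_form_along_expand[OF l r V Z _ ch(1)]) (use S(3) in auto)
  note T = subspace_tangent_space[of ?p]
  have bil: "b ?p (\<Sum>j\<in>UNIV. x j *\<^sub>R e j) (\<Sum>k\<in>UNIV. y k *\<^sub>R f k)
      = (\<Sum>j\<in>UNIV. \<Sum>k\<in>UNIV. x j * y k * b ?p (e j) (f k))"
    if "\<And>j::'n. e j \<in> tangent_space A ?p" "\<And>k::'n. f k \<in> tangent_space A ?p" for x y e f
    by (rule bilinear_frame_expand[OF l r T that])
  note eT = coord_vec_tangent[OF ch]
  have DeT: "?De j \<in> tangent_space A ?p" for j by (rule connection_tangent[OF v field_near_coord[OF ch]])
  have dT: "(\<Sum>j\<in>UNIV. f j *\<^sub>R ?e j ?p) \<in> tangent_space A ?p" for f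
    by (intro subspace_sum[OF T] subspace_scale[OF T] eT)
  have dT': "(\<Sum>j\<in>UNIV. f j *\<^sub>R ?De j) \<in> tangent_space A ?p" for f
    by (intro subspace_sum[OF T] subspace_scale[OF T] DeT)
  have Vt: "V t = (\<Sum>j\<in>UNIV. V t (?x j) *\<^sub>R ?e j ?p)" by (rule tangent_expand[OF ch along_tangent[OF V t]])
  have Zt: "Z t = (\<Sum>j\<in>UNIV. Z t (?x j) *\<^sub>R ?e j ?p)" by (rule tangent_expand[OF ch along_tangent[OF Z t]])
  have add_l: "b ?p (x + y) z = b ?p x z + b ?p y z"
    if "x \<in> tangent_space A ?p" "y \<in> tangent_space A ?p" "z \<in> tangent_space A ?p" for x y z
    using l[OF that(3), unfolded linear_on_def, rule_format, OF that(1,2), of 1 1] by simp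
  have add_r: "b ?p z (x + y) = b ?p z x + b ?p z y"
    if "x \<in> tangent_space A ?p" "y \<in> tangent_space A ?p" "z \<in> tangent_space A ?p" for x y z
    using r[OF that(3), unfolded linear_on_def, rule_format, OF that(1,2), of 1 1] by simp
  have cV: "b ?p (cov V t) (Z t) = (\<Sum>j\<in>UNIV. \<Sum>k\<in>UNIV. ?dV j * Z t (?x k) * ?g j k)
      + (\<Sum>j\<in>UNIV. \<Sum>k\<in>UNIV. V t (?x j) * Z t (?x k) * b ?p (?De j) (?e k ?p))"
  proof -
    have "b ?p (cov V t) (Z t) = b ?p (cov V t) (\<Sum>j\<in>UNIV. Z t (?x j) *\<^sub>R ?e j ?p)"
      by (rule arg_cong[of _ _ "b ?p (cov V t)"], rule Zt)
    also have "\<dots> = b ?p (\<Sum>j\<in>UNIV. ?dV j *\<^sub>R ?e j ?p) (\<Sum>j\<in>UNIV. Z t (?x j) *\<^sub>R ?e j ?p)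
        + b ?p (\<Sum>j\<in>UNIV. V t (?x j) *\<^sub>R ?De j) (\<Sum>j\<in>UNIV. Z t (?x j) *\<^sub>R ?e j ?p)"
      unfolding cov_frame[OF V t ch] sum.distrib by (rule add_l[OF dT dT' dT])
    finally show ?thesis unfolding bil[OF eT eT] bil[OF DeT eT] .
  qed
  have cZ: "b ?p (V t) (cov Z t) = (\<Sum>j\<in>UNIV. \<Sum>k\<in>UNIV. V t (?x j) * ?dZ k * ?g j k)
      + (\<Sum>j\<in>UNIV. \<Sum>k\<in>UNIV. V t (?x j) * Z t (?x k) * b ?p (?e j ?p) (?De k))"
  proof -
    have "b ?p (V t) (cov Z t) = b ?p (\<Sum>j\<in>UNIV. V t (?x j) *\<^sub>R ?e j ?p) (cov Z t)"
      by (rule arg_cong[of _ _ "\<lambda>x. b ?p x (cov Z t)"], rule Vt)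
    also have "\<dots> = b ?p (\<Sum>j\<in>UNIV. V t (?x j) *\<^sub>R ?e j ?p) (\<Sum>j\<in>UNIV. ?dZ j *\<^sub>R ?e j ?p)
        + b ?p (\<Sum>j\<in>UNIV. V t (?x j) *\<^sub>R ?e j ?p) (\<Sum>j\<in>UNIV. Z t (?x j) *\<^sub>R ?De j)"
      unfolding cov_frame[OF Z t ch] sum.distrib by (rule add_r[OF dT dT' dT])
    finally show ?thesis unfolding bil[OF eT eT] bil[OF eT DeT] .
  qed
  have "(\<Sum>j\<in>UNIV. \<Sum>k\<in>UNIV.
        V t (?x j) * Z t (?x k) * (b ?p (?De j) (?e k ?p) + b ?p (?e j ?p) (?De k))
        + (V t (?x j) * ?dZ k + ?dV j * Z t (?x k)) * ?g j k)
      = b ?p (cov V t) (Z t) + b ?p (V t) (cov Z t)"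
    unfolding cV cZ sum.distrib[symmetric] by (intro sum.cong refl) (simp add: algebra_simps)
  with D1 show "((\<lambda>s. b (\<gamma> s) (V s) (Z s)) has_vector_derivative
          b ?p (cov V t) (Z t) + b ?p (V t) (cov Z t)) (at t within I)" by simp
qed

end

lemma minus_diff_swap: "z = - w \<Longrightarrow> x - y - z = - (y - x - w)"
  for x y z w :: "'v::ab_group_add"
  by simp

context smooth_manifold
begin

section \<open>Alternating tensors\<close>

lemma tangent_not_smooth:
  assumes "v \<in> tangent_space A p" "\<not> smooth_near A p f"
  shows "v f = 0"
proof -
  obtain U \<phi> where c: "(U, \<phi>) \<in> A" "p \<in> U" using chart_exists by blast
  obtain w where w: "v = coord_vec U \<phi> w p" using assms(1) unfolding tangent_space_eq[OF c] by blast
  show ?thesis using assms(2) by (simp add: w coord_vec_def)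
qed

lemma bracket_antisym: "lie_bracket A X Y p = - lie_bracket A Y X p"
  by (simp add: lie_bracket_def fun_eq_iff)

lemma bracket_add_left:
  assumes X: "field_near X p" and X': "field_near X' p" and Y: "field_near Y p"
  shows "lie_bracket A (\<lambda>q. X q + X' q) Y p = lie_bracket A X Y p + lie_bracket A X' Y p"
proof
  fix f
  have "Y p (\<lambda>q. X q f + X' q f) = Y p (\<lambda>q. X q f) + Y p (\<lambda>q. X' q f)" if "smooth_near A p f"
    by (rule tangent_add[OF field_near_tangent[OF Y] field_near_apply[OF X that] field_near_apply[OF X' that]])
  then show "lie_bracket A (\<lambda>q. X q + X' q) Y p f = (lie_bracket A X Y p + lie_bracket A X' Y p) f"
    by (simp add: lie_bracket_def)
qed

lemma bracket_scale_left:
  assumes h: "smooth_near A p h" and X: "field_near X p" and Y: "field_near Y p"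
  shows "lie_bracket A (\<lambda>q. h q *\<^sub>R X q) Y p = h p *\<^sub>R lie_bracket A X Y p - Y p h *\<^sub>R X p"
proof
  fix f
  show "lie_bracket A (\<lambda>q. h q *\<^sub>R X q) Y p f = (h p *\<^sub>R lie_bracket A X Y p - Y p h *\<^sub>R X p) f"
  proof (cases "smooth_near A p f")
    case True
    have "Y p (\<lambda>q. h q * X q f) = Y p h * X p f + h p * Y p (\<lambda>q. X q f)"
      by (rule tangent_mult[OF field_near_tangent[OF Y] h field_near_apply[OF X True]])
    then show ?thesis using True by (simp add: lie_bracket_def scaleR_fun_def algebra_simps)
  next
    case False
    then show ?thesis
      using tangent_not_smooth[OF field_near_tangent[OF X] False] by (simp add: lie_bracket_def scaleR_fun_def)
  qed
qed

lemma bracket_cong_left: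
  assumes W: "open W" "p \<in> W" and eq: "\<And>q. q \<in> W \<Longrightarrow> X q = X' q" and Y: "field_near Y p"
  shows "lie_bracket A X Y p = lie_bracket A X' Y p"
proof -
  have "Y p (\<lambda>q. X q f) = Y p (\<lambda>q. X' q f)" for f
    by (rule tangent_cong[OF field_near_tangent[OF Y] W]) (simp add: eq)
  then show ?thesis unfolding lie_bracket_def eq[OF W(2)] by (simp only:)
qed

text \<open>Linearity over functions is required in the first argument only; antisymmetry transports it to the
second one. The operators behind \<open>d\<theta>\<close> and the torsion are both of this kind.\<close>

definition alternating_tensorial ::
    "('a vfield \<Rightarrow> 'a vfield \<Rightarrow> 'a \<Rightarrow> 'b::real_vector) \<Rightarrow> 'a \<Rightarrow> bool" where
  "alternating_tensorial B p \<longleftrightarrow>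
     (\<forall>X Y. field_near X p \<longrightarrow> field_near Y p \<longrightarrow> B X Y p = - B Y X p) \<and>
     (\<forall>X X' Y. field_near X p \<longrightarrow> field_near X' p \<longrightarrow> field_near Y p \<longrightarrow>
        B (\<lambda>q. X q + X' q) Y p = B X Y p + B X' Y p) \<and>
     (\<forall>f X Y. smooth_near A p f \<longrightarrow> field_near X p \<longrightarrow> field_near Y p \<longrightarrow>
        B (\<lambda>q. f q *\<^sub>R X q) Y p = f p *\<^sub>R B X Y p) \<and>
     (\<forall>W X X' Y. open W \<longrightarrow> p \<in> W \<longrightarrow> vector_field A W X \<longrightarrow> vector_field A W X' \<longrightarrow>
        (\<forall>q\<in>W. X q = X' q) \<longrightarrow> field_near Y p \<longrightarrow> B X Y p = B X' Y p)"

lemmas alternating_anti = alternating_tensorial_def[THEN iffD1, THEN conjunct1, rule_format]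
lemmas alternating_add =
  alternating_tensorial_def[THEN iffD1, THEN conjunct2, THEN conjunct1, rule_format]
lemmas alternating_scale =
  alternating_tensorial_def[THEN iffD1, THEN conjunct2, THEN conjunct2, THEN conjunct1, rule_format]
lemmas alternating_cong =
  alternating_tensorial_def[THEN iffD1, THEN conjunct2, THEN conjunct2, THEN conjunct2, rule_format]

lemma alternating_tensorial_tensor2:
  assumes B: "alternating_tensorial B p"
    and X: "field_near X p" and Y: "field_near Y p" and u: "X p = u" and v: "Y p = v"
  shows "tensor2 A B p u v = B X Y p"
proof (rule tensor2_eq[OF _ X Y u v])
  have one: "B X Y p = B X' Y p"
    if "field_near X p" "field_near X' p" "field_near Y p" "X p = X' p" for X X' Y
    by (rule pointwise_determined[where L = "\<lambda>X. B X Y p", OF alternating_add[OF B _ _ that(3)]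
          alternating_scale[OF B _ _ that(3)] alternating_cong[OF B _ _ _ _ _ that(3)] that(1,2,4)])
  fix X X' Y Y' assume n: "field_near X p" "field_near X' p" "field_near Y p" "field_near Y' p"
    and e: "X p = X' p" "Y p = Y' p"
  have "B X Y p = B X' Y p" by (rule one[OF n(1-3) e(1)])
  also have "\<dots> = - B Y X' p" by (rule alternating_anti[OF B n(2,3)])
  also have "\<dots> = - B Y' X' p" using one[OF n(3,4,2) e(2)] by simp
  also have "\<dots> = B X' Y' p" by (rule alternating_anti[OF B n(2,4), symmetric])
  finally show "B X Y p = B X' Y' p" .
qed

lemma alternating_tensorial_antisym:
  assumes B: "alternating_tensorial B p" and u: "u \<in> tangent_space A p" and v: "v \<in> tangent_space A p"
  shows "tensor2 A B p u v = - tensor2 A B p v u"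
proof -
  obtain X where X: "field_near X p" "X p = u" using field_extension_exists[OF u] .
  obtain Y where Y: "field_near Y p" "Y p = v" using field_extension_exists[OF v] .
  from alternating_anti[OF B X(1) Y(1)] show ?thesis
    unfolding alternating_tensorial_tensor2[OF B X(1) Y(1) X(2) Y(2)]
      alternating_tensorial_tensor2[OF B Y(1) X(1) Y(2) X(2)] .
qed

lemma alternating_tensorial_linear:
  assumes B: "alternating_tensorial B p" and v: "v \<in> tangent_space A p"
  shows "linear_on (tangent_space A p) (\<lambda>u. tensor2 A B p u v)"
  unfolding linear_on_def
proof (intro ballI allI)
  fix u w and a b :: real
  assume uw: "u \<in> tangent_space A p" "w \<in> tangent_space A p"
  obtain X where X: "field_near X p" "X p = u" using field_extension_exists[OF uw(1)] .
  obtain X' where X': "field_near X' p" "X' p = w" using field_extension_exists[OF uw(2)] .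
  obtain Y where Y: "field_near Y p" "Y p = v" using field_extension_exists[OF v] .
  note T = alternating_tensorial_tensor2[OF B _ Y(1) _ Y(2)]
  note n = field_near_scale[OF smooth_near_const X(1), of a] field_near_scale[OF smooth_near_const X'(1), of b]
  have "tensor2 A B p (a *\<^sub>R u + b *\<^sub>R w) v = B (\<lambda>q. a *\<^sub>R X q + b *\<^sub>R X' q) Y p"
    by (rule T[OF field_near_add[OF n]]) (simp add: X X')
  also have "\<dots> = B (\<lambda>q. a *\<^sub>R X q) Y p + B (\<lambda>q. b *\<^sub>R X' q) Y p"
    by (rule alternating_add[OF B n Y(1)])
  also have "B (\<lambda>q. a *\<^sub>R X q) Y p = a *\<^sub>R B X Y p"
    by (rule alternating_scale[OF B smooth_near_const X(1) Y(1)])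
  also have "B (\<lambda>q. b *\<^sub>R X' q) Y p = b *\<^sub>R B X' Y p"
    by (rule alternating_scale[OF B smooth_near_const X'(1) Y(1)])
  finally show "tensor2 A B p (a *\<^sub>R u + b *\<^sub>R w) v = a *\<^sub>R tensor2 A B p u v + b *\<^sub>R tensor2 A B p w v"
    unfolding T[OF X] T[OF X'] .
qed

lemma alternating_tensorial_linear_right:
  assumes B: "alternating_tensorial B p" and u: "u \<in> tangent_space A p"
  shows "linear_on (tangent_space A p) (tensor2 A B p u)"
  unfolding linear_on_def
proof (intro ballI allI)
  fix v w and a b :: real
  assume vw: "v \<in> tangent_space A p" "w \<in> tangent_space A p"
  have "a *\<^sub>R v + b *\<^sub>R w \<in> tangent_space A p"
    using vw by (intro subspace_add[OF subspace_tangent_space] subspace_scale[OF subspace_tangent_space])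
  from alternating_tensorial_antisym[OF B u this]
  have "tensor2 A B p u (a *\<^sub>R v + b *\<^sub>R w) = - (a *\<^sub>R tensor2 A B p v u + b *\<^sub>R tensor2 A B p w u)"
    using alternating_tensorial_linear[OF B u, unfolded linear_on_def, rule_format, OF vw, of a b] by simp
  then show "tensor2 A B p u (a *\<^sub>R v + b *\<^sub>R w) = a *\<^sub>R tensor2 A B p u v + b *\<^sub>R tensor2 A B p u w"
    unfolding alternating_tensorial_antisym[OF B u vw(1)] alternating_tensorial_antisym[OF B u vw(2)] by simp
qed

text \<open>When \<open>X\<close> is multiplied by \<open>f\<close>, the term \<open>Y(f) \<theta>(X)\<close> from the Leibniz rule cancels the one from the
bracket \<open>[f X, Y] = f [X, Y] - Y(f) X\<close>.\<close>

lemma ext_deriv_alternating: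
  assumes \<theta>: "one_form A \<theta>"
  shows "alternating_tensorial (\<lambda>X Y p. (X p (\<lambda>q. \<theta> q (Y q)) - Y p (\<lambda>q. \<theta> q (X q))
        - \<theta> p (lie_bracket A X Y p)) / 2) p"
proof -
  have lin: "linear_on (tangent_space A p) (\<theta> p)" for p
    by (rule \<theta>[unfolded one_form_def, THEN conjunct1, rule_format])
  have lin': "\<theta> q (a *\<^sub>R u + b *\<^sub>R v) = a * \<theta> q u + b * \<theta> q v"
    if "u \<in> tangent_space A q" "v \<in> tangent_space A q" for a b u v q
    using lin[of q] that unfolding linear_on_def by simp
  have add: "\<theta> q (u + v) = \<theta> q u + \<theta> q v" if "u \<in> tangent_space A q" "v \<in> tangent_space A q" for u v q
    using lin'[OF that, of 1 1] by simp
  have sc: "\<theta> q (a *\<^sub>R u) = a * \<theta> q u" if "u \<in> tangent_space A q" for a u q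
    using lin'[OF that that, of a 0] by simp
  have neg: "\<theta> q (- u) = - \<theta> q u" if "u \<in> tangent_space A q" for u q
    using sc[OF that, of "-1"] by simp
  have sm: "smooth_near A p (\<lambda>q. \<theta> q (X q))" if X: "field_near X p" for X p
  proof -
    obtain W where W: "open W" "p \<in> W" "vector_field A W X" using X unfolding field_near_def by blast
    have "smooth_fun A W (\<lambda>q. \<theta> q (X q))"
      by (rule \<theta>[unfolded one_form_def, THEN conjunct2, THEN spec, THEN spec, THEN mp])
         (intro conjI W(1,3))
    then show ?thesis by (rule smooth_nearI[OF W(1,2)])
  qed
  show ?thesis
    unfolding alternating_tensorial_def
  proof (intro conjI allI impI)
    fix X Y assume X: "field_near X p" and Y: "field_near Y p"
    have n: "\<theta> p (lie_bracket A X Y p) = - \<theta> p (lie_bracket A Y X p)"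
      unfolding bracket_antisym[of X Y] by (rule neg[OF lie_bracket_tangent[OF Y X]])
    show "(X p (\<lambda>q. \<theta> q (Y q)) - Y p (\<lambda>q. \<theta> q (X q)) - \<theta> p (lie_bracket A X Y p)) / 2 =
      - ((Y p (\<lambda>q. \<theta> q (X q)) - X p (\<lambda>q. \<theta> q (Y q)) - \<theta> p (lie_bracket A Y X p)) / 2)"
      unfolding n by (simp add: field_simps)
  next
    fix X X' Y assume X: "field_near X p" and X': "field_near X' p" and Y: "field_near Y p"
    obtain W where W: "open W" "p \<in> W" "vector_field A W X" "vector_field A W X'"
      using field_near_common[OF X X'] .
    have "Y p (\<lambda>q. \<theta> q (X q + X' q)) = Y p (\<lambda>q. \<theta> q (X q) + \<theta> q (X' q))"
      by (rule tangent_cong[OF field_near_tangent[OF Y] W(1,2)])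
         (rule add[OF vector_field_tangent[OF W(3)] vector_field_tangent[OF W(4)]])
    also have "\<dots> = Y p (\<lambda>q. \<theta> q (X q)) + Y p (\<lambda>q. \<theta> q (X' q))"
      by (rule tangent_add[OF field_near_tangent[OF Y] sm[OF X] sm[OF X']])
    finally show "((X p + X' p) (\<lambda>q. \<theta> q (Y q)) - Y p (\<lambda>q. \<theta> q (X q + X' q))
        - \<theta> p (lie_bracket A (\<lambda>q. X q + X' q) Y p)) / 2
      = (X p (\<lambda>q. \<theta> q (Y q)) - Y p (\<lambda>q. \<theta> q (X q)) - \<theta> p (lie_bracket A X Y p)) / 2
      + (X' p (\<lambda>q. \<theta> q (Y q)) - Y p (\<lambda>q. \<theta> q (X' q)) - \<theta> p (lie_bracket A X' Y p)) / 2"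
      unfolding bracket_add_left[OF X X' Y] add[OF lie_bracket_tangent[OF X Y] lie_bracket_tangent[OF X' Y]]
      by (simp add: field_simps)
  next
    fix f X Y assume f: "smooth_near A p f" and X: "field_near X p" and Y: "field_near Y p"
    obtain W where W: "open W" "p \<in> W" "vector_field A W X" using X unfolding field_near_def by blast
    have "Y p (\<lambda>q. \<theta> q (f q *\<^sub>R X q)) = Y p (\<lambda>q. f q * \<theta> q (X q))"
      by (rule tangent_cong[OF field_near_tangent[OF Y] W(1,2)])
         (rule sc[OF vector_field_tangent[OF W(3)]])
    also have "\<dots> = Y p f * \<theta> p (X p) + f p * Y p (\<lambda>q. \<theta> q (X q))"
      by (rule tangent_mult[OF field_near_tangent[OF Y] f sm[OF X]])
    finally have 1: "Y p (\<lambda>q. \<theta> q (f q *\<^sub>R X q)) = Y p f * \<theta> p (X p) + f p * Y p (\<lambda>q. \<theta> q (X q))" .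
    have 2: "\<theta> p (f p *\<^sub>R lie_bracket A X Y p - Y p f *\<^sub>R X p) = f p * \<theta> p (lie_bracket A X Y p) - Y p f * \<theta> p (X p)"
      using lin'[OF lie_bracket_tangent[OF X Y] field_near_tangent[OF X], of "f p" "- Y p f"] by simp
    show "((f p *\<^sub>R X p) (\<lambda>q. \<theta> q (Y q)) - Y p (\<lambda>q. \<theta> q (f q *\<^sub>R X q))
        - \<theta> p (lie_bracket A (\<lambda>q. f q *\<^sub>R X q) Y p)) / 2
      = f p *\<^sub>R ((X p (\<lambda>q. \<theta> q (Y q)) - Y p (\<lambda>q. \<theta> q (X q)) - \<theta> p (lie_bracket A X Y p)) / 2)"
      unfolding bracket_scale_left[OF f X Y] 1 2 by (simp add: field_simps scaleR_fun_def)
  next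
    fix W and X X' Y :: "'a vfield"
    assume W: "open W" "p \<in> W" and eq: "\<forall>q\<in>W. X q = X' q" and Y: "field_near Y p"
    have "Y p (\<lambda>q. \<theta> q (X q)) = Y p (\<lambda>q. \<theta> q (X' q))"
      by (rule tangent_cong[OF field_near_tangent[OF Y] W]) (simp add: eq)
    moreover have "X p = X' p" using eq W by blast
    moreover have "lie_bracket A X Y p = lie_bracket A X' Y p"
      by (rule bracket_cong_left[OF W _ Y]) (use eq in blast)
    ultimately show "(X p (\<lambda>q. \<theta> q (Y q)) - Y p (\<lambda>q. \<theta> q (X q)) - \<theta> p (lie_bracket A X Y p)) / 2
      = (X' p (\<lambda>q. \<theta> q (Y q)) - Y p (\<lambda>q. \<theta> q (X' q)) - \<theta> p (lie_bracket A X' Y p)) / 2" by simp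
  qed
qed

end

section \<open>Torsion and curvature\<close>

context manifold_connection
begin

lemma connection_linear_apply:
  assumes "field_near Y p" "u \<in> tangent_space A p" "v \<in> tangent_space A p"
  shows "D p (a *\<^sub>R u + b *\<^sub>R v) Y = a *\<^sub>R D p u Y + b *\<^sub>R D p v Y"
  by (rule connection_linear[OF assms(1), unfolded linear_on_def, rule_format, OF assms(2,3)])

text \<open>The term \<open>Y(f) X\<close> from the Leibniz rule of the connection cancels the one from the bracket.\<close>

lemma torsion_alternating:
  "alternating_tensorial (\<lambda>X Y p. D p (X p) Y - D p (Y p) X - lie_bracket A X Y p) p"
  unfolding alternating_tensorial_def
proof (intro conjI allI impI)
  fix X Y assume X: "field_near X p" and Y: "field_near Y p"
  show "D p (X p) Y - D p (Y p) X - lie_bracket A X Y p = - (D p (Y p) X - D p (X p) Y - lie_bracket A Y X p)"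
    unfolding bracket_antisym[of X Y] by (simp add: algebra_simps)
next
  fix X X' Y assume X: "field_near X p" and X': "field_near X' p" and Y: "field_near Y p"
  note t = field_near_tangent[OF X] field_near_tangent[OF X'] field_near_tangent[OF Y]
  have 1: "D p (X p + X' p) Y = D p (X p) Y + D p (X' p) Y"
    using connection_linear_apply[OF Y t(1,2), of 1 1] by (simp only: scaleR_one)
  show "D p (X p + X' p) Y - D p (Y p) (\<lambda>q. X q + X' q) - lie_bracket A (\<lambda>q. X q + X' q) Y p
     = (D p (X p) Y - D p (Y p) X - lie_bracket A X Y p) + (D p (X' p) Y - D p (Y p) X' - lie_bracket A X' Y p)"
    unfolding 1 connection_add[OF t(3) X X'] bracket_add_left[OF X X' Y] by (simp only: algebra_simps)
next
  fix f X Y assume f: "smooth_near A p f" and X: "field_near X p" and Y: "field_near Y p"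
  note t = field_near_tangent[OF X] field_near_tangent[OF Y]
  have 1: "D p (f p *\<^sub>R X p) Y = f p *\<^sub>R D p (X p) Y"
    using connection_linear_apply[OF Y t(1,1), of "f p" 0] by (simp only: scaleR_zero_left add_0_right)
  show "D p (f p *\<^sub>R X p) Y - D p (Y p) (\<lambda>q. f q *\<^sub>R X q) - lie_bracket A (\<lambda>q. f q *\<^sub>R X q) Y p
     = f p *\<^sub>R (D p (X p) Y - D p (Y p) X - lie_bracket A X Y p)"
    unfolding 1 connection_scale[OF t(2) f X] bracket_scale_left[OF f X Y] by (simp only: algebra_simps)
next
  fix W X X' Y assume W: "open W" "p \<in> W" and v: "vector_field A W X" "vector_field A W X'"
    and eq: "\<forall>q\<in>W. X q = X' q" and Y: "field_near Y p"
  have "D p (Y p) X = D p (Y p) X'"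
    by (rule connection_cong[OF field_near_tangent[OF Y] W v]) (use eq in blast)
  moreover have "X p = X' p" using eq W by blast
  moreover have "lie_bracket A X Y p = lie_bracket A X' Y p"
    by (rule bracket_cong_left[OF W _ Y]) (use eq in blast)
  ultimately show "D p (X p) Y - D p (Y p) X - lie_bracket A X Y p = D p (X' p) Y - D p (Y p) X' - lie_bracket A X' Y p"
    by simp
qed

definition curvature_operator :: "'a vfield \<Rightarrow> 'a vfield \<Rightarrow> 'a vfield \<Rightarrow> 'a \<Rightarrow> 'a tvec" where
  "curvature_operator X Y Z p = D p (X p) (\<lambda>q. D q (Y q) Z) - D p (Y p) (\<lambda>q. D q (X q) Z)
        - D p (lie_bracket A X Y p) Z"

lemma second_derivative_cong:
  assumes v: "v \<in> tangent_space A p" and W: "open W" "p \<in> W" and X: "vector_field A W X" "vector_field A W Z"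
    and Y: "vector_field A W Y" and eq: "\<And>q. q \<in> W \<Longrightarrow> D q (X q) Z = Y q"
  shows "D p v (\<lambda>q. D q (X q) Z) = D p v Y"
  by (rule connection_cong[OF v W connection_field[OF W(1) X] Y eq])

lemma curvature_operator_antisym:
  assumes "field_near X p" "field_near Y p" "field_near Z p"
  shows "curvature_operator X Y Z p = - curvature_operator Y X Z p"
proof -
  have "D p (lie_bracket A X Y p) Z = - D p (lie_bracket A Y X p) Z"
    using connection_linear_apply[OF assms(3) lie_bracket_tangent[OF assms(2,1)] lie_bracket_tangent[OF assms(2,1)], of "-1" 0]
    unfolding bracket_antisym[of X Y] by (simp only: scaleR_minus1_left scaleR_zero_left add_0_right)
  then show ?thesis unfolding curvature_operator_def by (rule minus_diff_swap)
qed

lemma field_near_common3: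
  assumes "field_near X p" "field_near Y p" "field_near Z p"
  obtains W where "open W" "p \<in> W" "vector_field A W X" "vector_field A W Y" "vector_field A W Z"
proof -
  obtain W where W: "open W" "p \<in> W" "vector_field A W X" "vector_field A W Y"
    using field_near_common[OF assms(1,2)] .
  obtain W' where W': "open W'" "p \<in> W'" "vector_field A W' Z"
    using assms(3) unfolding field_near_def by blast
  show ?thesis using that[of "W \<inter> W'"] W W' by (auto intro: vector_field_subset)
qed

lemma curvature_operator_add:
  assumes X: "field_near X p" and X': "field_near X' p" and Y: "field_near Y p" and Z: "field_near Z p"
  shows "curvature_operator (\<lambda>q. X q + X' q) Y Z p = curvature_operator X Y Z p + curvature_operator X' Y Z p"
proof -
  note tY = field_near_tangent[OF Y]
  note t = field_near_tangent[OF X] field_near_tangent[OF X']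
  note YZ = field_near_connection[OF Y Z]
  obtain W where W: "open W" "p \<in> W" "vector_field A W X" "vector_field A W X'" "vector_field A W Z"
    using field_near_common3[OF X X' Z] .
  have 1: "D p (X p + X' p) E = D p (X p) E + D p (X' p) E" if "field_near E p" for E
    using connection_linear_apply[OF that t, of 1 1] by (simp only: scaleR_one)
  have 2: "D p (lie_bracket A X Y p + lie_bracket A X' Y p) Z = D p (lie_bracket A X Y p) Z + D p (lie_bracket A X' Y p) Z"
    using connection_linear_apply[OF Z lie_bracket_tangent[OF X Y] lie_bracket_tangent[OF X' Y], of 1 1]
    by (simp only: scaleR_one)
  have "D p (Y p) (\<lambda>q. D q (X q + X' q) Z) = D p (Y p) (\<lambda>q. D q (X q) Z + D q (X' q) Z)"
  proof (rule second_derivative_cong[OF tY W(1,2) vector_field_add[OF W(3,4)] W(5)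
        vector_field_add[OF connection_field[OF W(1,3,5)] connection_field[OF W(1,4,5)]]])
    fix q assume q: "q \<in> W"
    show "D q (X q + X' q) Z = D q (X q) Z + D q (X' q) Z"
      using connection_linear_apply[OF field_nearI[OF W(1) q W(5)] vector_field_tangent[OF W(3) q]
          vector_field_tangent[OF W(4) q], of 1 1] by (simp only: scaleR_one)
  qed
  also have "\<dots> = D p (Y p) (\<lambda>q. D q (X q) Z) + D p (Y p) (\<lambda>q. D q (X' q) Z)"
    by (rule connection_add[OF tY field_near_connection[OF X Z] field_near_connection[OF X' Z]])
  finally show ?thesis
    unfolding curvature_operator_def bracket_add_left[OF X X' Y] 1[OF YZ] 2 by (simp only: algebra_simps)
qed

lemma curvature_operator_scale:
  assumes f: "smooth_near A p f" and X: "field_near X p" and Y: "field_near Y p" and Z: "field_near Z p"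
  shows "curvature_operator (\<lambda>q. f q *\<^sub>R X q) Y Z p = f p *\<^sub>R curvature_operator X Y Z p"
proof -
  note tY = field_near_tangent[OF Y]
  note t = field_near_tangent[OF X]
  note YZ = field_near_connection[OF Y Z]
  obtain W' where W': "open W'" "p \<in> W'" "smooth_fun A W' f" using f unfolding smooth_near_def by blast
  obtain W where W: "open W" "p \<in> W" "vector_field A W X" "vector_field A W Z"
    using field_near_common[OF X Z] .
  let ?W = "W \<inter> W'"
  have W: "open ?W" "p \<in> ?W" "vector_field A ?W X" "vector_field A ?W Z" "smooth_fun A ?W f"
    using W W' by (auto intro: vector_field_subset smooth_fun_subset)
  have 1: "D p (f p *\<^sub>R X p) E = f p *\<^sub>R D p (X p) E" if "field_near E p" for E
    using connection_linear_apply[OF that t t, of "f p" 0] by (simp only: scaleR_zero_left add_0_right)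
  have 2: "D p (f p *\<^sub>R lie_bracket A X Y p - Y p f *\<^sub>R X p) Z = f p *\<^sub>R D p (lie_bracket A X Y p) Z - Y p f *\<^sub>R D p (X p) Z"
    using connection_linear_apply[OF Z lie_bracket_tangent[OF X Y] t, of "f p" "- Y p f"]
    by (simp only: scaleR_minus_left add_uminus_conv_diff)
  have "D p (Y p) (\<lambda>q. D q (f q *\<^sub>R X q) Z) = D p (Y p) (\<lambda>q. f q *\<^sub>R D q (X q) Z)"
  proof (rule second_derivative_cong[OF tY W(1,2) vector_field_scale[OF W(5,3)] W(4)
        vector_field_scale[OF W(5) connection_field[OF W(1,3,4)]]])
    fix q assume q: "q \<in> ?W"
    show "D q (f q *\<^sub>R X q) Z = f q *\<^sub>R D q (X q) Z"
      using connection_linear_apply[OF field_nearI[OF W(1) q W(4)] vector_field_tangent[OF W(3) q]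
          vector_field_tangent[OF W(3) q], of "f q" 0] by (simp only: scaleR_zero_left add_0_right)
  qed
  also have "\<dots> = Y p f *\<^sub>R D p (X p) Z + f p *\<^sub>R D p (Y p) (\<lambda>q. D q (X q) Z)"
    by (rule connection_scale[OF tY f field_near_connection[OF X Z]])
  finally show ?thesis
    unfolding curvature_operator_def bracket_scale_left[OF f X Y] 1[OF YZ] 2 by (simp only: algebra_simps)
qed

lemma curvature_operator_slot1:
  assumes X: "field_near X p" and X': "field_near X' p" and XX: "X p = X' p"
    and Y: "field_near Y p" and Z: "field_near Z p"
  shows "curvature_operator X Y Z p = curvature_operator X' Y Z p"
proof (rule pointwise_determined[where L = "\<lambda>X. curvature_operator X Y Z p",
      OF curvature_operator_add[OF _ _ Y Z] curvature_operator_scale[OF _ _ Y Z] _ X X' XX])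
  fix X X' W assume W: "open W" "p \<in> W" and v: "vector_field A W X" "vector_field A W X'"
    and eq: "\<And>q. q \<in> W \<Longrightarrow> X q = X' q"
  obtain W' where W': "open W'" "p \<in> W'" "vector_field A W' Z" using Z unfolding field_near_def by blast
  have V: "open (W \<inter> W')" "p \<in> W \<inter> W'" "vector_field A (W \<inter> W') X" "vector_field A (W \<inter> W') X'" "vector_field A (W \<inter> W') Z"
    using W v W' by (auto intro: vector_field_subset)
  have "D p (Y p) (\<lambda>q. D q (X q) Z) = D p (Y p) (\<lambda>q. D q (X' q) Z)"
    by (rule connection_cong[OF field_near_tangent[OF Y] V(1,2) connection_field[OF V(1,3,5)] connection_field[OF V(1,4,5)]])
       (simp add: eq)
  moreover have "lie_bracket A X Y p = lie_bracket A X' Y p"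
    by (rule bracket_cong_left[OF W _ Y]) (rule eq)
  ultimately show "curvature_operator X Y Z p = curvature_operator X' Y Z p"
    unfolding curvature_operator_def eq[OF W(2)] by (simp only:)
qed

text \<open>In \<open>R(X,Y)(f Z)\<close> the mixed first-order terms cancel by antisymmetry, and the terms with \<open>X(Y f)\<close>,
\<open>Y(X f)\<close> and \<open>[X,Y] f\<close> cancel by the definition of the bracket.\<close>

lemma curvature_operator_slot3:
  assumes X: "field_near X p" and Y: "field_near Y p"
    and Z: "field_near Z p" and Z': "field_near Z' p" and ZZ: "Z p = Z' p"
  shows "curvature_operator X Y Z p = curvature_operator X Y Z' p"
proof (rule pointwise_determined[where L = "\<lambda>Z. curvature_operator X Y Z p", OF _ _ _ Z Z' ZZ])
  have add: "D p v (\<lambda>q. D q (X q) (\<lambda>q. Z q + Z' q)) = D p v (\<lambda>q. D q (X q) Z) + D p v (\<lambda>q. D q (X q) Z')"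
    if X: "field_near X p" and Z: "field_near Z p" and Z': "field_near Z' p" and v: "v \<in> tangent_space A p" for v X Z Z'
  proof -
    obtain W where W: "open W" "p \<in> W" "vector_field A W X" "vector_field A W Z" "vector_field A W Z'"
      using field_near_common3[OF X Z Z'] .
    have "D p v (\<lambda>q. D q (X q) (\<lambda>q. Z q + Z' q)) = D p v (\<lambda>q. D q (X q) Z + D q (X q) Z')"
      by (rule second_derivative_cong[OF v W(1,2,3) vector_field_add[OF W(4,5)]
            vector_field_add[OF connection_field[OF W(1,3,4)] connection_field[OF W(1,3,5)]]])
         (rule connection_add[OF vector_field_tangent[OF W(3)] field_nearI[OF W(1) _ W(4)] field_nearI[OF W(1) _ W(5)]])
    also have "\<dots> = D p v (\<lambda>q. D q (X q) Z) + D p v (\<lambda>q. D q (X q) Z')"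
      by (rule connection_add[OF v field_near_connection[OF X Z] field_near_connection[OF X Z']])
    finally show ?thesis .
  qed
  note t = field_near_tangent[OF X] field_near_tangent[OF Y] lie_bracket_tangent[OF X Y]
  show "curvature_operator X Y (\<lambda>q. Z q + Z' q) p = curvature_operator X Y Z p + curvature_operator X Y Z' p"
    if Z: "field_near Z p" and Z': "field_near Z' p" for Z Z'
    unfolding curvature_operator_def add[OF Y Z Z' t(1)] add[OF X Z Z' t(2)] connection_add[OF t(3) Z Z']
    by (simp only: algebra_simps)
  have sc: "D p v (\<lambda>q. D q (X q) (\<lambda>q. f q *\<^sub>R Z q)) = v (\<lambda>q. X q f) *\<^sub>R Z p + X p f *\<^sub>R D p v Z
      + (v f *\<^sub>R D p (X p) Z + f p *\<^sub>R D p v (\<lambda>q. D q (X q) Z))"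
    if X: "field_near X p" and Z: "field_near Z p" and f: "smooth_near A p f" and v: "v \<in> tangent_space A p" for v X Z f
  proof -
    obtain W' where W': "open W'" "p \<in> W'" "smooth_fun A W' f" using f unfolding smooth_near_def by blast
    obtain W where W: "open W" "p \<in> W" "vector_field A W X" "vector_field A W Z"
      using field_near_common[OF X Z] .
    let ?W = "W \<inter> W'"
    have W: "open ?W" "p \<in> ?W" "vector_field A ?W X" "vector_field A ?W Z" "smooth_fun A ?W f"
      using W W' by (auto intro: vector_field_subset smooth_fun_subset)
    have "D p v (\<lambda>q. D q (X q) (\<lambda>q. f q *\<^sub>R Z q)) = D p v (\<lambda>q. X q f *\<^sub>R Z q + f q *\<^sub>R D q (X q) Z)"
      by (rule second_derivative_cong[OF v W(1,2,3) vector_field_scale[OF W(5,4)]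
            vector_field_add[OF vector_field_scale[OF vector_field_smooth[OF W(3,1) subset_refl W(5)] W(4)]
              vector_field_scale[OF W(5) connection_field[OF W(1,3,4)]]]])
         (rule connection_scale[OF vector_field_tangent[OF W(3)] smooth_nearI[OF W(1) _ W(5)] field_nearI[OF W(1) _ W(4)]])
    also have "\<dots> = D p v (\<lambda>q. X q f *\<^sub>R Z q) + D p v (\<lambda>q. f q *\<^sub>R D q (X q) Z)"
      by (rule connection_add[OF v field_near_scale[OF field_near_apply[OF X f] Z]
            field_near_scale[OF f field_near_connection[OF X Z]]])
    also have "\<dots> = v (\<lambda>q. X q f) *\<^sub>R Z p + X p f *\<^sub>R D p v Z
      + (v f *\<^sub>R D p (X p) Z + f p *\<^sub>R D p v (\<lambda>q. D q (X q) Z))"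
      unfolding connection_scale[OF v field_near_apply[OF X f] Z]
        connection_scale[OF v f field_near_connection[OF X Z]] ..
    finally show ?thesis .
  qed
  show "curvature_operator X Y (\<lambda>q. f q *\<^sub>R Z q) p = f p *\<^sub>R curvature_operator X Y Z p"
    if f: "smooth_near A p f" and Z: "field_near Z p" for f Z
  proof -
    have b: "lie_bracket A X Y p f = X p (\<lambda>q. Y q f) - Y p (\<lambda>q. X q f)" using f by (simp add: lie_bracket_def)
    show ?thesis
      unfolding curvature_operator_def sc[OF Y Z f t(1)] sc[OF X Z f t(2)] connection_scale[OF t(3) f Z] b
      by (simp only: algebra_simps)
  qed
  fix Z Z' W assume W: "open W" "p \<in> W" and v: "vector_field A W Z" "vector_field A W Z'"
    and eq: "\<And>q. q \<in> W \<Longrightarrow> Z q = Z' q"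
  have c: "D p v (\<lambda>q. D q (X q) Z) = D p v (\<lambda>q. D q (X q) Z')"
    if X: "field_near X p" and v': "v \<in> tangent_space A p" for v X
  proof -
    obtain W' where W': "open W'" "p \<in> W'" "vector_field A W' X" using X unfolding field_near_def by blast
    have V: "open (W \<inter> W')" "p \<in> W \<inter> W'" "vector_field A (W \<inter> W') X" "vector_field A (W \<inter> W') Z" "vector_field A (W \<inter> W') Z'"
      using W v W' by (auto intro: vector_field_subset)
    show ?thesis
    proof (rule connection_cong[OF v' V(1,2) connection_field[OF V(1,3,4)] connection_field[OF V(1,3,5)]])
      fix q assume q: "q \<in> W \<inter> W'"
      show "D q (X q) Z = D q (X q) Z'"
        by (rule connection_cong[OF vector_field_tangent[OF V(3) q] V(1) q V(4,5)]) (simp add: eq)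
    qed
  qed
  have d: "D p (lie_bracket A X Y p) Z = D p (lie_bracket A X Y p) Z'"
    by (rule connection_cong[OF t(3) W v]) (rule eq)
  show "curvature_operator X Y Z p = curvature_operator X Y Z' p"
    unfolding curvature_operator_def c[OF Y t(1)] c[OF X t(2)] d ..
qed

lemma curvature_eq:
  assumes X: "field_near X p" and Y: "field_near Y p" and Z: "field_near Z p"
    and u: "X p = u" and v: "Y p = v" and w: "Z p = w"
  shows "curvature A D p u v w = curvature_operator X Y Z p"
proof -
  have "tensor3 A curvature_operator p u v w = curvature_operator X Y Z p"
  proof (rule tensor3_eq[OF _ X Y Z u v w])
    fix X X' Y Y' Z Z' assume n: "field_near X p" "field_near X' p" "field_near Y p" "field_near Y' p"
      "field_near Z p" "field_near Z' p" and e: "X p = X' p" "Y p = Y' p" "Z p = Z' p"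
    have "curvature_operator X Y Z p = curvature_operator X' Y Z p"
      by (rule curvature_operator_slot1[OF n(1,2) e(1) n(3,5)])
    also have "\<dots> = - curvature_operator Y X' Z p" by (rule curvature_operator_antisym[OF n(2,3,5)])
    also have "\<dots> = - curvature_operator Y' X' Z p"
      using curvature_operator_slot1[OF n(3,4) e(2) n(2,5)] by simp
    also have "\<dots> = curvature_operator X' Y' Z p" by (rule curvature_operator_antisym[OF n(2,4,5), symmetric])
    also have "\<dots> = curvature_operator X' Y' Z' p" by (rule curvature_operator_slot3[OF n(2,4,5,6) e(3)])
    finally show "curvature_operator X Y Z p = curvature_operator X' Y' Z' p" .
  qed
  then show ?thesis unfolding curvature_def curvature_operator_def .
qed

text \<open>Used with \<open>u = \<gamma>'\<close>: adding a multiple of the velocity to a Jacobi field does not change the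
curvature term of its equation.\<close>

lemma curvature_shift:
  assumes u: "u \<in> tangent_space A p" and v: "v \<in> tangent_space A p" and w: "w \<in> tangent_space A p"
  shows "curvature A D p u (v + c *\<^sub>R u) w = curvature A D p u v w"
proof -
  obtain X where X: "field_near X p" "X p = u" using field_extension_exists[OF u] .
  obtain Y where Y: "field_near Y p" "Y p = v" using field_extension_exists[OF v] .
  obtain Z where Z: "field_near Z p" "Z p = w" using field_extension_exists[OF w] .
  have cX: "field_near (\<lambda>q. c *\<^sub>R X q) p" by (rule field_near_scale[OF smooth_near_const X(1)])
  have YX: "field_near (\<lambda>q. Y q + c *\<^sub>R X q) p" by (rule field_near_add[OF Y(1) cX])
  have "2 *\<^sub>R curvature_operator X X Z p = curvature_operator X X Z p + - curvature_operator X X Z p"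
    unfolding scaleR_2 curvature_operator_antisym[OF X(1) X(1) Z(1), symmetric] ..
  then have self: "curvature_operator X X Z p = 0"
    by (simp only: right_minus scaleR_eq_0_iff) simp
  have "curvature A D p u (v + c *\<^sub>R u) w = curvature_operator X (\<lambda>q. Y q + c *\<^sub>R X q) Z p"
    by (rule curvature_eq[OF X(1) YX Z(1) X(2) _ Z(2)]) (simp only: X Y)
  also have "\<dots> = - curvature_operator (\<lambda>q. Y q + c *\<^sub>R X q) X Z p"
    by (rule curvature_operator_antisym[OF X(1) YX Z(1)])
  also have "\<dots> = - (curvature_operator Y X Z p + c *\<^sub>R curvature_operator X X Z p)"
    unfolding curvature_operator_add[OF Y(1) cX X(1) Z(1)]
      curvature_operator_scale[OF smooth_near_const X(1) X(1) Z(1)] ..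
  also have "\<dots> = - curvature_operator Y X Z p" by (simp only: self scaleR_zero_right add_0_right)
  also have "\<dots> = curvature_operator X Y Z p"
    by (rule curvature_operator_antisym[OF X(1) Y(1) Z(1), symmetric])
  also have "\<dots> = curvature A D p u v w"
    by (rule curvature_eq[OF X(1) Y(1) Z(1) X(2) Y(2) Z(2), symmetric])
  finally show ?thesis .
qed

lemma curvature_operator_tangent:
  assumes "field_near X p" "field_near Y p" "field_near Z p"
  shows "curvature_operator X Y Z p \<in> tangent_space A p"
  unfolding curvature_operator_def
  by (intro subspace_diff[OF subspace_tangent_space] connection_tangent field_near_tangent
      lie_bracket_tangent field_near_connection assms)

end

section \<open>Global extension of tangent vectors\<close>

text \<open>A constant-coefficient field of a chart is cut off by a bump function and extended by \<open>0\<close>. The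
extension is smooth because the support is contained in the compact set \<open>K\<close>, which is closed in
the manifold by the Hausdorff property.\<close>

lemma global_field_extension:
  fixes A :: "('a::t2_space, 'n::finite) chart set"
  assumes A: "smooth_atlas A" and v: "v \<in> tangent_space A p"
  shows "\<exists>X. vector_field A UNIV X \<and> X p = v"
proof -
  interpret smooth_manifold A by unfold_locales (rule A)
  obtain U \<phi> where c: "(U, \<phi>) \<in> A" "p \<in> U" using chart_exists by blast
  obtain w where w: "v = coord_vec U \<phi> w p" using v unfolding tangent_space_eq[OF c] by blast
  obtain r where r: "r > 0" "cball (\<phi> p) r \<subseteq> \<phi> ` U"
    using chart_image_open[OF c(1)] c(2) open_contains_cball by blast
  obtain \<beta> where \<beta>: "smooth_on UNIV \<beta>" "\<beta> (\<phi> p) \<noteq> (0::real)" "\<forall>x. dist (\<phi> p) x \<ge> r \<longrightarrow> \<beta> x = 0"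
    using smooth_bump_exists[OF r(1), of "\<phi> p"] by blast
  define K where "K = inv_into U \<phi> ` cball (\<phi> p) r"
  have "continuous_on (cball (\<phi> p) r) (inv_into U \<phi>)"
    by (rule continuous_on_subset[OF _ r(2)])
       (use chart_homeomorphism[OF c(1)] in \<open>simp add: homeomorphism_def\<close>)
  then have K: "closed K" unfolding K_def by (intro compact_imp_closed compact_continuous_image) auto
  have KU: "K \<subseteq> U" unfolding K_def using r(2) inv_into_into by (metis image_subsetI subset_iff)
  define h where "h = (\<lambda>q. \<beta> (\<phi> q) / \<beta> (\<phi> p))"
  \<comment> \<open>normalised so that the factor at \<open>p\<close> is \<open>1\<close>\<close>
  define X where "X = (\<lambda>q. if q \<in> U then h q *\<^sub>R coord_vec U \<phi> w q else 0)"
  have "smooth_on (\<phi> ` U) (\<lambda>x. \<beta> x * inverse (\<beta> (\<phi> p)))"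
    by (intro smooth_on_mult smooth_on_const smooth_on_subset[OF \<beta>(1)]) simp
  from smooth_fun_chart_compose[OF c(1) this] have h: "smooth_fun A U h"
    by (simp add: h_def divide_inverse)
  have "vector_field A UNIV X"
  proof (rule vector_field_local)
    fix q
    show "\<exists>N. open N \<and> q \<in> N \<and> vector_field A (UNIV \<inter> N) X"
    proof (cases "q \<in> U")
      case True
      have "vector_field A U X"
        by (rule vector_field_cong[OF vector_field_scale[OF h coord_vec_field[OF c(1), of w]]])
           (simp add: X_def)
      then show ?thesis using True chart_open[OF c(1)] by (intro exI[of _ U]) simp
    next
      case False
      have "vector_field A (- K) X"
      proof (rule vector_field_cong[OF vector_field_zero])
        fix q assume q: "q \<in> - K"
        have "h q = 0" if "q \<in> U"
        proof -
          have "\<phi> q \<notin> cball (\<phi> p) r"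
            using q chart_inv[OF c(1) that] unfolding K_def by (metis ComplD imageI)
          then show ?thesis using \<beta>(3) by (simp add: h_def)
        qed
        then show "0 = X q" by (simp add: X_def)
      qed
      then show ?thesis using False KU K by (intro exI[of _ "- K"]) auto
    qed
  qed
  moreover have "X p = v" using c(2) \<beta>(2) by (simp add: X_def h_def w)
  ultimately show ?thesis by blast
qed

section \<open>The Webster metric and the Tanaka-Webster connection\<close>

lemma projection_linear:
  "(a *\<^sub>R u + b *\<^sub>R v) - (a * x + b * y) *\<^sub>R z = a *\<^sub>R (u - x *\<^sub>R z) + b *\<^sub>R (v - y *\<^sub>R z)"
  for u v z :: "'v::real_vector"
  by (simp add: algebra_simps)

locale webster_manifold = manifold_connection A D
  for A :: "('a::{t2_space,second_countable_topology}, 'n::finite) chart set" and D +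
  fixes m :: nat and H :: "'a \<Rightarrow> 'a tvec set" and J :: "'a \<Rightarrow> 'a tvec \<Rightarrow> 'a tvec"
    and \<theta> :: "'a \<Rightarrow> 'a tvec \<Rightarrow> real" and \<xi> :: "'a vfield"
  assumes pseudo: "pseudo_hermitian A m H J \<theta>"
    and reeb: "reeb_field A \<theta> \<xi>"
    and tanaka: "tanaka_webster A H J \<theta> \<xi> D"
begin

abbreviation \<omega> :: "'a \<Rightarrow> 'a tvec \<Rightarrow> 'a tvec \<Rightarrow> real" where "\<omega> \<equiv> ext_deriv A \<theta>"
abbreviation g :: "'a \<Rightarrow> 'a tvec \<Rightarrow> 'a tvec \<Rightarrow> real" where "g \<equiv> webster_metric A J \<theta> \<xi>"
abbreviation hor :: "'a \<Rightarrow> 'a tvec \<Rightarrow> 'a tvec" where "hor \<equiv> horizontal_part \<theta> \<xi>"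
abbreviation J' :: "'a \<Rightarrow> 'a tvec \<Rightarrow> 'a tvec" where "J' \<equiv> extended_J J \<theta> \<xi>"

lemma theta_form: "one_form A \<theta>" and complex_structure: "smooth_complex_structure A H J"
  and integrable: "integrable_cr A H J" and H_eq: "H p = {v \<in> tangent_space A p. \<theta> p v = 0}"
  using pseudo unfolding pseudo_hermitian_def by blast+

lemma H_tangent: "v \<in> H p \<Longrightarrow> v \<in> tangent_space A p" and H_theta: "v \<in> H p \<Longrightarrow> \<theta> p v = 0"
  unfolding H_eq by blast+

lemma reeb_vector_field: "vector_field A UNIV \<xi>" and theta_reeb: "\<theta> p (\<xi> p) = 1"
  and omega_reeb: "v \<in> tangent_space A p \<Longrightarrow> \<omega> p (\<xi> p) v = 0"
  using reeb unfolding reeb_field_def by blast+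

lemma reeb_tangent: "\<xi> p \<in> tangent_space A p"
  by (rule vector_field_tangent[OF reeb_vector_field UNIV_I])

lemma theta_linear: "linear_on (tangent_space A p) (\<theta> p)"
  by (rule theta_form[unfolded one_form_def, THEN conjunct1, rule_format])

lemma theta_apply: "u \<in> tangent_space A p \<Longrightarrow> v \<in> tangent_space A p \<Longrightarrow>
    \<theta> p (a *\<^sub>R u + b *\<^sub>R v) = a * \<theta> p u + b * \<theta> p v"
  using theta_linear[unfolded linear_on_def, rule_format, of u p v a b] by simp

lemma theta_smooth:
  assumes "open W" "vector_field A W X"
  shows "smooth_fun A W (\<lambda>p. \<theta> p (X p))"
  by (rule theta_form[unfolded one_form_def, THEN conjunct2, THEN spec, THEN spec, THEN mp])
     (intro conjI assms)

lemma J_H: "v \<in> H p \<Longrightarrow> J p v \<in> H p" and J_J: "v \<in> H p \<Longrightarrow> J p (J p v) = - v"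
  and J_linear: "linear_on (H p) (J p)"
  using complex_structure unfolding smooth_complex_structure_def by blast+

lemma J_field:
  assumes "open W" "vector_field A W X" "\<And>q. q \<in> W \<Longrightarrow> X q \<in> H q"
  shows "vector_field A W (\<lambda>q. J q (X q))"
  by (rule complex_structure[unfolded smooth_complex_structure_def, THEN conjunct2, THEN spec, THEN spec, THEN mp])
     (intro conjI ballI assms)

lemma H_subspace: "subspace (H p)"
proof (rule subspaceI)
  show "0 \<in> H p"
    using subspace_0[OF subspace_tangent_space[of p]] theta_apply[of 0 p 0 0 0] unfolding H_eq by simp
  show "x + y \<in> H p" if "x \<in> H p" "y \<in> H p" for x y
    using subspace_add[OF subspace_tangent_space[of p]] theta_apply[of x p y 1 1] that unfolding H_eq by simp
  show "c *\<^sub>R x \<in> H p" if "x \<in> H p" for c x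
    using subspace_scale[OF subspace_tangent_space[of p]] theta_apply[of x p x c 0] that unfolding H_eq by simp
qed

lemma J_zero: "J p 0 = 0"
  using J_linear[of p, unfolded linear_on_def, rule_format, OF subspace_0[OF H_subspace] subspace_0[OF H_subspace], of 0 0]
  by simp

lemma hor_H: "v \<in> tangent_space A p \<Longrightarrow> hor p v \<in> H p"
proof -
  assume v: "v \<in> tangent_space A p"
  have "\<theta> p (hor p v) = 0"
    using theta_apply[OF v reeb_tangent, of 1 "- \<theta> p v"] by (simp add: horizontal_part_def theta_reeb)
  moreover have "hor p v \<in> tangent_space A p"
    unfolding horizontal_part_def
    by (intro subspace_diff[OF subspace_tangent_space] subspace_scale[OF subspace_tangent_space] v reeb_tangent)
  ultimately show ?thesis unfolding H_eq by blast
qed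

lemma hor_of_H: "v \<in> H p \<Longrightarrow> hor p v = v"
  by (simp add: horizontal_part_def H_theta)

lemma hor_reeb: "hor p (\<xi> p) = 0"
  by (simp add: horizontal_part_def theta_reeb)

lemma hor_decomp: "v = 1 *\<^sub>R hor p v + \<theta> p v *\<^sub>R \<xi> p"
  by (simp add: horizontal_part_def)

lemma hor_apply: "u \<in> tangent_space A p \<Longrightarrow> v \<in> tangent_space A p \<Longrightarrow>
    hor p (a *\<^sub>R u + b *\<^sub>R v) = a *\<^sub>R hor p u + b *\<^sub>R hor p v"
  unfolding horizontal_part_def theta_apply by (rule projection_linear)

lemma hor_field: "open W \<Longrightarrow> vector_field A W X \<Longrightarrow> vector_field A W (\<lambda>q. hor q (X q))"
  unfolding horizontal_part_def
  by (intro vector_field_diff vector_field_scale theta_smooth vector_field_subset[OF reeb_vector_field]) auto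

lemma J'_H: "v \<in> tangent_space A p \<Longrightarrow> J' p v \<in> H p"
  unfolding extended_J_def by (intro J_H hor_H)

lemma J'_field: "open W \<Longrightarrow> vector_field A W X \<Longrightarrow> vector_field A W (\<lambda>q. J' q (X q))"
  unfolding extended_J_def by (intro J_field hor_field hor_H) (auto intro: vector_field_tangent)

lemma J'_apply: "u \<in> tangent_space A p \<Longrightarrow> v \<in> tangent_space A p \<Longrightarrow>
    J' p (a *\<^sub>R u + b *\<^sub>R v) = a *\<^sub>R J' p u + b *\<^sub>R J' p v"
  unfolding extended_J_def hor_apply
  by (rule J_linear[unfolded linear_on_def, rule_format, OF hor_H hor_H])

lemma omega_eq:
  assumes "field_near X p" "field_near Y p"
  shows "\<omega> p (X p) (Y p) = (X p (\<lambda>q. \<theta> q (Y q)) - Y p (\<lambda>q. \<theta> q (X q)) - \<theta> p (lie_bracket A X Y p)) / 2"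
  unfolding ext_deriv_def
  by (rule alternating_tensorial_tensor2[OF ext_deriv_alternating[OF theta_form] assms refl refl])

lemma omega_linear: "v \<in> tangent_space A p \<Longrightarrow> linear_on (tangent_space A p) (\<lambda>u. \<omega> p u v)"
  unfolding ext_deriv_def by (rule alternating_tensorial_linear[OF ext_deriv_alternating[OF theta_form]])

lemma omega_linear_right: "u \<in> tangent_space A p \<Longrightarrow> linear_on (tangent_space A p) (\<omega> p u)"
  unfolding ext_deriv_def by (rule alternating_tensorial_linear_right[OF ext_deriv_alternating[OF theta_form]])

lemma omega_antisym: "u \<in> tangent_space A p \<Longrightarrow> v \<in> tangent_space A p \<Longrightarrow> \<omega> p u v = - \<omega> p v u"
  unfolding ext_deriv_def by (rule alternating_tensorial_antisym[OF ext_deriv_alternating[OF theta_form]])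

lemma omega_apply: "u \<in> tangent_space A p \<Longrightarrow> v \<in> tangent_space A p \<Longrightarrow> w \<in> tangent_space A p \<Longrightarrow>
    \<omega> p (a *\<^sub>R u + b *\<^sub>R v) w = a * \<omega> p u w + b * \<omega> p v w"
  using omega_linear[unfolded linear_on_def, rule_format, of w p u v a b] by simp

lemma omega_apply_right: "u \<in> tangent_space A p \<Longrightarrow> v \<in> tangent_space A p \<Longrightarrow> w \<in> tangent_space A p \<Longrightarrow>
    \<omega> p w (a *\<^sub>R u + b *\<^sub>R v) = a * \<omega> p w u + b * \<omega> p w v"
  using omega_linear_right[unfolded linear_on_def, rule_format, of w p u v a b] by simp

lemma omega_smooth:
  assumes W: "open W" and X: "vector_field A W X" and Y: "vector_field A W Y"
  shows "smooth_fun A W (\<lambda>q. \<omega> q (X q) (Y q))"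
proof -
  have "smooth_fun A W (\<lambda>q. (1/2) * (X q (\<lambda>q. \<theta> q (Y q)) - Y q (\<lambda>q. \<theta> q (X q)) - \<theta> q (lie_bracket A X Y q)))"
    by (intro smooth_fun_mult smooth_fun_const smooth_fun_diff vector_field_smooth[OF X W subset_refl]
        vector_field_smooth[OF Y W subset_refl] theta_smooth W X Y lie_bracket_field)
  then show ?thesis
  proof (rule smooth_fun_cong[rotated])
    fix q assume q: "q \<in> W"
    show "(1/2) * (X q (\<lambda>q. \<theta> q (Y q)) - Y q (\<lambda>q. \<theta> q (X q)) - \<theta> q (lie_bracket A X Y q)) = \<omega> q (X q) (Y q)"
      unfolding omega_eq[OF field_nearI[OF W q X] field_nearI[OF W q Y]] by simp
  qed
qed

text \<open>The vertical direction lies in the kernel of \<open>d\<theta>\<close>.\<close>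

lemma omega_hor:
  assumes u: "u \<in> tangent_space A p" and v: "v \<in> tangent_space A p"
  shows "\<omega> p u v = \<omega> p (hor p u) (hor p v)"
proof -
  note h = H_tangent[OF hor_H[OF u]] H_tangent[OF hor_H[OF v]]
  have "\<omega> p (1 *\<^sub>R hor p u + \<theta> p u *\<^sub>R \<xi> p) v = \<omega> p (hor p u) v"
    unfolding omega_apply[OF h(1) reeb_tangent v] omega_reeb[OF v] by simp
  moreover have "\<omega> p (hor p u) (1 *\<^sub>R hor p v + \<theta> p v *\<^sub>R \<xi> p) = \<omega> p (hor p u) (hor p v)"
    unfolding omega_apply_right[OF h(2) reeb_tangent h(1)] omega_antisym[OF h(1) reeb_tangent] omega_reeb[OF h(1)] by simp
  ultimately show ?thesis unfolding hor_decomp[symmetric] by simp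
qed

lemma metric_eq: "g p u v = \<theta> p u * \<theta> p v + \<omega> p (hor p u) (J' p v)"
  by (simp add: webster_metric_def levi_form_def extended_J_def)

lemma metric_linear:
  assumes v: "v \<in> tangent_space A p"
  shows "linear_on (tangent_space A p) (\<lambda>u. g p u v)"
  unfolding linear_on_def
proof (intro ballI allI)
  fix u w and a b :: real
  assume uw: "u \<in> tangent_space A p" "w \<in> tangent_space A p"
  show "g p (a *\<^sub>R u + b *\<^sub>R w) v = a *\<^sub>R g p u v + b *\<^sub>R g p w v"
    unfolding metric_eq theta_apply[OF uw] hor_apply[OF uw]
      omega_apply[OF H_tangent[OF hor_H[OF uw(1)]] H_tangent[OF hor_H[OF uw(2)]] H_tangent[OF J'_H[OF v]]]
    by (simp add: algebra_simps)
qed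

lemma metric_linear_right:
  assumes v: "v \<in> tangent_space A p"
  shows "linear_on (tangent_space A p) (g p v)"
  unfolding linear_on_def
proof (intro ballI allI)
  fix u w and a b :: real
  assume uw: "u \<in> tangent_space A p" "w \<in> tangent_space A p"
  show "g p v (a *\<^sub>R u + b *\<^sub>R w) = a *\<^sub>R g p v u + b *\<^sub>R g p v w"
    unfolding metric_eq theta_apply[OF uw] J'_apply[OF uw]
      omega_apply_right[OF H_tangent[OF J'_H[OF uw(1)]] H_tangent[OF J'_H[OF uw(2)]] H_tangent[OF hor_H[OF v]]]
    by (simp add: algebra_simps)
qed

lemma metric_apply: "u \<in> tangent_space A p \<Longrightarrow> v \<in> tangent_space A p \<Longrightarrow> w \<in> tangent_space A p \<Longrightarrow>
    g p (a *\<^sub>R u + b *\<^sub>R v) w = a * g p u w + b * g p v w"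
  using metric_linear[unfolded linear_on_def, rule_format, of w p u v a b] by simp

lemma metric_zero: "v \<in> tangent_space A p \<Longrightarrow> g p 0 v = 0" "v \<in> tangent_space A p \<Longrightarrow> g p v 0 = 0"
  using metric_linear[unfolded linear_on_def, rule_format, of v p 0 0 0 0]
    metric_linear_right[unfolded linear_on_def, rule_format, of v p 0 0 0 0]
    subspace_0[OF subspace_tangent_space[of p]] by simp_all

lemma metric_smooth:
  assumes W: "open W" and X: "vector_field A W X" and Y: "vector_field A W Y"
  shows "smooth_fun A W (\<lambda>q. g q (X q) (Y q))"
  unfolding metric_eq
  by (intro smooth_fun_add smooth_fun_mult theta_smooth omega_smooth hor_field J'_field W X Y)

text \<open>This identifies the integrand of the theorem with the function in the torsion of the Jacobi
equation.\<close>

lemma metric_J: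
  assumes u: "u \<in> tangent_space A p" and v: "v \<in> tangent_space A p"
  shows "g p v (J' p u) = \<omega> p u v"
proof -
  note hu = hor_H[OF u] and hv = hor_H[OF v]
  have "J' p (J' p u) = - hor p u"
    unfolding extended_J_def hor_of_H[OF J_H[OF hu]] by (rule J_J[OF hu])
  then have "g p v (J' p u) = \<omega> p (hor p v) (- hor p u)"
    unfolding metric_eq H_theta[OF J'_H[OF u]] by simp
  also have "\<dots> = - \<omega> p (hor p v) (hor p u)"
    using omega_apply_right[OF H_tangent[OF hu] H_tangent[OF hu] H_tangent[OF hv], of "-1" 0] by simp
  also have "\<dots> = \<omega> p u v"
    using omega_antisym[OF H_tangent[OF hu] H_tangent[OF hv]] omega_hor[OF u v] by simp
  finally show ?thesis .
qed

lemma metric_reeb: "v \<in> tangent_space A p \<Longrightarrow> g p (\<xi> p) v = \<theta> p v"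
  and metric_reeb_right: "v \<in> tangent_space A p \<Longrightarrow> g p v (\<xi> p) = \<theta> p v"
proof -
  assume v: "v \<in> tangent_space A p"
  have z: "0 \<in> tangent_space A p" by (rule subspace_0[OF subspace_tangent_space])
  have "\<omega> p 0 (J' p v) = 0"
    using omega_apply[OF z z H_tangent[OF J'_H[OF v]], of 0 0] by simp
  then show "g p (\<xi> p) v = \<theta> p v" unfolding metric_eq hor_reeb theta_reeb by simp
  have "\<omega> p (hor p v) 0 = 0"
    using omega_apply_right[OF z z H_tangent[OF hor_H[OF v]], of 0 0] by simp
  then show "g p v (\<xi> p) = \<theta> p v" unfolding metric_eq extended_J_def hor_reeb theta_reeb J_zero by simp
qed

lemma horizontal_field_extension:
  assumes "u \<in> H p"
  shows "\<exists>X. vector_field A UNIV X \<and> (\<forall>q. X q \<in> H q) \<and> X p = u"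
proof -
  obtain X where X: "vector_field A UNIV X" "X p = u"
    using global_field_extension[OF atlas H_tangent[OF assms]] by blast
  show ?thesis
    using hor_field[OF open_UNIV X(1)] hor_H[OF vector_field_tangent[OF X(1) UNIV_I]] hor_of_H[OF assms] X(2)
    by (intro exI[of _ "\<lambda>q. hor q (X q)"]) auto
qed

lemma omega_horizontal_fields:
  assumes X: "field_near X p" "\<And>q. X q \<in> H q" and Y: "field_near Y p" "\<And>q. Y q \<in> H q"
  shows "\<omega> p (X p) (Y p) = - \<theta> p (lie_bracket A X Y p) / 2"
proof -
  have "(\<lambda>q. \<theta> q (X q)) = (\<lambda>q. 0)" "(\<lambda>q. \<theta> q (Y q)) = (\<lambda>q. 0)"
    using H_theta[OF X(2)] H_theta[OF Y(2)] by blast+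
  then show ?thesis
    unfolding omega_eq[OF X(1) Y(1)]
    by (simp add: tangent_const[OF field_near_tangent[OF X(1)]] tangent_const[OF field_near_tangent[OF Y(1)]])
qed

text \<open>Extend \<open>u\<close> and \<open>v\<close> to global horizontal fields \<open>X\<close> and \<open>Y\<close>. The bracket of the sections \<open>X - i J X\<close>
and \<open>Y - i J Y\<close> has real part \<open>[X, Y] - [J X, J Y]\<close>; by integrability it is horizontal, so \<open>\<theta>\<close> has
the same value on both brackets. On horizontal fields \<open>d\<theta>(X, Y) = - \<theta>([X, Y]) / 2\<close>.\<close>

lemma omega_J_invariant:
  assumes u: "u \<in> H p" and v: "v \<in> H p"
  shows "\<omega> p (J p u) (J p v) = \<omega> p u v"
proof -
  obtain X where X: "vector_field A UNIV X" "\<And>q. X q \<in> H q" "X p = u"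
    using horizontal_field_extension[OF u] by blast
  obtain Y where Y: "vector_field A UNIV Y" "\<And>q. Y q \<in> H q" "Y p = v"
    using horizontal_field_extension[OF v] by blast
  define C where "C = (\<lambda>(X :: 'a vfield) q f. complex_of_real (X q f) - \<i> * complex_of_real (J q (X q) f))"
  have C: "C X \<in> smooth_csections A (H10 H J)" and JX: "vector_field A UNIV (\<lambda>q. J q (X q))"
    if X: "vector_field A UNIV X" "\<And>q. X q \<in> H q" for X
  proof -
    show JX: "vector_field A UNIV (\<lambda>q. J q (X q))" by (rule J_field[OF open_UNIV X])
    have "(\<lambda>p f. Re (C X p f)) = X" "(\<lambda>p f. Im (C X p f)) = (\<lambda>p. (-1) *\<^sub>R J p (X p))"
      by (simp_all add: C_def fun_eq_iff scaleR_fun_def)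
    then have "vector_field A UNIV (\<lambda>p f. Re (C X p f))" "vector_field A UNIV (\<lambda>p f. Im (C X p f))"
      using X(1) vector_field_scale[OF smooth_fun_const JX, of "-1"] by simp_all
    moreover have "C X q \<in> H10 H J q" for q unfolding C_def H10_def using X(2) by blast
    ultimately show "C X \<in> smooth_csections A (H10 H J)" unfolding smooth_csections_def by blast
  qed
  have "clie_bracket A (C X) (C Y) \<in> smooth_csections A (H10 H J)"
    using integrable C[OF X(1,2)] C[OF Y(1,2)] unfolding integrable_cr_def by blast
  then have "clie_bracket A (C X) (C Y) p \<in> H10 H J p" unfolding smooth_csections_def by blast
  then obtain w where w: "w \<in> H p"
    "clie_bracket A (C X) (C Y) p = (\<lambda>f. complex_of_real (w f) - \<i> * complex_of_real (J p w f))"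
    unfolding H10_def by blast
  note nX = field_nearI[OF open_UNIV UNIV_I[of p] X(1)] and nY = field_nearI[OF open_UNIV UNIV_I[of p] Y(1)]
  note nJX = field_nearI[OF open_UNIV UNIV_I[of p] JX[OF X(1,2)]] and nJY = field_nearI[OF open_UNIV UNIV_I[of p] JX[OF Y(1,2)]]
  let ?B = "lie_bracket A X Y p" and ?B' = "lie_bracket A (\<lambda>q. J q (X q)) (\<lambda>q. J q (Y q)) p"
  have "w f = (1 *\<^sub>R ?B + (-1) *\<^sub>R ?B') f" for f
  proof -
    have "w f = Re (clie_bracket A (C X) (C Y) p f)" unfolding w(2) by simp
    also have "\<dots> = (1 *\<^sub>R ?B + (-1) *\<^sub>R ?B') f"
    proof (cases "smooth_near A p f")
      case True
      have m: "J p (Z p) (\<lambda>q. - J q (Z' q) f) = - J p (Z p) (\<lambda>q. J q (Z' q) f)"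
        if "field_near (\<lambda>q. J q (Z q)) p" "field_near (\<lambda>q. J q (Z' q)) p" for Z Z'
        by (rule tangent_minus[OF field_near_tangent[OF that(1)] field_near_apply[OF that(2) True]])
      have "Re (cact (C X p) (\<lambda>q. C Y q f)) = X p (\<lambda>q. Y q f) - J p (X p) (\<lambda>q. J q (Y q) f)"
        "Re (cact (C Y p) (\<lambda>q. C X q f)) = Y p (\<lambda>q. X q f) - J p (Y p) (\<lambda>q. J q (X q) f)"
        by (simp_all add: cact_def C_def m[OF nJX nJY] m[OF nJY nJX])
      then show ?thesis using True by (simp add: clie_bracket_def lie_bracket_def scaleR_fun_def)
    next
      case False
      then show ?thesis by (simp add: clie_bracket_def lie_bracket_def scaleR_fun_def)
    qed
    finally show ?thesis .
  qed
  then have "w = 1 *\<^sub>R ?B + (-1) *\<^sub>R ?B'" by blast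
  then have "\<theta> p ?B = \<theta> p ?B'"
    using H_theta[OF w(1)] theta_apply[OF lie_bracket_tangent[OF nX nY] lie_bracket_tangent[OF nJX nJY], of 1 "-1"]
    by simp
  moreover have "\<omega> p (J p (X p)) (J p (Y p)) = - \<theta> p ?B' / 2"
    by (rule omega_horizontal_fields[OF nJX J_H[OF X(2)] nJY J_H[OF Y(2)]])
  ultimately show ?thesis
    using omega_horizontal_fields[OF nX X(2) nY Y(2)] X(3) Y(3) by simp
qed

text \<open>Substituting \<open>J v\<close> in the invariance of \<open>d\<theta>\<close> under \<open>J\<close> gives
\<open>d\<theta>(u, J v) = d\<theta>(J u, - v) = d\<theta>(v, J u)\<close>.\<close>

lemma metric_sym:
  assumes u: "u \<in> tangent_space A p" and v: "v \<in> tangent_space A p"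
  shows "g p u v = g p v u"
proof -
  note hu = hor_H[OF u] and hv = hor_H[OF v]
  have "\<omega> p (hor p u) (J p (hor p v)) = \<omega> p (J p (hor p u)) (J p (J p (hor p v)))"
    by (rule omega_J_invariant[OF hu J_H[OF hv], symmetric])
  also have "\<dots> = \<omega> p (J p (hor p u)) (- hor p v)" unfolding J_J[OF hv] ..
  also have "\<dots> = - \<omega> p (J p (hor p u)) (hor p v)"
    using omega_apply_right[OF H_tangent[OF hv] H_tangent[OF hv] H_tangent[OF J_H[OF hu]], of "-1" 0] by simp
  also have "\<dots> = \<omega> p (hor p v) (J p (hor p u))"
    using omega_antisym[OF H_tangent[OF hv] H_tangent[OF J_H[OF hu]]] by simp
  finally show ?thesis unfolding metric_eq extended_J_def by simp
qed

lemma metric_parallel: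
  assumes v: "v \<in> tangent_space A p" and X: "field_near X p" and Y: "field_near Y p"
  shows "v (\<lambda>q. g q (X q) (Y q)) = g p (D p v X) (Y p) + g p (X p) (D p v Y)"
proof -
  obtain W where W: "open W" "p \<in> W" "vector_field A W X" "vector_field A W Y"
    using field_near_common[OF X Y] .
  show ?thesis
    by (rule tanaka[unfolded tanaka_webster_def, THEN conjunct2, THEN conjunct2, THEN conjunct1,
          THEN spec[of _ W], THEN spec[of _ p], THEN spec[of _ v], THEN spec[of _ X], THEN spec[of _ Y], THEN mp])
       (intro conjI W v)
qed

lemma J_parallel:
  assumes v: "v \<in> tangent_space A p" and X: "vector_field A UNIV X"
  shows "D p v (\<lambda>q. J' q (X q)) = J' p (D p v X)"
  by (rule tanaka[unfolded tanaka_webster_def, THEN conjunct2, THEN conjunct2, THEN conjunct2, THEN conjunct1,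
          THEN spec[of _ UNIV], THEN spec[of _ p], THEN spec[of _ v], THEN spec[of _ X], THEN mp])
     (intro conjI open_UNIV UNIV_I v X)

text \<open>As \<open>J \<xi> = 0\<close> and \<open>J\<close> is parallel, \<open>J (\<nabla>\<xi>) = 0\<close>, so \<open>\<nabla>\<xi>\<close> is vertical; as \<open>\<xi>\<close> has unit length it is also
orthogonal to \<open>\<xi>\<close>.\<close>

lemma reeb_parallel:
  assumes v: "v \<in> tangent_space A p"
  shows "D p v \<xi> = 0"
proof -
  note n\<xi> = field_nearI[OF open_UNIV UNIV_I reeb_vector_field]
  let ?w = "D p v \<xi>"
  have w: "?w \<in> tangent_space A p" by (rule connection_tangent[OF v n\<xi>])
  have "(\<lambda>q. J' q (\<xi> q)) = (\<lambda>q. 0)" unfolding extended_J_def hor_reeb J_zero ..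
  then have "J' p ?w = 0" using J_parallel[OF v reeb_vector_field] connection_zero[OF v] by simp
  then have "J p (J p (hor p ?w)) = 0" unfolding extended_J_def by (simp only: J_zero)
  then have h: "hor p ?w = 0" using J_J[OF hor_H[OF w]] by simp
  have one: "(\<lambda>q. g q (\<xi> q) (\<xi> q)) = (\<lambda>q. 1)" by (simp only: metric_reeb[OF reeb_tangent] theta_reeb)
  have "v (\<lambda>q. g q (\<xi> q) (\<xi> q)) = 0" unfolding one by (rule tangent_const[OF v])
  then have "\<theta> p ?w = 0"
    unfolding metric_parallel[OF v n\<xi> n\<xi>] metric_reeb[OF w] metric_reeb_right[OF w] by simp
  then show ?thesis using hor_decomp[of ?w p] h by simp
qed

lemma torsion_linear: "v \<in> tangent_space A p \<Longrightarrow> linear_on (tangent_space A p) (\<lambda>u. torsion A D p u v)"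
  and torsion_antisym: "u \<in> tangent_space A p \<Longrightarrow> v \<in> tangent_space A p \<Longrightarrow>
    torsion A D p u v = - torsion A D p v u"
  unfolding torsion_def
  by (rule alternating_tensorial_linear[OF torsion_alternating],
      simp only:, rule alternating_tensorial_antisym[OF torsion_alternating])

text \<open>Both sides are alternating and annihilate \<open>\<xi>\<close>, the left one by the Sasakian condition, so only the
horizontal parts matter. There the formula is part of the definition of the connection.\<close>

lemma sasakian_torsion:
  assumes S: "sasakian A \<xi> D" and u: "u \<in> tangent_space A p" and v: "v \<in> tangent_space A p"
  shows "torsion A D p u v = (2 * \<omega> p u v) *\<^sub>R \<xi> p"
proof -
  let ?T = "torsion A D p"
  have z: "?T (\<xi> p) w = 0" if "w \<in> tangent_space A p" for w
    using S that unfolding sasakian_def by blast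
  have red: "?T u v = ?T (hor p u) v" if u: "u \<in> tangent_space A p" and v: "v \<in> tangent_space A p" for u v
  proof -
    have "?T (1 *\<^sub>R hor p u + \<theta> p u *\<^sub>R \<xi> p) v = 1 *\<^sub>R ?T (hor p u) v + \<theta> p u *\<^sub>R ?T (\<xi> p) v"
      by (rule torsion_linear[OF v, unfolded linear_on_def, rule_format, OF H_tangent[OF hor_H[OF u]] reeb_tangent])
    then show ?thesis
      unfolding hor_decomp[symmetric] z[OF v] by (simp only: scaleR_one scaleR_zero_right add_0_right)
  qed
  note hu = H_tangent[OF hor_H[OF u]]
  have "?T u v = ?T (hor p u) v" by (rule red[OF u v])
  also have "\<dots> = - ?T v (hor p u)" by (rule torsion_antisym[OF hu v])
  also have "\<dots> = - ?T (hor p v) (hor p u)" unfolding red[OF v hu] ..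
  also have "\<dots> = ?T (hor p u) (hor p v)"
    by (rule torsion_antisym[OF hu H_tangent[OF hor_H[OF v]], symmetric])
  also have "\<dots> = (2 * \<omega> p (hor p u) (hor p v)) *\<^sub>R \<xi> p"
    using tanaka hor_H[OF u] hor_H[OF v] unfolding tanaka_webster_def by blast
  finally show ?thesis unfolding omega_hor[OF u v] .
qed

text \<open>Differentiate \<open>h = \<langle>Z, Z\<rangle>\<close>. Metric compatibility and symmetry give
\<open>X (Y h) = 2 (\<langle>\<nabla>\<^sub>X \<nabla>\<^sub>Y Z, Z\<rangle> + \<langle>\<nabla>\<^sub>Y Z, \<nabla>\<^sub>X Z\<rangle>)\<close> and \<open>[X, Y] h = 2 \<langle>\<nabla>\<^bsub>[X, Y]\<^esub> Z, Z\<rangle>\<close>; subtract.\<close>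

lemma curvature_metric_zero:
  assumes u: "u \<in> tangent_space A p" and v: "v \<in> tangent_space A p" and w: "w \<in> tangent_space A p"
  shows "g p (curvature A D p u v w) w = 0" and "curvature A D p u v w \<in> tangent_space A p"
proof -
  obtain X where X: "field_near X p" "X p = u" using field_extension_exists[OF u] .
  obtain Y where Y: "field_near Y p" "Y p = v" using field_extension_exists[OF v] .
  obtain Z where Z: "field_near Z p" "Z p = w" using field_extension_exists[OF w] .
  have R: "curvature A D p u v w = curvature_operator X Y Z p"
    by (rule curvature_eq[OF X(1) Y(1) Z(1) X(2) Y(2) Z(2)])
  show "curvature A D p u v w \<in> tangent_space A p"
    unfolding R by (rule curvature_operator_tangent[OF X(1) Y(1) Z(1)])
  define h where "h = (\<lambda>q. g q (Z q) (Z q))"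
  obtain W where W: "open W" "p \<in> W" "vector_field A W Z" using Z(1) unfolding field_near_def by blast
  have hs: "smooth_near A p h"
    unfolding h_def by (rule smooth_nearI[OF W(1,2) metric_smooth[OF W(1,3,3)]])
  have first: "x h = 2 * g q (D q x Z) (Z q)" if "x \<in> tangent_space A q" "field_near Z q" for x q
    unfolding h_def metric_parallel[OF that(1,2,2)]
    using metric_sym[OF connection_tangent[OF that] field_near_tangent[OF that(2)]] by simp
  have second: "x (\<lambda>q. E q h) = 2 * (g p (D p x (\<lambda>q. D q (E q) Z)) w + g p (D p (E p) Z) (D p x Z))"
    if x: "x \<in> tangent_space A p" and E: "field_near E p" for x E
  proof -
    obtain V where V: "open V" "p \<in> V" "vector_field A V E" "vector_field A V Z"
      using field_near_common[OF E Z(1)] .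
    have sm: "smooth_near A p (\<lambda>q. g q (D q (E q) Z) (Z q))"
      by (rule smooth_nearI[OF V(1,2) metric_smooth[OF V(1) connection_field[OF V(1,3,4)] V(4)]])
    have "x (\<lambda>q. E q h) = x (\<lambda>q. 2 * g q (D q (E q) Z) (Z q))"
      by (rule tangent_cong[OF x V(1,2)])
         (rule first[OF vector_field_tangent[OF V(3)] field_nearI[OF V(1) _ V(4)]])
    also have "\<dots> = 2 * x (\<lambda>q. g q (D q (E q) Z) (Z q))"
      unfolding tangent_mult[OF x smooth_near_const sm] tangent_const[OF x] by simp
    finally show ?thesis
      unfolding metric_parallel[OF x field_near_connection[OF E Z(1)] Z(1)] Z(2) .
  qed
  let ?a = "D p u (\<lambda>q. D q (Y q) Z)" and ?b = "D p v (\<lambda>q. D q (X q) Z)" and ?c = "D p (lie_bracket A X Y p) Z"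
  have t: "?a \<in> tangent_space A p" "?b \<in> tangent_space A p" "?c \<in> tangent_space A p"
    by (intro connection_tangent u v lie_bracket_tangent field_near_connection X(1) Y(1) Z(1))+
  have "2 * g p ?c w = lie_bracket A X Y p h"
    unfolding first[OF lie_bracket_tangent[OF X(1) Y(1)] Z(1)] Z(2) ..
  also have "\<dots> = u (\<lambda>q. Y q h) - v (\<lambda>q. X q h)" using hs X(2) Y(2) by (simp add: lie_bracket_def)
  also have "\<dots> = 2 * (g p ?a w + g p (D p v Z) (D p u Z)) - 2 * (g p ?b w + g p (D p u Z) (D p v Z))"
    unfolding second[OF u Y(1)] second[OF v X(1)] X(2) Y(2) ..
  also have "\<dots> = 2 * g p ?a w - 2 * g p ?b w"
    using metric_sym[OF connection_tangent[OF u Z(1)] connection_tangent[OF v Z(1)]] by simp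
  finally have e: "g p ?a w - g p ?b w - g p ?c w = 0" by simp
  have "curvature_operator X Y Z p = 1 *\<^sub>R ?a + (-1) *\<^sub>R (1 *\<^sub>R ?b + 1 *\<^sub>R ?c)"
    unfolding curvature_operator_def X(2) Y(2) by (simp only: scaleR_one scaleR_minus1_left) simp
  then show "g p (curvature A D p u v w) w = 0"
    unfolding R using e t
      metric_apply[OF t(1) subspace_add[OF subspace_tangent_space t(2,3)] w, of 1 "-1"]
      metric_apply[OF t(2,3) w, of 1 1] by simp
qed

end

section \<open>Jacobi fields on Sasakian manifolds\<close>

locale webster_geodesic = webster_manifold A D m H J \<theta> \<xi> + connection_curve A D I \<gamma>
  for A :: "('a::{t2_space,second_countable_topology}, 'n::finite) chart set"
    and D m H J \<theta> \<xi> I \<gamma> +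
  assumes sas: "sasakian A \<xi> D"
    and geo: "\<And>t. t \<in> I \<Longrightarrow> cov vel t = 0"
    and unit: "\<And>t. t \<in> I \<Longrightarrow> g (\<gamma> t) (vel t) (vel t) = 1"
    and interval: "is_interval I" and start: "0 \<in> I" "I \<subseteq> {0..}"
begin

lemma initial_subinterval: "t \<in> I \<Longrightarrow> {0..t} \<subseteq> I"
  using interval[unfolded is_interval_1, rule_format, OF start(1), of t] by auto

lemma along_vel: "along vel"
  by (rule along_velocity[OF domain curve])

lemma along_reeb: "along (\<lambda>s. \<xi> (\<gamma> s))"
  by (rule along_pullback[OF domain curve open_UNIV reeb_vector_field]) simp

lemma cov_reeb: "t \<in> I \<Longrightarrow> cov (\<lambda>s. \<xi> (\<gamma> s)) t = 0"
  using cov_pullback[OF reeb_vector_field] reeb_parallel[OF vel_tangent] by simp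

lemma metric_along_derivative:
  assumes V: "along V" and Z: "along Z" and t: "t \<in> I"
  shows "((\<lambda>s. g (\<gamma> s) (V s) (Z s)) has_vector_derivative
     g (\<gamma> t) (cov V t) (Z t) + g (\<gamma> t) (V t) (cov Z t)) (at t within I)"
  by (rule parallel_form_derivative[where b = g,
        OF metric_linear metric_linear_right metric_smooth metric_parallel V Z t])

lemma metric_velocity_derivative:
  assumes V: "along V" and t: "t \<in> I"
  shows "((\<lambda>s. g (\<gamma> s) (V s) (vel s)) has_vector_derivative g (\<gamma> t) (cov V t) (vel t)) (at t within I)"
  using metric_along_derivative[OF V along_vel t] metric_zero(2)[OF along_tangent[OF V t]]
  by (simp add: geo[OF t])

lemma reeb_component_constant: "t \<in> I \<Longrightarrow> g (\<gamma> t) (\<xi> (\<gamma> t)) (vel t) = g (\<gamma> 0) (\<xi> (\<gamma> 0)) (vel 0)"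
proof -
  assume t: "t \<in> I"
  have "((\<lambda>s. g (\<gamma> s) (\<xi> (\<gamma> s)) (vel s)) has_vector_derivative 0) (at s within I)" if "s \<in> I" for s
    using metric_velocity_derivative[OF along_reeb that] metric_zero(1)[OF vel_tangent[OF that]]
    by (simp add: cov_reeb[OF that])
  then obtain c where "\<And>s. s \<in> I \<Longrightarrow> g (\<gamma> s) (\<xi> (\<gamma> s)) (vel s) = c"
    using has_vector_derivative_zero_constant[OF is_interval_convex[OF interval],
        of "\<lambda>s. g (\<gamma> s) (\<xi> (\<gamma> s)) (vel s)"] by blast
  from this[OF t] this[OF start(1)] show ?thesis by simp
qed

lemma omega_along_smooth:
  assumes V: "along V"
  shows "smooth_on I (\<lambda>s. \<omega> (\<gamma> s) (vel s) (V s))"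
  by (rule bilinear_form_along_smooth[where b = \<omega>,
        OF omega_linear omega_linear_right omega_smooth along_vel V])

text \<open>The pairing of the Jacobi equation with the velocity, integrated twice: the difference of
\<open>\<langle>\<nabla>V, \<gamma>'\<rangle>\<close> and \<open>2 \<kappa> w\<close> is the constant \<open>b\<close>, where \<open>w = d\<theta>(\<gamma>', V)\<close> is the function in the torsion.\<close>

lemma jacobi_velocity_component:
  assumes V: "jacobi_field A D I \<gamma> V"
  shows "\<exists>a b. \<forall>t\<in>I. g (\<gamma> t) (V t) (vel t) = a + b * t
     + 2 * g (\<gamma> 0) (\<xi> (\<gamma> 0)) (vel 0) * integral {0..t} (\<lambda>s. \<omega> (\<gamma> s) (vel s) (V s))"
proof -
  define \<kappa> where "\<kappa> = g (\<gamma> 0) (\<xi> (\<gamma> 0)) (vel 0)"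
  define w where "w = (\<lambda>s. \<omega> (\<gamma> s) (vel s) (V s))"
  have Va: "along V"
    and Ve: "\<And>t. t \<in> I \<Longrightarrow> cov (cov V) t = curvature A D (\<gamma> t) (vel t) (V t) (vel t)
        + cov (\<lambda>s. torsion A D (\<gamma> s) (vel s) (V s)) t"
    using V unfolding jacobi_field_def by blast+
  note cVa = cov_along_curve[OF Va]
  have w: "smooth_on I w" unfolding w_def by (rule omega_along_smooth[OF Va])
  let ?w' = "\<lambda>t. dt w t"
  have dw: "(w has_vector_derivative ?w' t) (at t within I)" if "t \<in> I" for t
    by (rule smooth_on_has_vector_derivative[OF domain w that])
  have w2: "smooth_on I (\<lambda>s. 2 * w s)" by (rule smooth_on_mult[OF smooth_on_const w])
  have torsion_cov: "cov (\<lambda>s. torsion A D (\<gamma> s) (vel s) (V s)) t = (2 * ?w' t) *\<^sub>R \<xi> (\<gamma> t)" if t: "t \<in> I" for t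
  proof -
    have "cov (\<lambda>s. torsion A D (\<gamma> s) (vel s) (V s)) t = cov (\<lambda>s. (2 * w s) *\<^sub>R \<xi> (\<gamma> s)) t"
      unfolding w_def by (rule cov_cong, rule sasakian_torsion[OF sas vel_tangent along_tangent[OF Va]])
    also have "\<dots> = dt (\<lambda>s. 2 * w s) t *\<^sub>R \<xi> (\<gamma> t)"
      unfolding cov_scale[OF w2 along_reeb t] cov_reeb[OF t] by (simp only: scaleR_zero_right add_0_right)
    also have "dt (\<lambda>s. 2 * w s) t = 2 * ?w' t"
      using has_vector_derivative_mult[OF has_vector_derivative_const dw[OF t], of 2]
      by (intro vector_derivative_eq[OF t]) simp
    finally show ?thesis .
  qed
  have second: "((\<lambda>s. g (\<gamma> s) (cov V s) (vel s)) has_vector_derivative 2 * \<kappa> * ?w' t) (at t within I)"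
    if t: "t \<in> I" for t
  proof -
    let ?R = "curvature A D (\<gamma> t) (vel t) (V t) (vel t)"
    note v = vel_tangent[OF t]
    note R = curvature_metric_zero[OF v along_tangent[OF Va t] v]
    have "cov (cov V) t = 1 *\<^sub>R ?R + (2 * ?w' t) *\<^sub>R \<xi> (\<gamma> t)"
      unfolding Ve[OF t] torsion_cov[OF t] by (simp only: scaleR_one)
    then have "g (\<gamma> t) (cov (cov V) t) (vel t) = 2 * \<kappa> * ?w' t"
      using metric_apply[OF R(2) reeb_tangent v, of 1 "2 * ?w' t"] R(1) reeb_component_constant[OF t]
      by (simp add: \<kappa>_def)
    then show ?thesis using metric_velocity_derivative[OF cVa t] by simp
  qed
  have "((\<lambda>s. g (\<gamma> s) (cov V s) (vel s) - 2 * \<kappa> * w s) has_vector_derivative 0) (at t within I)"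
    if t: "t \<in> I" for t
    using has_vector_derivative_diff[OF second[OF t] has_vector_derivative_mult[OF has_vector_derivative_const dw[OF t], of "2 * \<kappa>"]]
    by simp
  then obtain b where b: "\<And>t. t \<in> I \<Longrightarrow> g (\<gamma> t) (cov V t) (vel t) - 2 * \<kappa> * w t = b"
    using has_vector_derivative_zero_constant[OF is_interval_convex[OF interval],
        of "\<lambda>s. g (\<gamma> s) (cov V s) (vel s) - 2 * \<kappa> * w s"] by blast
  define a where "a = g (\<gamma> 0) (V 0) (vel 0)"
  have "g (\<gamma> t) (V t) (vel t) = a + b * t + 2 * \<kappa> * integral {0..t} w" if t: "t \<in> I" for t
  proof -
    have t0: "0 \<le> t" using t start(2) by auto
    have sub: "{0..t} \<subseteq> I" by (rule initial_subinterval[OF t])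
    \<comment> \<open>the same integral, computed once by the fundamental theorem and once termwise\<close>
    have "((\<lambda>s. b + 2 * \<kappa> * w s) has_integral g (\<gamma> t) (V t) (vel t) - g (\<gamma> 0) (V 0) (vel 0)) {0..t}"
    proof (rule fundamental_theorem_of_calculus[OF t0])
      fix s assume s: "s \<in> {0..t}"
      then have sI: "s \<in> I" using sub by blast
      have "((\<lambda>s. g (\<gamma> s) (V s) (vel s)) has_vector_derivative b + 2 * \<kappa> * w s) (at s within I)"
        using metric_velocity_derivative[OF Va sI] b[OF sI] by (simp add: algebra_simps)
      then show "((\<lambda>s. g (\<gamma> s) (V s) (vel s)) has_vector_derivative b + 2 * \<kappa> * w s) (at s within {0..t})"
        by (rule has_vector_derivative_within_subset[OF _ sub])
    qed
    moreover have "((\<lambda>s. b + 2 * \<kappa> * w s) has_integral b * t + 2 * \<kappa> * integral {0..t} w) {0..t}"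
    proof (rule has_integral_add)
      show "((\<lambda>s. b) has_integral b * t) {0..t}"
        using has_integral_const_real[of b 0 t] t0 by (simp add: mult.commute)
      have "continuous_on I w"
        unfolding continuous_on_eq_continuous_within
        by (intro ballI has_vector_derivative_continuous[OF dw])
      then have "w integrable_on {0..t}"
        by (intro integrable_continuous_real continuous_on_subset[OF _ sub])
      then show "((\<lambda>s. 2 * \<kappa> * w s) has_integral 2 * \<kappa> * integral {0..t} w) {0..t}"
        by (intro has_integral_mult_right integrable_integral)
    qed
    ultimately have "g (\<gamma> t) (V t) (vel t) - g (\<gamma> 0) (V 0) (vel 0) = b * t + 2 * \<kappa> * integral {0..t} w"
      by (rule has_integral_unique)
    then show ?thesis by (simp add: a_def)
  qed
  then show ?thesis unfolding \<kappa>_def w_def by blast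
qed

text \<open>An affine function times \<open>\<gamma>'\<close> has vanishing second covariant derivative, and it enters neither the
curvature nor the torsion term because both vanish on \<open>(\<gamma>', \<gamma>')\<close>.\<close>

lemma jacobi_add_affine_velocity:
  assumes V: "jacobi_field A D I \<gamma> V" and W: "\<And>t. t \<in> I \<Longrightarrow> W t = V t + (a + b * t) *\<^sub>R vel t"
  shows "jacobi_field A D I \<gamma> W"
proof -
  have Va: "along V"
    and Ve: "\<And>t. t \<in> I \<Longrightarrow> cov (cov V) t = curvature A D (\<gamma> t) (vel t) (V t) (vel t)
        + cov (\<lambda>s. torsion A D (\<gamma> s) (vel s) (V s)) t"
    using V unfolding jacobi_field_def by blast+
  have c: "smooth_on I (\<lambda>t. a + b * t)"
    by (intro smooth_on_add smooth_on_const smooth_on_linear bounded_linear_mult_right)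
  have dc: "dt (\<lambda>t. a + b * t) t = b" if "t \<in> I" for t
    by (rule vector_derivative_eq[OF that]) (auto intro!: derivative_eq_intros simp: has_real_derivative_iff_has_vector_derivative[symmetric])
  have d0: "dt (\<lambda>t. b) t = 0" if "t \<in> I" for t
    by (rule vector_derivative_eq[OF that has_vector_derivative_const])
  note cv = along_scale[OF c along_vel] and bv = along_scale[OF smooth_on_const along_vel]
  have Wa: "along W"
    by (rule along_cong[OF along_add[OF Va cv]]) (rule W[symmetric])
  have covW: "cov W t = cov V t + b *\<^sub>R vel t" if t: "t \<in> I" for t
  proof -
    have "cov W t = cov (\<lambda>s. V s + (a + b * s) *\<^sub>R vel s) t" by (rule cov_cong) (rule W)
    then show ?thesis
      unfolding cov_add[OF Va cv t] cov_scale[OF c along_vel t] dc[OF t] geo[OF t]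
      by (simp only: scaleR_zero_right add_0_right)
  qed
  have covcovW: "cov (cov W) t = cov (cov V) t" if t: "t \<in> I" for t
  proof -
    have "cov (cov W) t = cov (\<lambda>s. cov V s + b *\<^sub>R vel s) t" by (rule cov_cong) (rule covW)
    then show ?thesis
      unfolding cov_add[OF cov_along_curve[OF Va] bv t] cov_scale[OF smooth_on_const along_vel t] d0[OF t] geo[OF t]
      by (simp only: scaleR_zero_right scaleR_zero_left add_0_right)
  qed
  have tor: "torsion A D (\<gamma> s) (vel s) (W s) = torsion A D (\<gamma> s) (vel s) (V s)" if s: "s \<in> I" for s
  proof -
    note v = vel_tangent[OF s] and Vt = along_tangent[OF Va s]
    have "\<omega> (\<gamma> s) (vel s) (vel s) = 0" using omega_antisym[OF v v] by simp
    then have "\<omega> (\<gamma> s) (vel s) (W s) = \<omega> (\<gamma> s) (vel s) (V s)"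
      using omega_apply_right[OF Vt v v, of 1 "a + b * s"] by (simp add: W[OF s])
    then show ?thesis
      unfolding sasakian_torsion[OF sas v along_tangent[OF Wa s]] sasakian_torsion[OF sas v Vt] by (simp only:)
  qed
  show ?thesis
    unfolding jacobi_field_def
  proof (intro conjI ballI Wa)
    fix t assume t: "t \<in> I"
    note v = vel_tangent[OF t]
    have R: "curvature A D (\<gamma> t) (vel t) (W t) (vel t) = curvature A D (\<gamma> t) (vel t) (V t) (vel t)"
      unfolding W[OF t] by (rule curvature_shift[OF v along_tangent[OF Va t] v])
    have T: "cov (\<lambda>s. torsion A D (\<gamma> s) (vel s) (W s)) t = cov (\<lambda>s. torsion A D (\<gamma> s) (vel s) (V s)) t"
      by (rule cov_cong) (rule tor)
    show "cov (cov W) t = curvature A D (\<gamma> t) (vel t) (W t) (vel t)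
        + cov (\<lambda>s. torsion A D (\<gamma> s) (vel s) (W s)) t"
      unfolding covcovW[OF t] R T by (rule Ve[OF t])
  qed
qed

definition decomposition :: "(real \<Rightarrow> 'a tvec) \<Rightarrow> real \<Rightarrow> real \<Rightarrow> (real \<Rightarrow> 'a tvec) \<Rightarrow> bool" where
  "decomposition V a b W \<longleftrightarrow> jacobi_field A D I \<gamma> W \<and>
     (\<forall>t\<in>I. V t = a *\<^sub>R vel t + (b * t) *\<^sub>R vel t + W t) \<and>
     (\<forall>t\<in>I. g (\<gamma> t) (W t) (vel t)
        = 2 * g (\<gamma> t) (\<xi> (\<gamma> t)) (vel t) * integral {0..t} (\<lambda>s. g (\<gamma> s) (V s) (J' (\<gamma> s) (vel s))))"

lemma metric_affine:
  assumes Va: "along V" and t: "t \<in> I"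
  shows "g (\<gamma> t) (V t + c *\<^sub>R vel t) (vel t) = g (\<gamma> t) (V t) (vel t) + c"
  using metric_apply[OF along_tangent[OF Va t] vel_tangent[OF t] vel_tangent[OF t], of 1 c] unit[OF t] by simp

lemma jacobi_decomposition_exists:
  assumes V: "jacobi_field A D I \<gamma> V"
  shows "\<exists>a b W. decomposition V a b W"
proof -
  have Va: "along V" using V unfolding jacobi_field_def by blast
  obtain a b where ab: "\<forall>t\<in>I. g (\<gamma> t) (V t) (vel t) = a + b * t
     + 2 * g (\<gamma> 0) (\<xi> (\<gamma> 0)) (vel 0) * integral {0..t} (\<lambda>s. \<omega> (\<gamma> s) (vel s) (V s))"
    using jacobi_velocity_component[OF V] by blast
  define W where "W = (\<lambda>t. V t + (- a + - b * t) *\<^sub>R vel t)"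
  have "jacobi_field A D I \<gamma> W"
    by (rule jacobi_add_affine_velocity[OF V]) (simp only: W_def)
  moreover have "V t = a *\<^sub>R vel t + (b * t) *\<^sub>R vel t + W t" if "t \<in> I" for t
    unfolding W_def by (simp only: scaleR_add_left scaleR_minus_left mult_minus_left) simp
  moreover have "g (\<gamma> t) (W t) (vel t)
        = 2 * g (\<gamma> t) (\<xi> (\<gamma> t)) (vel t) * integral {0..t} (\<lambda>s. g (\<gamma> s) (V s) (J' (\<gamma> s) (vel s)))" if t: "t \<in> I" for t
  proof -
    have "integral {0..t} (\<lambda>s. g (\<gamma> s) (V s) (J' (\<gamma> s) (vel s))) = integral {0..t} (\<lambda>s. \<omega> (\<gamma> s) (vel s) (V s))"
      by (rule integral_cong, rule metric_J[OF vel_tangent along_tangent[OF Va]])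
         (use initial_subinterval[OF t] in auto)
    then show ?thesis
      unfolding W_def metric_affine[OF Va t] reeb_component_constant[OF t] using ab t by simp
  qed
  ultimately show ?thesis unfolding decomposition_def by blast
qed

text \<open>Pairing with the unit vector \<open>\<gamma>'\<close> determines \<open>a + b t\<close> for all \<open>t\<close> in \<open>I\<close>; the interval contains \<open>0\<close> and,
being nondegenerate, another point.\<close>

lemma jacobi_decomposition_unique:
  assumes V: "jacobi_field A D I \<gamma> V"
    and 1: "decomposition V a b W" and 2: "decomposition V a' b' W'"
  shows "a' = a \<and> b' = b \<and> (\<forall>t\<in>I. W' t = W t)"
proof -
  have coef: "a + b * t = g (\<gamma> t) (V t) (vel t)
      - 2 * g (\<gamma> t) (\<xi> (\<gamma> t)) (vel t) * integral {0..t} (\<lambda>s. g (\<gamma> s) (V s) (J' (\<gamma> s) (vel s)))"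
    if d: "decomposition V a b W" and t: "t \<in> I" for a b W t
  proof -
    have Wa: "along W" using d unfolding decomposition_def jacobi_field_def by blast
    have "V t = a *\<^sub>R vel t + (b * t) *\<^sub>R vel t + W t" using d t unfolding decomposition_def by blast
    also have "\<dots> = W t + (a + b * t) *\<^sub>R vel t" by (simp only: scaleR_add_left add_ac)
    finally have "g (\<gamma> t) (V t) (vel t) = g (\<gamma> t) (W t) (vel t) + (a + b * t)"
      using metric_affine[OF Wa t, of "a + b * t"] by (simp only:)
    moreover have "g (\<gamma> t) (W t) (vel t)
        = 2 * g (\<gamma> t) (\<xi> (\<gamma> t)) (vel t) * integral {0..t} (\<lambda>s. g (\<gamma> s) (V s) (J' (\<gamma> s) (vel s)))"
      using d t unfolding decomposition_def by blast
    ultimately show ?thesis by linarith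
  qed
  have eq: "a' + b' * t = a + b * t" if "t \<in> I" for t
    unfolding coef[OF 1 that] coef[OF 2 that] ..
  have a: "a' = a" using eq[OF start(1)] by simp
  obtain t where t: "t \<in> I" "t \<noteq> 0"
    using domain[unfolded derivative_domain_def, rule_format, OF start(1), of 1 1] by auto
  have b: "b' = b" using eq[OF t(1)] t(2) a by simp
  have "W' t = W t" if t: "t \<in> I" for t
  proof -
    have "a *\<^sub>R vel t + (b * t) *\<^sub>R vel t + W t = V t" "a *\<^sub>R vel t + (b * t) *\<^sub>R vel t + W' t = V t"
      using 1 2 t unfolding decomposition_def a b by metis+
    then show ?thesis by (metis add_left_imp_eq)
  qed
  with a b show ?thesis by blast
qed

lemma decomposition_perpendicular:
  assumes d: "decomposition V a b W"
    and c: "(\<forall>t\<in>I. g (\<gamma> t) (\<xi> (\<gamma> t)) (vel t) = 0) \<or> (\<forall>t\<in>I. g (\<gamma> t) (V t) (J' (\<gamma> t) (vel t)) = 0)"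
    and t: "t \<in> I"
  shows "g (\<gamma> t) (W t) (vel t) = 0"
proof -
  have W: "g (\<gamma> t) (W t) (vel t)
        = 2 * g (\<gamma> t) (\<xi> (\<gamma> t)) (vel t) * integral {0..t} (\<lambda>s. g (\<gamma> s) (V s) (J' (\<gamma> s) (vel s)))"
    using d t unfolding decomposition_def by blast
  from c show ?thesis
  proof
    assume "\<forall>t\<in>I. g (\<gamma> t) (V t) (J' (\<gamma> t) (vel t)) = 0"
    then have "integral {0..t} (\<lambda>s. g (\<gamma> s) (V s) (J' (\<gamma> s) (vel s))) = integral {0..t} (\<lambda>s. 0)"
      using initial_subinterval[OF t] by (intro integral_cong) blast
    then show ?thesis unfolding W by simp
  qed (use W t in simp)
qed

end

theorem theorem3p2:
  fixes A :: "('a::{t2_space,second_countable_topology}, 'n::finite) chart set"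
    and m :: nat
    and H :: "'a \<Rightarrow> 'a tvec set"
    and J :: "'a \<Rightarrow> 'a tvec \<Rightarrow> 'a tvec"
    and \<theta> :: "'a \<Rightarrow> 'a tvec \<Rightarrow> real"
    and \<xi> :: "'a vfield"
    and D :: "'a connection"
    and I :: "real set"
    and \<gamma> :: "real \<Rightarrow> 'a"
    and V :: "real \<Rightarrow> 'a tvec"
  assumes "pseudo_hermitian A m H J \<theta>"
    and "reeb_field A \<theta> \<xi>"
    and "tanaka_webster A H J \<theta> \<xi> D"
    and "sasakian A \<xi> D"
    and "complete_connection A D"
    and "geodesic A D I \<gamma>" and "0 \<in> I" and "I \<subseteq> {0..}"
    and "\<forall>t\<in>I. webster_metric A J \<theta> \<xi> (\<gamma> t) (velocity A I \<gamma> t) (velocity A I \<gamma> t) = 1"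
    and "jacobi_field A D I \<gamma> V"
  shows "let g = (\<lambda>t. webster_metric A J \<theta> \<xi> (\<gamma> t));
             \<gamma>' = velocity A I \<gamma>;
             J\<gamma>' = (\<lambda>t. extended_J J \<theta> \<xi> (\<gamma> t) (\<gamma>' t));
             decomposition = (\<lambda>a b W.
               jacobi_field A D I \<gamma> W \<and>
               (\<forall>t\<in>I. V t = a *\<^sub>R \<gamma>' t + (b * t) *\<^sub>R \<gamma>' t + W t) \<and>
               (\<forall>t\<in>I. g t (W t) (\<gamma>' t)
                  = 2 * g t (\<xi> (\<gamma> t)) (\<gamma>' t) * integral {0..t} (\<lambda>s. g s (V s) (J\<gamma>' s))))
         in (\<exists>a b W. decomposition a b W \<and>
               (\<forall>a' b' W'. decomposition a' b' W' \<longrightarrow> a' = a \<and> b' = b \<and> (\<forall>t\<in>I. W' t = W t))) \<and>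
            (\<forall>a b W. decomposition a b W \<and>
               ((\<forall>t\<in>I. g t (\<xi> (\<gamma> t)) (\<gamma>' t) = 0) \<or> (\<forall>t\<in>I. g t (V t) (J\<gamma>' t) = 0)) \<longrightarrow>
               (\<forall>t\<in>I. g t (W t) (\<gamma>' t) = 0))"
proof -
  interpret webster_geodesic A D m H J \<theta> \<xi> I \<gamma>
  proof unfold_locales
    show "smooth_atlas A" using assms(1) unfolding pseudo_hermitian_def by blast
    show "linear_connection A D" using assms(3) unfolding tanaka_webster_def by blast
    show "derivative_domain I"
      by (rule derivative_domain_interval) (use assms(6) in \<open>auto simp: geodesic_def\<close>)
    show "smooth_curve A I \<gamma>" "is_interval I" using assms(6) unfolding geodesic_def by blast+
    show "cov_along A D I \<gamma> (velocity A I \<gamma>) t = 0" if "t \<in> I" for t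
      using assms(6) that unfolding geodesic_def by blast
    show "webster_metric A J \<theta> \<xi> (\<gamma> t) (velocity A I \<gamma> t) (velocity A I \<gamma> t) = 1" if "t \<in> I" for t
      using assms(9) that by blast
  qed (rule assms)+
  obtain a b W where d: "decomposition V a b W"
    using jacobi_decomposition_exists[OF assms(10)] by blast
  have ex: "\<exists>a b W. decomposition V a b W \<and>
      (\<forall>a' b' W'. decomposition V a' b' W' \<longrightarrow> a' = a \<and> b' = b \<and> (\<forall>t\<in>I. W' t = W t))"
    using d jacobi_decomposition_unique[OF assms(10) d]
    by (intro exI[of _ a] exI[of _ b] exI[of _ W]) blast
  have perp: "\<forall>a b W. decomposition V a b W \<and>
      ((\<forall>t\<in>I. g (\<gamma> t) (\<xi> (\<gamma> t)) (vel t) = 0) \<or> (\<forall>t\<in>I. g (\<gamma> t) (V t) (J' (\<gamma> t) (vel t)) = 0)) \<longrightarrow>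
      (\<forall>t\<in>I. g (\<gamma> t) (W t) (vel t) = 0)"
    using decomposition_perpendicular by blast
  show ?thesis
    unfolding Let_def by (rule conjI[OF ex perp, unfolded decomposition_def])
qed

end
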